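(* Let $\mathbb{K}=\mathbb{Q}(q,\nu,w)$, let $Y_1=1+O(t)$ and $Y_2=\frac{s}{w(\nu-1)}+O(t)$ be the two series of $\mathbb{K}(s)[[t]]$ satisfying $K(1+ts,Y_i)=0$ (kernel $K$ below), and let $I(y)=wtyqM(1,y)+\frac{y-1}{y}+\frac{ty}{y-1}$. Let $d\in\mathbb{N}$ and let $H(y)\in\mathbb{K}(y)((t))$ have valuation at least $-d$ in $(y-1)$, i.e. each coefficient $[t^n]H(y)$ is a rational function of $y$ that either has no pole at $y=1$ or has a pole of multiplicity at most $d$ there. Then $H(Y_1)$ and $H(Y_2)$ are well-defined elements of $\mathbb{K}(s)((t))$. If moreover $H(Y_1)=H(Y_2)$, then there exist Laurent series $A_0,\dots,A_d\in\mathbb{K}((t))$ such that $H(y)=\sum_{i=0}^d A_i\,I(y)^i$.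
   Context: Planar maps are connected planar graphs properly embedded in the oriented sphere up to orientation-preserving homeomorphism (loops and multiple edges allowed), rooted by a distinguished corner whose vertex/face are the root-vertex/root-face; degrees count edges with multiplicity; the atomic map is included; $e,v,f$ count edges, vertices, faces; $d_v,d_f$ are root-vertex and root-face degrees. The Potts polynomial is $P_G(q,\nu)=\sum_{c:V(G)\to\{1,\dots,q\}}\nu^{m(c)}$, $m(c)$ = number of monochromatic edges (loops always monochromatic), viewed as a polynomial in $q,\nu$. $M(x,y)=M(q,\nu,t,w,1;x,y)$, where $M(q,\nu,t,w,z;x,y)=\frac1q\sum_{M}t^{e(M)}w^{v(M)-1}z^{f(M)-1}x^{d_v(M)}y^{d_f(M)}P_M(q,\nu)$ over rooted planar maps. The kernel is $K(x,y)=1-\frac{x^2ywt(\nu-1)}{x-1}-\frac{xy^2t}{y-1}-xyt(x\nu-1)M(x,1)-xywt((\nu-1)(y-1)+qy)M(1,y)$; $s$ is an indeterminate. A series in $t$ with rational coefficients in $y$ is extended here to Laurent series in $t$ ($\mathbb{K}(y)((t))$). *)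

theory Defs
  imports "HOL-Analysis.Analysis" "HOL-Combinatorics.Permutations"
    "HOL-Computational_Algebra.Formal_Laurent_Series"
    "HOL-Computational_Algebra.Fraction_Field"
begin

section \<open>Fields of coefficients\<close>

text \<open>kp = Q[q][nu][w] (q innermost, then nu, then w outermost).
  K = Q(q,nu,w) is its fraction field.  Kr = K(z), rational functions in one
  indeterminate over K; used both for K(y) and for K(s).\<close>

type_synonym kp = "rat poly poly poly"
type_synonym K = "kp fract"
type_synonym Kr = "K poly fract"

definition qK :: K where "qK = Fract [:[:[:0, 1:]:]:] 1"
definition nuK :: K where "nuK = Fract [:[:0, 1:]:] 1"
definition wK :: K where "wK = Fract [:0, 1:] 1"

text \<open>constant embedding K -> K(z), and the indeterminate z of K(z)\<close>
definition cK :: "K \<Rightarrow> Kr" where "cK c = Fract [:c:] 1"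
definition zK :: Kr where "zK = Fract [:0, 1:] 1"

section \<open>Rooted planar maps as rooted combinatorial maps\<close>

text \<open>A map with e edges is encoded by a rotation system on the dart set
  {0..<2e}: sigma (vertex rotation) and alpha (fixed-point-free involution,
  the edges). Vertices = sigma-orbits, faces = (sigma o alpha)-orbits.
  The root corner is the corner attached to dart 0.\<close>

definition orb :: "(nat \<Rightarrow> nat) \<Rightarrow> nat \<Rightarrow> nat set" where
  "orb f x = {(f ^^ k) x | k. True}"

definition darts :: "nat \<Rightarrow> nat set" where "darts e = {0..<2 * e}"

definition nverts :: "nat \<Rightarrow> (nat \<Rightarrow> nat) \<times> (nat \<Rightarrow> nat) \<Rightarrow> nat" where
  "nverts e m = card (orb (fst m) ` darts e)"

definition nfaces :: "nat \<Rightarrow> (nat \<Rightarrow> nat) \<times> (nat \<Rightarrow> nat) \<Rightarrow> nat" where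
  "nfaces e m = card (orb (fst m \<circ> snd m) ` darts e)"

definition root_vdeg :: "(nat \<Rightarrow> nat) \<times> (nat \<Rightarrow> nat) \<Rightarrow> nat" where
  "root_vdeg m = card (orb (fst m) 0)"

definition root_fdeg :: "(nat \<Rightarrow> nat) \<times> (nat \<Rightarrow> nat) \<Rightarrow> nat" where
  "root_fdeg m = card (orb (fst m \<circ> snd m) 0)"

definition is_planar_map :: "nat \<Rightarrow> (nat \<Rightarrow> nat) \<times> (nat \<Rightarrow> nat) \<Rightarrow> bool" where
  "is_planar_map e m \<longleftrightarrow>
     (let D = darts e; \<sigma> = fst m; \<alpha> = snd m in
        \<sigma> permutes D \<and> \<alpha> permutes D \<and>
        (\<forall>d\<in>D. \<alpha> d \<noteq> d \<and> \<alpha> (\<alpha> d) = d) \<and>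
        (\<forall>d\<in>D. (0, d) \<in> ({(x, \<sigma> x) | x. x \<in> D} \<union> {(x, \<alpha> x) | x. x \<in> D})\<^sup>*) \<and>
        int (nverts e m) - int e + int (nfaces e m) = 2)"

text \<open>isomorphism of rooted maps: relabelling of darts fixing the root dart\<close>
definition map_iso :: "nat \<Rightarrow> (((nat \<Rightarrow> nat) \<times> (nat \<Rightarrow> nat)) \<times> ((nat \<Rightarrow> nat) \<times> (nat \<Rightarrow> nat))) set" where
  "map_iso e = {((\<sigma>, \<alpha>), (\<sigma>', \<alpha>')). \<exists>\<pi>. \<pi> permutes darts e \<and> \<pi> 0 = 0 \<and>
       \<sigma>' = \<pi> \<circ> \<sigma> \<circ> inv \<pi> \<and> \<alpha>' = \<pi> \<circ> \<alpha> \<circ> inv \<pi>}"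

text \<open>rooted planar maps with e >= 1 edges (isomorphism classes)\<close>
definition rooted_maps :: "nat \<Rightarrow> ((nat \<Rightarrow> nat) \<times> (nat \<Rightarrow> nat)) set set" where
  "rooted_maps e = {m. is_planar_map e m} // map_iso e"

section \<open>Potts polynomial\<close>

text \<open>colourings of the vertices (sigma-orbits) with colours 1..n,
  represented as functions on darts constant on vertices\<close>
definition colourings :: "nat \<Rightarrow> (nat \<Rightarrow> nat) \<times> (nat \<Rightarrow> nat) \<Rightarrow> nat \<Rightarrow> (nat \<Rightarrow> nat) set" where
  "colourings e m n = {c. (\<forall>d\<in>darts e. c d \<in> {1..n} \<and> c (fst m d) = c d) \<and>
                           (\<forall>d. d \<notin> darts e \<longrightarrow> c d = 0)}"

text \<open>number of monochromatic edges (edge = alpha-orbit {d, alpha d}, d < alpha d)\<close>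
definition mono_edges :: "nat \<Rightarrow> (nat \<Rightarrow> nat) \<times> (nat \<Rightarrow> nat) \<Rightarrow> (nat \<Rightarrow> nat) \<Rightarrow> nat" where
  "mono_edges e m c = card {d \<in> darts e. d < snd m d \<and> c d = c (snd m d)}"

text \<open>Potts polynomial in Q[q][nu]: the polynomial whose value at every positive
  integer q is the colouring sum\<close>
definition potts :: "nat \<Rightarrow> (nat \<Rightarrow> nat) \<times> (nat \<Rightarrow> nat) \<Rightarrow> rat poly poly" where
  "potts e m = (THE P. \<forall>n::nat. n \<ge> 1 \<longrightarrow>
       map_poly (\<lambda>c. poly c (of_nat n)) P = (\<Sum>c\<in>colourings e m n. monom 1 (mono_edges e m c)))"

section \<open>The generating function M\<close>

definition map_weight :: "nat \<Rightarrow> (nat \<Rightarrow> nat) \<times> (nat \<Rightarrow> nat) \<Rightarrow> K" where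
  "map_weight e m = wK ^ (nverts e m - 1) * Fract [:potts e m:] 1 / qK"

text \<open>[t^e] M(1,y) as a polynomial in y; the atomic map gives 1 at e = 0\<close>
definition M1y_coeff :: "nat \<Rightarrow> K poly" where
  "M1y_coeff e = (if e = 0 then 1 else
     (\<Sum>C\<in>rooted_maps e. let m = (SOME m. m \<in> C) in monom (map_weight e m) (root_fdeg m)))"

text \<open>[t^e] M(x,1) as a polynomial in x\<close>
definition Mx1_coeff :: "nat \<Rightarrow> K poly" where
  "Mx1_coeff e = (if e = 0 then 1 else
     (\<Sum>C\<in>rooted_maps e. let m = (SOME m. m \<in> C) in monom (map_weight e m) (root_vdeg m)))"

text \<open>M(1,y) and M(x,1) as elements of K(z)((t))\<close>
definition M1y :: "Kr fls" where
  "M1y = fps_to_fls (Abs_fps (\<lambda>e. Fract (M1y_coeff e) 1))"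
definition Mx1 :: "Kr fls" where
  "Mx1 = fps_to_fls (Abs_fps (\<lambda>e. Fract (Mx1_coeff e) 1))"

section \<open>Substitution of a series for the variable of K(z)((t))\<close>

definition kc :: "K \<Rightarrow> Kr fls" where "kc c = fls_const (cK c)"

definition peval :: "K poly \<Rightarrow> Kr fls \<Rightarrow> Kr fls" where
  "peval p Y = poly (map_poly kc p) Y"

definition rat_eval :: "Kr \<Rightarrow> Kr fls \<Rightarrow> Kr fls" where
  "rat_eval r Y = (SOME z. \<exists>a b. b \<noteq> 0 \<and> r = Fract a b \<and> peval b Y \<noteq> 0 \<and>
                             z = peval a Y / peval b Y)"

definition subst_terms :: "Kr fls \<Rightarrow> Kr fls \<Rightarrow> int \<Rightarrow> Kr fls" where
  "subst_terms H Y = (\<lambda>n. fls_X_intpow n * rat_eval (fls_nth H n) Y)"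

text \<open>H(Y) is well defined: every coefficient can be evaluated at Y and the
  resulting series sum_n t^n H_n(Y) converges (t-adically)\<close>
definition subst_wd :: "Kr fls \<Rightarrow> Kr fls \<Rightarrow> bool" where
  "subst_wd H Y \<longleftrightarrow> (\<forall>n. \<exists>a b. b \<noteq> 0 \<and> fls_nth H n = Fract a b \<and> peval b Y \<noteq> 0) \<and>
                     subst_terms H Y summable_on UNIV"

definition subst :: "Kr fls \<Rightarrow> Kr fls \<Rightarrow> Kr fls" where
  "subst H Y = infsum (subst_terms H Y) UNIV"

section \<open>Kernel, invariant I, embedding of K((t))\<close>

definition kernel :: "Kr fls \<Rightarrow> Kr fls \<Rightarrow> Kr fls" where
  "kernel X Y = 1
     - X^2 * Y * kc wK * fls_X * (kc nuK - 1) / (X - 1)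
     - X * Y^2 * fls_X / (Y - 1)
     - X * Y * fls_X * (X * kc nuK - 1) * subst Mx1 X
     - X * Y * kc wK * fls_X * ((kc nuK - 1) * (Y - 1) + kc qK * Y) * subst M1y Y"

text \<open>I(y) = w t y q M(1,y) + (y-1)/y + t y/(y-1) in K(y)((t))\<close>
definition Iinv :: "Kr fls" where
  "Iinv = fls_const (cK wK * cK qK * zK) * fls_X * M1y
          + fls_const ((zK - 1) / zK) + fls_X * fls_const (zK / (zK - 1))"

definition embK_fls :: "K fls \<Rightarrow> Kr fls" where
  "embK_fls A = Abs_fls (\<lambda>n. cK (fls_nth A n))"

end

theory Submission
  imports Defs "HOL-Combinatorics.Orbits"
begin

text \<open>
  Decomposing maps at their root edge gives Tutte's functional equation for \<open>M(x, y)\<close>. By deletion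
  and contraction, the Potts weight of a map is that of the map without the root edge, plus
  \<open>\<nu> - 1\<close> times that of the map with the root edge contracted. Deletion either disconnects the map
  (isthmus) or leaves a map with two marked corners in one face, and the contracted terms follow by
  duality. To avoid quotients by isomorphism, maps are counted with labelled darts: a rooted map has
  no nontrivial automorphism, so labelling is multiplication by a factorial, and products of
  generating functions become binomial convolutions.

  On the curve \<open>K(X, Y) = 0\<close> the coefficient of \<open>M(X, Y)\<close> in the functional equation vanishes. The
  two resulting equations express \<open>X I(Y)\<close> through \<open>X\<close> and \<open>M(X, 1)\<close> alone, so
  \<open>I(Y\<^sub>1) = I(Y\<^sub>2)\<close>. Since \<open>I\<close> has a simple pole at \<open>y = 1\<close> with coefficient \<open>t\<close>, subtracting
  multiples of powers of \<open>I\<close> removes the pole of \<open>H\<close>. The lowest coefficient of an invariant without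
  pole at \<open>1\<close> takes the same value at \<open>1\<close> and at \<open>s / (w (\<nu> - 1))\<close>, which is transcendental over
  \<open>K\<close>; hence it is constant, and so are all coefficients by induction.
\<close>

section \<open>Orbits\<close>

text \<open>The series M(x, y) in two variables is never formed. At X = 1 + ts its coefficients
  depend on t themselves, so the t that counts edges must be kept apart from the t inside X and Y.
  Map sums are therefore taken at arbitrary elements x, y of K(s)((t)), the functional equation is
  an identity of power series over this field in a separate variable \<open>fps_X\<close>, and
  \<open>t_sums\<close> then sets this variable to t. Euler's relation is needed as an inequality:
  when cutting an isthmus splits a planar map, only the total is known, and the bound on each part
  forces both to be planar. The divided differences come from the corner that receives the second
  end of the root edge: along a face of degree k (leg included) it closes off faces of degrees 1 to
  k. Deleting a loop takes two half-edges from the root vertex, so loops, and dually isthmuses,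
  bring correction terms. Since s does not lie in K, Y1 - 1 has valuation exactly 1 in t. A pole of
  order d at 1 thus costs at most t^(-d), uniformly in all coefficients of H, and H(Y1)
  converges.\<close>

definition perm_on :: "(nat \<Rightarrow> nat) \<Rightarrow> nat set \<Rightarrow> bool" where
  "perm_on p X \<longleftrightarrow> finite X \<and> bij_betw p X X"

abbreviation sw :: "nat \<Rightarrow> nat \<Rightarrow> nat \<Rightarrow> nat" where
  "sw \<equiv> Transposition.transpose"

definition cyc :: "(nat \<Rightarrow> nat) \<Rightarrow> nat set \<Rightarrow> nat" where
  "cyc p X = card (orb p ` X)"

definition closed_under :: "(nat \<Rightarrow> nat) \<Rightarrow> nat set \<Rightarrow> bool" where
  "closed_under p S \<longleftrightarrow> (\<forall>x\<in>S. p x \<in> S)"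

lemma orb_self: "x \<in> orb p x"
  unfolding orb_def by (metis (mono_tags, lifting) funpow_0 mem_Collect_eq)

lemma orb_step: "y \<in> orb p x \<Longrightarrow> p y \<in> orb p x"
  unfolding orb_def
proof -
  assume "y \<in> {(p ^^ k) x |k. True}"
  then obtain k where "y = (p ^^ k) x" by auto
  then have "p y = (p ^^ Suc k) x" by simp
  then show "p y \<in> {(p ^^ k) x |k. True}" by blast
qed

lemma orb_closed: "closed_under p (orb p x)"
  by (simp add: closed_under_def orb_step)

lemma orb_least:
  assumes "x \<in> S" "closed_under p S" shows "orb p x \<subseteq> S"
proof -
  have "(p ^^ k) x \<in> S" for k
    by (induction k) (use assms in \<open>auto simp: closed_under_def\<close>)
  then show ?thesis unfolding orb_def by auto
qed

lemma orb_cong: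
  assumes "x \<in> S" "closed_under p S" "\<And>y. y \<in> S \<Longrightarrow> p y = q y"
  shows "orb p x = orb q x"
proof -
  have "(p ^^ k) x = (q ^^ k) x \<and> (p ^^ k) x \<in> S" for k
  proof (induction k)
    case 0 then show ?case using assms by simp
  next
    case (Suc k)
    then have "p ((p ^^ k) x) = q ((p ^^ k) x)" "p ((p ^^ k) x) \<in> S"
      using assms(2,3) unfolding closed_under_def by blast+
    then show ?case using Suc by simp
  qed
  then show ?thesis unfolding orb_def by auto
qed

lemma perm_on_closed: "perm_on p X \<Longrightarrow> closed_under p X"
  by (auto simp: perm_on_def closed_under_def bij_betw_def)

lemma perm_on_finite: "perm_on p X \<Longrightarrow> finite X"
  by (simp add: perm_on_def)

lemma perm_on_inj: "perm_on p X \<Longrightarrow> x \<in> X \<Longrightarrow> y \<in> X \<Longrightarrow> p x = p y \<longleftrightarrow> x = y"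
  by (metis bij_betw_imp_inj_on inj_on_eq_iff perm_on_def)

lemma perm_on_orb_subset: "perm_on p X \<Longrightarrow> x \<in> X \<Longrightarrow> orb p x \<subseteq> X"
  using orb_least perm_on_closed by blast

lemma perm_onI:
  assumes "finite X" "closed_under p X" "inj_on p X" shows "perm_on p X"
  unfolding perm_on_def bij_betw_def
  using assms endo_inj_surj[of X p] by (auto simp: closed_under_def)

text \<open>The advantage of \<open>perm_on\<close> over \<open>permutes\<close>: nothing is asked
  outside the set, so one and the same function can be studied on a closed subset without being
  redefined.\<close>

lemma perm_on_subset:
  assumes "perm_on p X" "S \<subseteq> X" "closed_under p S" shows "perm_on p S"
  by (meson assms bij_betw_imp_inj_on finite_subset inj_on_subset perm_onI perm_on_def)

lemma perm_on_Diff: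
  assumes "perm_on p X" "S \<subseteq> X" "closed_under p S" shows "closed_under p (X - S)"
proof -
  have "p ` S = S" using perm_on_subset[OF assms] by (simp add: perm_on_def bij_betw_def)
  moreover have "p x \<noteq> p y" if "x \<in> X - S" "y \<in> S" for x y
    using that assms perm_on_inj by (metis DiffD1 DiffD2 subsetD)
  ultimately show ?thesis
    using assms(1) perm_on_closed unfolding closed_under_def
    by (smt (verit) Diff_iff image_iff)
qed

lemma perm_on_period:
  assumes "perm_on p X" "x \<in> X" shows "\<exists>m>0. (p ^^ m) x = x"
proof -
  have b: "bij_betw (p ^^ k) X X" for k
    using assms(1) by (simp add: perm_on_def bij_betw_funpow)
  have "\<not> inj_on (\<lambda>k. (p ^^ k) x) (UNIV :: nat set)"
  proof
    assume i: "inj_on (\<lambda>k. (p ^^ k) x) (UNIV :: nat set)"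
    have "range (\<lambda>k. (p ^^ k) x) \<subseteq> X" using b assms(2) by (auto simp: bij_betw_def)
    then show False using i assms(1) by (meson finite_imageD finite_subset infinite_UNIV_nat perm_on_def)
  qed
  then obtain i j where ij: "i < j" "(p ^^ i) x = (p ^^ j) x"
    unfolding inj_on_def by (metis linorder_neqE_nat)
  have "(p ^^ i) ((p ^^ (j - i)) x) = (p ^^ i) x"
    using ij by (metis add_diff_inverse_nat comp_apply funpow_add less_imp_not_less)
  then have "(p ^^ (j - i)) x = x"
    using b[of i] b[of "j-i"] assms(2) by (metis bij_betw_def bij_betwE inj_on_eq_iff)
  then show ?thesis using ij by (metis zero_less_diff)
qed

lemma orb_eq:
  assumes "perm_on p X" "x \<in> X" "y \<in> orb p x" shows "orb p y = orb p x"
proof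
  show 1: "orb p y \<subseteq> orb p x" using assms(3) orb_closed orb_least by blast
  obtain k where k: "y = (p ^^ k) x" using assms(3) unfolding orb_def by auto
  obtain m where m: "m > 0" "(p ^^ m) x = x" using perm_on_period assms by blast
  have mm: "(p ^^ (m * k)) x = x"
  proof (induction k)
    case (Suc k)
    then show ?case using m by (simp add: funpow_add add.commute)
  qed simp
  \<comment> \<open>\<open>m * k\<close> is a multiple of the period and at least \<open>k\<close>,
    so \<open>m * k - k\<close> further steps lead from \<open>y\<close> back to
    \<open>x\<close>.\<close>
  have "k \<le> m * k" using m by simp
  then have "(p ^^ (m * k - k)) y = x"
    using mm k by (metis comp_apply funpow_add le_add_diff_inverse2)
  then have "x \<in> orb p y" unfolding orb_def by auto
  then show "orb p x \<subseteq> orb p y" using orb_closed orb_least by blast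
qed

lemma orb_sym:
  assumes "perm_on p X" "x \<in> X" "y \<in> orb p x" shows "x \<in> orb p y"
  using orb_eq[OF assms] orb_self by blast

lemma finite_orb: "perm_on p X \<Longrightarrow> x \<in> X \<Longrightarrow> finite (orb p x)"
  by (meson finite_subset perm_on_finite perm_on_orb_subset)

lemma orb_image: "perm_on p X \<Longrightarrow> x \<in> X \<Longrightarrow> orb p (p x) = orb p x"
  by (meson orb_eq orb_self orb_step)

lemma cyc_cong:
  assumes "closed_under p S" "\<And>y. y \<in> S \<Longrightarrow> p y = q y"
  shows "cyc p S = cyc q S"
  unfolding cyc_def by (metis (no_types, lifting) assms image_cong orb_cong)

lemma cyc_Un:
  assumes "perm_on p S" "perm_on p T" "S \<inter> T = {}"
  shows "cyc p (S \<union> T) = cyc p S + cyc p T"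
proof -
  have "orb p ` S \<inter> orb p ` T = {}"
    using assms by (auto simp: image_iff) (metis disjoint_iff orb_self perm_on_orb_subset subsetD)
  then show ?thesis unfolding cyc_def image_Un
    using assms by (simp add: card_Un_disjoint perm_on_finite)
qed

lemma cyc_single: "p b = b \<Longrightarrow> cyc p {b} = 1"
  by (simp add: cyc_def)

lemma cyc_remove_fixed:
  assumes "perm_on p X" "b \<in> X" "p b = b"
  shows "cyc p X = cyc p (X - {b}) + 1"
proof -
  have c: "closed_under p {b}" using assms(3) by (simp add: closed_under_def)
  have "perm_on p {b}" "perm_on p (X - {b})"
    using perm_on_subset[OF assms(1), of "{b}"] perm_on_subset[OF assms(1), of "X - {b}"]
      perm_on_Diff[OF assms(1) _ c] assms c by auto
  then have "cyc p ((X - {b}) \<union> {b}) = cyc p (X - {b}) + cyc p {b}"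
    by (intro cyc_Un) auto
  moreover have "(X - {b}) \<union> {b} = X" using assms by auto
  ultimately show ?thesis using cyc_single[of p b, OF assms(3)] by simp
qed

section \<open>Multiplying a permutation by a transposition\<close>

lemma perm_on_comp:
  "perm_on p X \<Longrightarrow> perm_on q X \<Longrightarrow> perm_on (p \<circ> q) X"
  unfolding perm_on_def using bij_betw_trans by blast

lemma perm_on_transpose:
  "finite X \<Longrightarrow> a \<in> X \<Longrightarrow> b \<in> X \<Longrightarrow> perm_on (sw a b) X"
  unfolding perm_on_def
  by (metis bij_betw_transpose_iff)

lemma perm_on_comp_transpose:
  "perm_on p X \<Longrightarrow> a \<in> X \<Longrightarrow> b \<in> X \<Longrightarrow> perm_on (p \<circ> sw a b) X"
  by (simp add: perm_on_comp perm_on_finite perm_on_transpose)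

lemma comp_transpose_twice: "p \<circ> sw a b \<circ> sw a b = p"
  by (simp add: comp_assoc)

text \<open>A transposition with one entry in each of two cycles splices these cycles together and
  leaves the others alone. Vertex and face counts of modified maps are obtained from this lemma and
  its converse \<open>orb_split\<close>.\<close>

lemma orb_merge:
  assumes p: "perm_on p X" and ab: "a \<in> X" "b \<in> X" "b \<notin> orb p a"
  shows "orb (p \<circ> sw a b) a = orb p a \<union> orb p b"
    and "orb (p \<circ> sw a b) b = orb p a \<union> orb p b"
    and "x \<in> X \<Longrightarrow> x \<notin> orb p a \<Longrightarrow> x \<notin> orb p b \<Longrightarrow> orb (p \<circ> sw a b) x = orb p x"
    and "cyc p X = cyc (p \<circ> sw a b) X + 1"
proof -
  define q where "q = p \<circ> sw a b"
  have q: "perm_on q X" unfolding q_def by (simp add: p ab perm_on_comp_transpose)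
  have qa: "q a = p b" and qb: "q b = p a" and qx: "\<And>x. x \<noteq> a \<Longrightarrow> x \<noteq> b \<Longrightarrow> q x = p x"
    by (auto simp: q_def)
  have a_nb: "a \<notin> orb p b" using ab orb_sym[OF p] by blast
  have b_in: "b \<in> orb q a"
  proof (rule ccontr)
    assume nb: "b \<notin> orb q a"
    \<comment> \<open>As long as it avoids \<open>b\<close>, the \<open>q\<close>-orbit of
      \<open>a\<close> moves by \<open>p\<close> alone inside the old cycle of \<open>b\<close>; it
      would never return to \<open>a\<close>, against periodicity.\<close>
    have *: "(q ^^ Suc j) a \<in> orb p b" for j
    proof (induction j)
      case 0 then show ?case using qa orb_step orb_self by simp
    next
      case (Suc j)
      have "(q ^^ Suc j) a \<in> orb q a" unfolding orb_def by blast
      then have "(q ^^ Suc j) a \<noteq> b" using nb by metis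
      moreover have "(q ^^ Suc j) a \<noteq> a" using Suc a_nb by metis
      ultimately have "q ((q ^^ Suc j) a) = p ((q ^^ Suc j) a)" using qx by blast
      then show ?case using Suc orb_step by simp
    qed
    obtain m where "m > 0" "(q ^^ m) a = a" using perm_on_period[OF q ab(1)] by blast
    then show False using *[of "m - 1"] a_nb by simp
  qed
  have cl: "closed_under p (orb q a)"
    unfolding closed_under_def
    by (metis b_in orb_self orb_step qa qb qx)
  have cl2: "closed_under q (orb p a \<union> orb p b)"
    unfolding closed_under_def
    by (metis Un_iff orb_self orb_step qa qb qx)
  have e: "orb q a = orb p a \<union> orb p b"
  proof
    show "orb q a \<subseteq> orb p a \<union> orb p b" using cl2 orb_least orb_self by blast
    show "orb p a \<union> orb p b \<subseteq> orb q a" using cl b_in orb_least orb_self by blast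
  qed
  have e2: "orb q b = orb q a" using b_in orb_eq[OF q ab(1)] by blast
  have e3: "orb q x = orb p x" if "x \<in> X" "x \<notin> orb p a" "x \<notin> orb p b" for x
  proof -
    have "y \<noteq> a" "y \<noteq> b" if "y \<in> orb p x" for y
      using that \<open>x \<in> X\<close> \<open>x \<notin> orb p a\<close> \<open>x \<notin> orb p b\<close> orb_sym[OF p] by blast+
    then show ?thesis
      using orb_cong[of x "orb p x" p q] orb_self orb_closed qx by metis
  qed
  show "orb (p \<circ> sw a b) a = orb p a \<union> orb p b"
    and "orb (p \<circ> sw a b) b = orb p a \<union> orb p b"
    and "x \<in> X \<Longrightarrow> x \<notin> orb p a \<Longrightarrow> x \<notin> orb p b \<Longrightarrow> orb (p \<circ> sw a b) x = orb p x"
    using e e2 e3 by (auto simp: q_def)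
  define S where "S = orb p a \<union> orb p b"
  have SX: "S \<subseteq> X" using p ab by (simp add: S_def perm_on_orb_subset)
  have Sp: "closed_under p S" unfolding S_def using orb_closed by (auto simp: closed_under_def)
  have Sq: "closed_under q S" using cl2 S_def by simp
  have Xs: "X = (X - S) \<union> S" using SX by auto
  have pp: "perm_on p S" "perm_on p (X - S)" "perm_on q S" "perm_on q (X - S)"
    using perm_on_subset p q SX Sp Sq perm_on_Diff by (meson Diff_subset)+
  have c1: "cyc p X = cyc p (X - S) + cyc p S" using cyc_Un[OF pp(2,1)] Xs by auto
  have c2: "cyc q X = cyc q (X - S) + cyc q S" using cyc_Un[OF pp(4,3)] Xs by auto
  have c3: "cyc q (X - S) = cyc p (X - S)" unfolding cyc_def
    using e3 S_def by (metis (no_types, lifting) Diff_iff Un_iff image_cong)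
  have "orb p ` S = {orb p a, orb p b}"
  proof -
    have "orb p x = orb p a \<or> orb p x = orb p b" if "x \<in> S" for x
      using that p ab orb_eq S_def by blast
    moreover have "a \<in> S" "b \<in> S" using orb_self S_def by auto
    ultimately show ?thesis by blast
  qed
  then have c4: "cyc p S = 2" unfolding cyc_def using ab orb_self by (metis card_2_iff)
  have "orb q ` S = {orb q a}"
  proof -
    have "orb q x = orb q a" if "x \<in> S" for x
      using that orb_eq[OF q ab(1)] e S_def by blast
    moreover have "a \<in> S" using orb_self S_def by auto
    ultimately show ?thesis by blast
  qed
  then have c5: "cyc q S = 1" unfolding cyc_def by simp
  show "cyc p X = cyc (p \<circ> sw a b) X + 1"
    using c1 c2 c3 c4 c5 q_def by simp
qed

text \<open>Once \<open>a\<close> and \<open>b\<close> are known to lie in different cycles of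
  \<open>p \<circ> sw a b\<close>, a second multiplication by the transposition gives back
  \<open>p\<close>, and \<open>orb_merge\<close> read backwards yields the rest.\<close>

lemma orb_split:
  assumes p: "perm_on p X" and ab: "a \<in> X" "b \<in> orb p a" "a \<noteq> b"
  shows "b \<notin> orb (p \<circ> sw a b) a"
    and "orb p a = orb (p \<circ> sw a b) a \<union> orb (p \<circ> sw a b) b"
    and "x \<in> X \<Longrightarrow> x \<notin> orb p a \<Longrightarrow> orb (p \<circ> sw a b) x = orb p x"
    and "cyc (p \<circ> sw a b) X = cyc p X + 1"
proof -
  define q where "q = p \<circ> sw a b"
  have bX: "b \<in> X" using p ab perm_on_orb_subset by blast
  have q: "perm_on q X" unfolding q_def by (simp add: p ab bX perm_on_comp_transpose)
  have qa: "q a = p b" and qb: "q b = p a" and qx: "\<And>x. x \<noteq> a \<Longrightarrow> x \<noteq> b \<Longrightarrow> q x = p x"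
    by (auto simp: q_def)
  define k where "k = (LEAST k. (p ^^ k) a = b)"
  have "\<exists>k. (p ^^ k) a = b" using ab(2) unfolding orb_def by auto
  then have k: "(p ^^ k) a = b" and kl: "\<And>j. j < k \<Longrightarrow> (p ^^ j) a \<noteq> b"
    unfolding k_def using LeastI_ex[of "\<lambda>k. (p ^^ k) a = b"] not_less_Least by auto
  have k0: "k > 0" using k ab(3) by (cases k) auto
  have na: "(p ^^ j) a \<noteq> a" if "1 \<le> j" "j \<le> k" for j
  proof
    assume "(p ^^ j) a = a"
    then have "(p ^^ (k - j)) a = b"
      using k that funpow_add[of "k - j" j p] by simp
    then show False using kl[of "k - j"] that by simp
  qed
  \<comment> \<open>The arc of the cycle that starts after \<open>a\<close> and ends in
    \<open>b\<close>. Under \<open>q\<close> it closes up at \<open>b\<close>, so the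
    \<open>q\<close>-orbit of \<open>b\<close> misses \<open>a\<close>.\<close>
  define T where "T = (\<lambda>j. (p ^^ j) a) ` {1..k}"
  have "closed_under q T"
    unfolding closed_under_def
  proof
    fix x assume "x \<in> T"
    then obtain j where j: "1 \<le> j" "j \<le> k" "x = (p ^^ j) a" unfolding T_def by auto
    show "q x \<in> T"
    proof (cases "j = k")
      case True
      then have "q x = (p ^^ 1) a" using j k qb by simp
      then show ?thesis unfolding T_def using k0 by (metis One_nat_def Suc_leI atLeastAtMost_iff
        image_eqI order_refl)
    next
      case False
      then have "q x = (p ^^ Suc j) a" using j kl na qx by simp
      then show ?thesis unfolding T_def using False j by (intro image_eqI[where x = "Suc j"]) auto
    qed
  qed
  moreover have "b \<in> T" unfolding T_def using k k0 by (intro image_eqI[where x = k]) auto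
  ultimately have "orb q b \<subseteq> T" using orb_least by blast
  moreover have "a \<notin> T" unfolding T_def using na by force
  ultimately have "a \<notin> orb q b" by blast
  then have nb: "b \<notin> orb q a" using orb_sym[OF q ab(1)] by blast
  have pq: "q \<circ> sw a b = p" unfolding q_def by (simp add: comp_transpose_twice)
  note m = orb_merge[OF q ab(1) bX nb, unfolded pq]
  show "b \<notin> orb (p \<circ> sw a b) a"
    and "orb p a = orb (p \<circ> sw a b) a \<union> orb (p \<circ> sw a b) b"
    and "cyc (p \<circ> sw a b) X = cyc p X + 1"
    using nb m by (auto simp: q_def)
  show "orb (p \<circ> sw a b) x = orb p x" if "x \<in> X" "x \<notin> orb p a"
    using m that by (auto simp: q_def)
qed

lemma cyc_transpose_le:
  assumes "perm_on p X" "a \<in> X" "b \<in> X"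
  shows "cyc p X \<le> cyc (p \<circ> sw a b) X + 1"
proof (cases "b \<in> orb p a")
  case True
  then show ?thesis using orb_split(4)[OF assms(1,2) True] by (cases "a = b") auto
next
  case False
  then show ?thesis using orb_merge(4)[OF assms(1,2,3) False] by simp
qed

section \<open>Connectedness and the genus bound\<close>

text \<open>Connectedness is expressed by closed subsets because cut maps are analysed through their
  closed parts; \<open>transitive_on_rtrancl\<close> translates it into the reachability used in
  \<open>is_planar_map\<close>.\<close>

definition transitive_on :: "nat set \<Rightarrow> (nat \<Rightarrow> nat) \<Rightarrow> (nat \<Rightarrow> nat) \<Rightarrow> bool" where
  "transitive_on X \<sigma> \<alpha> \<longleftrightarrow> X \<noteq> {} \<and>
     (\<forall>S. S \<subseteq> X \<longrightarrow> S \<noteq> {} \<longrightarrow> closed_under \<sigma> S \<longrightarrow> closed_under \<alpha> S \<longrightarrow> S = X)"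

definition invol_on :: "(nat \<Rightarrow> nat) \<Rightarrow> nat set \<Rightarrow> bool" where
  "invol_on \<alpha> X \<longleftrightarrow> finite X \<and> closed_under \<alpha> X \<and> (\<forall>x\<in>X. \<alpha> (\<alpha> x) = x)"

definition nonfix :: "(nat \<Rightarrow> nat) \<Rightarrow> nat set \<Rightarrow> nat" where
  "nonfix \<alpha> X = card {x \<in> X. \<alpha> x \<noteq> x}"

text \<open>Half of \<open>nonfix\<close> is the number of edges, so \<open>planar\<close> is Euler's relation freed of subtraction.\<close>

definition planar :: "nat set \<Rightarrow> (nat \<Rightarrow> nat) \<Rightarrow> (nat \<Rightarrow> nat) \<Rightarrow> bool" where
  "planar X \<sigma> \<alpha> \<longleftrightarrow> 2 * (cyc \<sigma> X + cyc (\<sigma> \<circ> \<alpha>) X) = nonfix \<alpha> X + 4"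

lemma invol_on_perm: "invol_on \<alpha> X \<Longrightarrow> perm_on \<alpha> X"
  by (rule perm_onI) (auto simp: invol_on_def inj_on_def, metis)

lemma invol_on_subset: "invol_on \<alpha> X \<Longrightarrow> S \<subseteq> X \<Longrightarrow> closed_under \<alpha> S \<Longrightarrow> invol_on \<alpha> S"
  by (auto simp: invol_on_def finite_subset)

lemma transitive_on_single_orbit: "transitive_on X \<sigma> \<alpha> \<Longrightarrow> x \<in> X \<Longrightarrow> S \<subseteq> X \<Longrightarrow> x \<in> S \<Longrightarrow> closed_under \<sigma> S \<Longrightarrow>
  closed_under \<alpha> S \<Longrightarrow> S = X"
  unfolding transitive_on_def by blast

lemma closed_under_comp: "closed_under p S \<Longrightarrow> closed_under q S \<Longrightarrow> closed_under (p \<circ> q) S"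
  by (simp add: closed_under_def)

lemma nonfix_Un:
  "finite S \<Longrightarrow> finite T \<Longrightarrow> S \<inter> T = {} \<Longrightarrow> nonfix \<alpha> (S \<union> T) = nonfix \<alpha> S + nonfix \<alpha> T"
  unfolding nonfix_def
  by (subst card_Un_disjoint[symmetric]) (auto intro!: arg_cong[where f = card])

lemma nonfix_cong: "(\<And>x. x \<in> S \<Longrightarrow> p x = q x) \<Longrightarrow> nonfix p S = nonfix q S"
  unfolding nonfix_def by (metis (mono_tags, lifting) Collect_cong)

lemma transitive_on_cong:
  assumes "\<And>x. x \<in> X \<Longrightarrow> \<sigma> x = \<sigma>' x" "\<And>x. x \<in> X \<Longrightarrow> \<alpha> x = \<alpha>' x"
  shows "transitive_on X \<sigma> \<alpha> \<longleftrightarrow> transitive_on X \<sigma>' \<alpha>'"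
proof -
  have "closed_under \<sigma> S = closed_under \<sigma>' S" "closed_under \<alpha> S = closed_under \<alpha>' S" if "S \<subseteq> X" for S
    using that assms unfolding closed_under_def by (metis subsetD)+
  then show ?thesis unfolding transitive_on_def by (metis (no_types, lifting))
qed

text \<open>Composing \<open>\<alpha>\<close> with the transposition makes \<open>a\<close> and
  \<open>b\<close> fixed points. The edge is thereby cut into two half-edges instead of being
  removed: dart set and vertices stay the same, and only the faces change.\<close>

locale edge_cut =
  fixes X :: "nat set" and \<sigma> \<alpha> :: "nat \<Rightarrow> nat" and a b :: nat
  assumes perm: "perm_on \<sigma> X" and inv: "invol_on \<alpha> X"
    and a: "a \<in> X" and ab: "\<alpha> a = b" and neq: "a \<noteq> b"
begin

abbreviation "\<alpha>' \<equiv> \<alpha> \<circ> sw a b"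

lemma b: "b \<in> X" using inv a ab by (auto simp: invol_on_def closed_under_def)

lemma ba: "\<alpha> b = a" using inv a ab by (auto simp: invol_on_def)

lemma cut_simps [simp]: "\<alpha>' a = a" "\<alpha>' b = b" "x \<noteq> a \<Longrightarrow> x \<noteq> b \<Longrightarrow> \<alpha>' x = \<alpha> x"
  using ab ba by auto

lemma inv': "invol_on \<alpha>' X"
proof -
  have "\<alpha> x \<noteq> a" "\<alpha> x \<noteq> b" if "x \<in> X" "x \<noteq> a" "x \<noteq> b" for x
    using that inv a b ab ba perm_on_inj[OF invol_on_perm[OF inv]] by metis+
  then have "\<alpha>' (\<alpha>' x) = x" "\<alpha>' x \<in> X" if "x \<in> X" for x
    using that inv a b ab ba by (cases "x = a"; cases "x = b"; force simp: invol_on_def closed_under_def)+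
  then show ?thesis using inv unfolding invol_on_def closed_under_def by blast
qed

lemma nonfix: "nonfix \<alpha> X = nonfix \<alpha>' X + 2"
proof -
  have "{x \<in> X. \<alpha> x \<noteq> x} = insert a (insert b {x \<in> X. \<alpha>' x \<noteq> x})"
    using a b ab ba neq cut_simps by (auto simp del: comp_apply) (metis cut_simps)+
  moreover have "a \<notin> {x \<in> X. \<alpha>' x \<noteq> x}" "b \<notin> {x \<in> X. \<alpha>' x \<noteq> x}"
    using cut_simps by (auto simp del: comp_apply)
  moreover have "finite X" using inv by (simp add: invol_on_def)
  ultimately show ?thesis unfolding nonfix_def using neq by simp
qed

lemma face_perm: "perm_on (\<sigma> \<circ> \<alpha>) X" "perm_on (\<sigma> \<circ> \<alpha>') X"
  using perm inv inv' invol_on_perm perm_on_comp by blast+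

lemma face_cut: "\<sigma> \<circ> \<alpha>' = (\<sigma> \<circ> \<alpha>) \<circ> sw a b" by auto

lemma closed_iff: "a \<in> S \<longleftrightarrow> b \<in> S \<Longrightarrow> closed_under \<alpha>' S \<longleftrightarrow> closed_under \<alpha> S"
  unfolding closed_under_def using ab ba cut_simps by metis

lemma disconnected:
  assumes "transitive_on X \<sigma> \<alpha>" "\<not> transitive_on X \<sigma> \<alpha>'"
  obtains S where "S \<subseteq> X" "a \<in> S" "b \<notin> S" "closed_under \<sigma> S" "closed_under \<alpha>' S"
    "transitive_on S \<sigma> \<alpha>'" "transitive_on (X - S) \<sigma> \<alpha>'"
proof -
  obtain T where T: "T \<subseteq> X" "T \<noteq> {}" "closed_under \<sigma> T" "closed_under \<alpha>' T" "T \<noteq> X"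
    using assms a unfolding transitive_on_def by blast
  have p': "perm_on \<alpha>' X" using inv' invol_on_perm by blast
  have D: "closed_under \<sigma> (X - T)" "closed_under \<alpha>' (X - T)"
    using perm_on_Diff perm p' T by blast+
  \<comment> \<open>A set closed after the cut that contains both or neither of \<open>a\<close> and
    \<open>b\<close> was closed before the cut, so connectedness leaves only the trivial
    sets.\<close>
  have key: "\<not> (a \<in> U \<longleftrightarrow> b \<in> U)" if "U \<subseteq> X" "U \<noteq> {}" "closed_under \<sigma> U" "closed_under \<alpha>' U" "U \<noteq> X" for U
    using that closed_iff assms(1) unfolding transitive_on_def by blast
  have transitive_on_part: "transitive_on U \<sigma> \<alpha>'" if U: "U \<subseteq> X" "U \<noteq> {}" "closed_under \<sigma> U"
    "closed_under \<alpha>' U" "U \<noteq> X" for U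
    unfolding transitive_on_def
  proof (intro conjI allI impI)
    fix V assume V: "V \<subseteq> U" "V \<noteq> {}" "closed_under \<sigma> V" "closed_under \<alpha>' V"
    \<comment> \<open>\<open>V\<close> and \<open>U\<close> each contain exactly one of
      \<open>a\<close> and \<open>b\<close>, hence the same one; a nonempty \<open>U - V\<close>
      would contain neither, against \<open>key\<close>.\<close>
    have "\<not> (a \<in> V \<longleftrightarrow> b \<in> V)" using key[of V] V U by blast
    moreover have "\<not> (a \<in> U \<longleftrightarrow> b \<in> U)" using key U by blast
    ultimately have *: "\<not> (a \<in> U - V)" "\<not> (b \<in> U - V)" using V by auto
    have pp: "perm_on \<sigma> U" "perm_on \<alpha>' U" using perm_on_subset perm p' U by blast+
    have c: "closed_under \<sigma> (U - V)" "closed_under \<alpha>' (U - V)"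
      using perm_on_Diff pp V by blast+
    show "V = U"
    proof (rule ccontr)
      assume "V \<noteq> U"
      then have "U - V \<noteq> {}" "U - V \<noteq> X" "U - V \<subseteq> X" using V U by auto
      then show False using key[of "U - V"] c * by blast
    qed
  qed (use U in auto)
  have TD: "X - T \<noteq> {}" "X - T \<noteq> X" using T by auto
  have t1: "transitive_on T \<sigma> \<alpha>'" using transitive_on_part[OF T] .
  have t2: "transitive_on (X - T) \<sigma> \<alpha>'" using transitive_on_part[of "X - T"] TD D by blast
  have X: "X - (X - T) = T" using T by auto
  show ?thesis
  proof (cases "a \<in> T")
    case True
    then show ?thesis using that[of T] key[OF T] T t1 t2 by blast
  next
    case False
    then have "b \<in> T" using key[OF T] by blast
    then show ?thesis using that[of "X - T"] False T t1 t2 D a by (simp add: X)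
  qed
qed

end

lemma genus_bound_arith:
  fixes v f :: nat
  assumes "2 * (v1 + f1) \<le> n1 + 4" "2 * (v2 + f2) \<le> n2 + 4" "v = v1 + v2" "f' = f1 + f2"
   "f' = f + 1" "n = n' + 2" "n' = n1 + n2"
  shows "2 * (v + f) \<le> n + 4"
  using assms unfolding distrib_left by linarith

text \<open>Induction on the edges, cutting one of them. If the map stays connected, an edge is lost
  and the number of faces changes by at most one. If it falls apart, each part contributes at most 2
  to v - e + f, and the cut has created exactly one face. With no edge left there is one vertex and
  one face.\<close>

lemma genus_bound:
  assumes "perm_on \<sigma> X" "invol_on \<alpha> X" "transitive_on X \<sigma> \<alpha>"
  shows "2 * (cyc \<sigma> X + cyc (\<sigma> \<circ> \<alpha>) X) \<le> nonfix \<alpha> X + 4"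
  using assms
proof (induction "nonfix \<alpha> X" arbitrary: X \<alpha> rule: less_induct)
  case less
  have fX: "finite X" using less.prems by (simp add: invol_on_def)
  show ?case
  proof (cases "\<forall>x\<in>X. \<alpha> x = x")
    case True
    obtain x where x: "x \<in> X" using less.prems by (auto simp: transitive_on_def)
    have o: "orb \<sigma> x = X"
    proof (rule transitive_on_single_orbit[OF less.prems(3) x])
      show "orb \<sigma> x \<subseteq> X" using less.prems x perm_on_orb_subset by blast
      then show "closed_under \<alpha> (orb \<sigma> x)" using True by (metis closed_under_def subsetD)
    qed (simp_all add: orb_self orb_closed)
    have "orb \<sigma> y = X" if "y \<in> X" for y using o orb_eq less.prems x that by metis
    then have "orb \<sigma> ` X = {X}" using x by auto
    then have c: "cyc \<sigma> X = 1" by (simp add: cyc_def)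
    have "cyc (\<sigma> \<circ> \<alpha>) X = cyc \<sigma> X"
      by (rule cyc_cong) (use True less.prems perm_on_closed in \<open>auto simp: closed_under_def\<close>)
    then show ?thesis using c by simp
  next
    case False
    then obtain a where a: "a \<in> X" "\<alpha> a \<noteq> a" by blast
    interpret edge_cut X \<sigma> \<alpha> a "\<alpha> a"
      by unfold_locales (use less.prems a in auto)
    let ?f = "\<sigma> \<circ> \<alpha>" and ?f' = "\<sigma> \<circ> \<alpha>'"
    show ?thesis
    proof (cases "transitive_on X \<sigma> \<alpha>'")
      case True
      have "2 * (cyc \<sigma> X + cyc ?f' X) \<le> nonfix \<alpha>' X + 4"
        using less.hyps[of \<alpha>' X] nonfix perm inv' True by simp
      moreover have "cyc ?f X \<le> cyc ?f' X + 1"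
        unfolding face_cut by (rule cyc_transpose_le[OF face_perm(1) a(1) b])
      moreover note nonfix
      ultimately show ?thesis by presburger
    next
      case False
      obtain S where S: "S \<subseteq> X" "a \<in> S" "\<alpha> a \<notin> S" "closed_under \<sigma> S" "closed_under \<alpha>' S"
        "transitive_on S \<sigma> \<alpha>'" "transitive_on (X - S) \<sigma> \<alpha>'"
        using disconnected[OF less.prems(3) False] by blast
      have p': "perm_on \<alpha>' X" using inv' invol_on_perm by blast
      have D: "closed_under \<sigma> (X - S)" "closed_under \<alpha>' (X - S)"
        using perm_on_Diff perm p' S by blast+
      have u: "S \<union> (X - S) = X" using S by auto
      have nf: "nonfix \<alpha>' X = nonfix \<alpha>' S + nonfix \<alpha>' (X - S)"
        using nonfix_Un[of S "X - S" \<alpha>'] u fX S(1) by (metis Diff_disjoint finite_Diff finite_subset)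
      have pS: "perm_on \<sigma> S" "perm_on \<sigma> (X - S)" "perm_on ?f' S" "perm_on ?f' (X - S)"
        using perm_on_subset perm face_perm(2) S D closed_under_comp by (meson Diff_subset)+
      have 1: "2 * (cyc \<sigma> S + cyc ?f' S) \<le> nonfix \<alpha>' S + 4"
        using less.hyps[of \<alpha>' S] nonfix nf pS S inv' invol_on_subset by simp
      have 2: "2 * (cyc \<sigma> (X - S) + cyc ?f' (X - S)) \<le> nonfix \<alpha>' (X - S) + 4"
        using less.hyps[of \<alpha>' "X - S"] nonfix nf pS S D inv' invol_on_subset[OF inv', of "X - S"] by simp
      have 3: "cyc \<sigma> X = cyc \<sigma> S + cyc \<sigma> (X - S)" and 4: "cyc ?f' X = cyc ?f' S + cyc ?f' (X - S)"
        using cyc_Un[of _ S "X - S"] pS u by auto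
      have "cyc ?f' X = cyc ?f X + 1 \<or> cyc ?f X = cyc ?f' X + 1"
        by (metis a(1) b face_cut face_perm(1) neq orb_merge(4) orb_split(4))
      \<comment> \<open>Had the cut merged two faces, \<open>a\<close> and \<open>\<alpha> a\<close>
        would share a face afterwards; but the face of \<open>a\<close> is confined to
        \<open>S\<close>.\<close>
      moreover have ne: "cyc ?f X \<noteq> cyc ?f' X + 1"
      proof
        assume *: "cyc ?f X = cyc ?f' X + 1"
        have n: "\<alpha> a \<in> orb ?f' a"
        proof (rule ccontr)
          assume "\<alpha> a \<notin> orb ?f' a"
          moreover have "?f = ?f' \<circ> sw a (\<alpha> a)" by (simp add: comp_assoc)
          ultimately have "\<alpha> a \<in> orb ?f a" by (metis Un_iff a(1) b face_perm(2) orb_merge(1) orb_self)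
          then show False using orb_split(4)[OF face_perm(1) a(1) _ neq] * unfolding face_cut by linarith
        qed
        have "orb ?f' a \<subseteq> S" using orb_least S closed_under_comp by blast
        then show False using S n by blast
      qed
      ultimately have "cyc ?f' X = cyc ?f X + 1" using ne by blast
      with 1 2 3 4 show ?thesis using nonfix nf by (rule genus_bound_arith)
    qed
  qed
qed

section \<open>Legged planar maps\<close>

type_synonym cmap = "(nat \<Rightarrow> nat) \<times> (nat \<Rightarrow> nat)"

text \<open>Fixed points of \<open>\<alpha>\<close> are legs: darts that belong to no edge. A single leg marks a corner and
  thereby also represents the rooted atomic map, which has no dart to root at.\<close>

definition legged :: "nat set \<Rightarrow> nat set \<Rightarrow> cmap set" where
  "legged L X = {(\<sigma>, \<alpha>). \<sigma> permutes X \<and> \<alpha> permutes X \<and> (\<forall>x. \<alpha> (\<alpha> x) = x) \<and>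
     {x \<in> X. \<alpha> x = x} = L \<and> transitive_on X \<sigma> \<alpha> \<and> planar X \<sigma> \<alpha>}"

lemma permutes_perm_on: "p permutes X \<Longrightarrow> finite X \<Longrightarrow> perm_on p X"
  by (simp add: perm_on_def permutes_imp_bij)

lemma permutes_fixes: "p permutes X \<Longrightarrow> x \<notin> X \<Longrightarrow> p x = x"
  by (simp add: permutes_def)

lemma permutes_mem: "p permutes X \<Longrightarrow> p x \<in> X \<longleftrightarrow> x \<in> X"
  by (rule permutes_in_image)

lemma leggedD:
  assumes "(\<sigma>, \<alpha>) \<in> legged L X"
  shows "\<sigma> permutes X" "\<alpha> permutes X" "\<alpha> (\<alpha> x) = x" "L \<subseteq> X" "x \<in> X \<Longrightarrow> \<alpha> x = x \<longleftrightarrow> x \<in> L"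
    "transitive_on X \<sigma> \<alpha>" "planar X \<sigma> \<alpha>"
  using assms unfolding legged_def by auto

lemma legged_invol: "(\<sigma>, \<alpha>) \<in> legged L X \<Longrightarrow> finite X \<Longrightarrow> invol_on \<alpha> X"
  unfolding invol_on_def closed_under_def using leggedD permutes_mem by metis

lemma finite_legged: "finite X \<Longrightarrow> finite (legged L X)"
  by (rule finite_subset[of _ "{p. p permutes X} \<times> {p. p permutes X}"])
    (auto simp: legged_def finite_permutations)

text \<open>On \<open>insert b D\<close> the permutation \<open>p\<close> has the fixed point
  \<open>b\<close>, and the transposition merges this one-element cycle into the cycle of
  \<open>z\<close>.\<close>

lemma orb_add_point:
  assumes "p permutes D" "finite D" "z \<in> D" "b \<notin> D"
  shows "orb (p \<circ> sw z b) b = insert b (orb p z)"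
    and "x \<in> D \<Longrightarrow> orb (p \<circ> sw z b) x = (if x \<in> orb p z then insert b (orb p x) else orb p x)"
    and "cyc (p \<circ> sw z b) (insert b D) = cyc p D"
proof -
  have pX: "p permutes insert b D" using assms(1) by (rule permutes_subset) blast
  have P: "perm_on p (insert b D)" using permutes_perm_on pX assms(2) by blast
  have PD: "perm_on p D" using permutes_perm_on assms by blast
  have pb: "p b = b" using permutes_fixes[OF assms(1,4)] .
  have zD: "orb p z \<subseteq> D" using perm_on_orb_subset[OF PD assms(3)] .
  have b: "b \<notin> orb p z" using zD assms by blast
  have ob: "orb p b = {b}" using orb_least[of b "{b}" p] pb orb_self by (auto simp: closed_under_def)
  note m = orb_merge[OF P _ _ b]
  show "orb (p \<circ> sw z b) b = insert b (orb p z)" using m(2) assms(3) ob by auto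
  show "cyc (p \<circ> sw z b) (insert b D) = cyc p D"
    using m(4) assms(3,4) cyc_remove_fixed[OF P _ pb] by simp
  show "orb (p \<circ> sw z b) x = (if x \<in> orb p z then insert b (orb p x) else orb p x)" if x: "x \<in> D"
  proof (cases "x \<in> orb p z")
    case True
    have "orb p x = orb p z" using orb_eq[OF PD assms(3) True] .
    moreover have q: "perm_on (p \<circ> sw z b) (insert b D)"
      using P perm_on_comp_transpose assms by blast
    have "x \<in> orb (p \<circ> sw z b) z" using m(1) assms True by blast
    then have "orb (p \<circ> sw z b) x = orb (p \<circ> sw z b) z"
      using orb_eq[OF q] assms by blast
    ultimately show ?thesis using m(1) assms ob True by auto
  next
    case False
    then have "x \<notin> orb p b" using ob x assms by auto
    then show ?thesis using m(3)[of x] False x assms by simp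
  qed
qed

text \<open>For a rotation that fixes \<open>b\<close>, the new rotation sends \<open>z\<close> to
  \<open>b\<close> and \<open>b\<close> to the old image of \<open>z\<close>: the leg is put into
  the corner that follows \<open>z\<close> at its vertex.\<close>

definition add_leg :: "nat \<Rightarrow> cmap \<Rightarrow> nat \<Rightarrow> cmap" where
  "add_leg b m z = (fst m \<circ> sw z b, snd m)"

text \<open>The face permutation applies \<open>\<alpha>\<close> first, so a leg that comes after
  \<open>z\<close> around its vertex comes after \<open>\<alpha> z\<close> along its face. This
  shift is the reason for \<open>snd m z\<close> in \<open>nonisthmic_sum\<close>.\<close>

lemma face_add_leg:
  assumes "\<And>x. \<alpha> (\<alpha> x) = x" "\<alpha> b = b"
  shows "(\<sigma> \<circ> sw z b) \<circ> \<alpha> = (\<sigma> \<circ> \<alpha>) \<circ> sw (\<alpha> z) b"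
proof
  fix x
  have i: "\<alpha> x = \<alpha> y \<longleftrightarrow> x = y" for x y by (metis assms(1))
  have "\<alpha> x = z \<longleftrightarrow> x = \<alpha> z" by (metis assms(1))
  moreover have "\<alpha> x = b \<longleftrightarrow> x = b" by (metis assms)
  ultimately show "((\<sigma> \<circ> sw z b) \<circ> \<alpha>) x = ((\<sigma> \<circ> \<alpha>) \<circ> sw (\<alpha> z) b) x"
    using assms by (auto simp: Transposition.transpose_def)
qed

lemma transitive_on_add_leg:
  assumes "\<sigma> permutes D" "\<alpha> permutes D" "z \<in> D" "b \<notin> D"
  shows "transitive_on (insert b D) (\<sigma> \<circ> sw z b) \<alpha> \<longleftrightarrow> transitive_on D \<sigma> \<alpha>"
proof -
  let ?s = "\<sigma> \<circ> sw z b"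
  have sb: "?s b = \<sigma> z" and sz: "?s z = b" and sx: "\<And>x. x \<noteq> z \<Longrightarrow> x \<noteq> b \<Longrightarrow> ?s x = \<sigma> x"
    using permutes_fixes[OF assms(1,4)] by auto
  have ab: "\<alpha> b = b" using permutes_fixes[OF assms(2,4)] .
  show ?thesis
  proof
    assume t: "transitive_on (insert b D) ?s \<alpha>"
    show "transitive_on D \<sigma> \<alpha>" unfolding transitive_on_def
    proof (intro conjI allI impI)
      show "D \<noteq> {}" using assms by auto
      fix S assume S: "S \<subseteq> D" "S \<noteq> {}" "closed_under \<sigma> S" "closed_under \<alpha> S"
      define T where "T = S \<union> (if z \<in> S then {b} else {})"
      have "closed_under ?s T" "closed_under \<alpha> T" "T \<subseteq> insert b D" "T \<noteq> {}"
        using S sb sz sx ab assms unfolding T_def closed_under_def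
          by (auto simp del: comp_apply) (metis subsetD)+
      then have "T = insert b D" using t unfolding transitive_on_def by blast
      then show "S = D" using S assms unfolding T_def by (auto split: if_splits)
    qed
  next
    assume t: "transitive_on D \<sigma> \<alpha>"
    show "transitive_on (insert b D) ?s \<alpha>" unfolding transitive_on_def
    proof (intro conjI allI impI)
      fix S assume S: "S \<subseteq> insert b D" "S \<noteq> {}" "closed_under ?s S" "closed_under \<alpha> S"
      have c1: "closed_under \<sigma> (S \<inter> D)"
        unfolding closed_under_def
      proof
        fix x assume x: "x \<in> S \<inter> D"
        have "\<sigma> x \<in> S"
        proof (cases "x = z")
          case True
          then have "?s (?s x) \<in> S" using S(3) x unfolding closed_under_def by blast
          then show ?thesis using True sb sz by metis
        next
          case False
          then show ?thesis using sx[of x] S(3) x assms unfolding closed_under_def by (metis IntD1 IntD2)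
        qed
        then show "\<sigma> x \<in> S \<inter> D" using permutes_mem[OF assms(1)] x by blast
      qed
      have c2: "closed_under \<alpha> (S \<inter> D)"
        using S(4) permutes_mem[OF assms(2)] unfolding closed_under_def by blast
      have "S \<inter> D \<noteq> {}"
      proof
        assume "S \<inter> D = {}"
        then have "S = {b}" using S by auto
        then have "\<sigma> z = b" using S(3) sb unfolding closed_under_def by auto
        then show False using assms permutes_mem[OF assms(1), of z] by auto
      qed
      then have D: "S \<inter> D = D" using t c1 c2 unfolding transitive_on_def by blast
      then have "?s z \<in> S" using S(3) assms unfolding closed_under_def by blast
      then show "S = insert b D" using D S sz by auto
    qed simp
  qed
qed

lemma permutes_comp_sw: "p permutes X \<Longrightarrow> a \<in> X \<Longrightarrow> b \<in> X \<Longrightarrow> p \<circ> sw a b permutes X"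
  by (meson permutes_compose permutes_swap_id)

lemma planar_add_leg:
  assumes "\<sigma> permutes D" "\<alpha> permutes D" "z \<in> D" "b \<notin> D" "finite D" "\<And>x. \<alpha> (\<alpha> x) = x"
  shows "planar (insert b D) (\<sigma> \<circ> sw z b) \<alpha> \<longleftrightarrow> planar D \<sigma> \<alpha>"
proof -
  have ab: "\<alpha> b = b" using permutes_fixes[OF assms(2,4)] .
  have "cyc (\<sigma> \<circ> sw z b) (insert b D) = cyc \<sigma> D"
    using orb_add_point(3) assms by blast
  moreover have "cyc ((\<sigma> \<circ> sw z b) \<circ> \<alpha>) (insert b D) = cyc (\<sigma> \<circ> \<alpha>) D"
    using face_add_leg[of \<alpha> b \<sigma> z] assms ab
      orb_add_point(3)[of "\<sigma> \<circ> \<alpha>" D "\<alpha> z" b] permutes_compose[of \<alpha> D \<sigma>] permutes_mem[OF assms(2)] by simp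
  moreover have "{x \<in> insert b D. \<alpha> x \<noteq> x} = {x \<in> D. \<alpha> x \<noteq> x}" using ab by auto
  ultimately show ?thesis unfolding planar_def nonfix_def by simp
qed

lemma add_leg_legged:
  assumes "m \<in> legged L D" "z \<in> D" "b \<notin> D" "finite D"
  shows "add_leg b m z \<in> legged (insert b L) (insert b D)"
proof -
  obtain \<sigma> \<alpha> where m: "m = (\<sigma>, \<alpha>)" by (cases m)
  note l = leggedD[OF assms(1)[unfolded m]]
  have p: "\<sigma> permutes insert b D" "\<alpha> permutes insert b D"
    using l(1,2) permutes_subset by blast+
  have "{x \<in> insert b D. \<alpha> x = x} = insert b L"
    using l(4,5) permutes_fixes[OF l(2) assms(3)] by auto
  then show ?thesis
    unfolding m add_leg_def legged_def
    using transitive_on_add_leg[OF l(1,2) assms(2,3)] planar_add_leg[OF l(1,2) assms(2-4) l(3)] l p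
      permutes_comp_sw[OF p(1)] assms by simp
qed

text \<open>Each map with the further leg \<open>b\<close> arises exactly once, since
  \<open>z\<close> must be the predecessor of \<open>b\<close> in the rotation. Connectedness and
  \<open>D \<noteq> {}\<close> prevent \<open>b\<close> from being its own predecessor.\<close>

lemma add_leg_sum:
  fixes F :: "cmap \<Rightarrow> 'a :: comm_monoid_add"
  assumes "finite D" "D \<noteq> {}" "b \<notin> D" "L \<subseteq> D"
  shows "(\<Sum>m\<in>legged (insert b L) (insert b D). F m) = (\<Sum>m\<in>legged L D. \<Sum>z\<in>D. F (add_leg b m z))"
proof -
  let ?f = "\<lambda>(m, z). add_leg b m z"
  have inj: "inj_on ?f (legged L D \<times> D)"
  proof (rule inj_onI, clarsimp)
    fix \<sigma> \<alpha> z \<sigma>' \<alpha>' z'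
    assume m: "(\<sigma>, \<alpha>) \<in> legged L D" "(\<sigma>', \<alpha>') \<in> legged L D" and z: "z \<in> D" "z' \<in> D"
      and e: "add_leg b (\<sigma>, \<alpha>) z = add_leg b (\<sigma>', \<alpha>') z'"
    have e1: "\<sigma> \<circ> sw z b = \<sigma>' \<circ> sw z' b" and e2: "\<alpha> = \<alpha>'" using e by (auto simp: add_leg_def)
    have p: "\<sigma> permutes insert b D" "\<sigma>' permutes insert b D"
      using leggedD(1) m permutes_subset by blast+
    have "(\<sigma> \<circ> sw z b) z = b" "(\<sigma>' \<circ> sw z' b) z' = b"
      using permutes_fixes[OF leggedD(1)] m assms(3) by auto
    then have "z = z'"
      using e1 permutes_inj[OF permutes_comp_sw[OF p(1), of z b]] z by (metis injD insert_iff)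
    moreover have "\<sigma> = \<sigma>'" using e1 \<open>z = z'\<close> comp_transpose_twice by metis
    ultimately show "\<sigma> = \<sigma>' \<and> \<alpha> = \<alpha>' \<and> z = z'" using e2 by blast
  qed
  have img: "?f ` (legged L D \<times> D) = legged (insert b L) (insert b D)"
  proof
    show "?f ` (legged L D \<times> D) \<subseteq> legged (insert b L) (insert b D)"
      using add_leg_legged assms by auto
    show "legged (insert b L) (insert b D) \<subseteq> ?f ` (legged L D \<times> D)"
    proof
      fix m assume mm: "m \<in> legged (insert b L) (insert b D)"
      obtain \<sigma> \<alpha> where m: "m = (\<sigma>, \<alpha>)" by (cases m)
      note l = leggedD[OF mm[unfolded m]]
      have ab: "\<alpha> b = b" using l(5) by blast
      obtain z where z: "\<sigma> z = b" using l(1) by (metis permutes_def)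
      have zX: "z \<in> insert b D" using permutes_mem[OF l(1), of z] z by simp
      have zb: "z \<noteq> b"
      proof
        assume "z = b"
        then have "closed_under \<sigma> {b}" "closed_under \<alpha> {b}" using z ab by (auto simp: closed_under_def)
        then have "{b} = insert b D" using l(6) unfolding transitive_on_def by blast
        then show False using assms by auto
      qed
      then have zD: "z \<in> D" using zX by simp
      define s where "s = \<sigma> \<circ> sw z b"
      have sp: "s permutes insert b D" unfolding s_def using permutes_comp_sw[OF l(1) zX] by simp
      have sb: "s b = b" using z by (simp add: s_def)
      have spD: "s permutes D"
        by (rule permutes_superset[OF sp]) (use sb in auto)
      have apD: "\<alpha> permutes D"
        by (rule permutes_superset[OF l(2)]) (use ab in auto)
      have ss: "s \<circ> sw z b = \<sigma>" unfolding s_def by (rule comp_transpose_twice)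
      have "{x \<in> D. \<alpha> x = x} = L" using l(5) assms by auto
      moreover have "transitive_on D s \<alpha>" using transitive_on_add_leg[OF spD apD zD assms(3)] ss l(6) by simp
      moreover have "planar D s \<alpha>" using planar_add_leg[OF spD apD zD assms(3,1) l(3)] ss l(7) by simp
      ultimately have "(s, \<alpha>) \<in> legged L D" using spD apD l(3) by (simp add: legged_def)
      moreover have "m = ?f ((s, \<alpha>), z)" using ss m by (simp add: add_leg_def)
      ultimately show "m \<in> ?f ` (legged L D \<times> D)" using zD by blast
    qed
  qed
  have "(\<Sum>m\<in>legged (insert b L) (insert b D). F m) = (\<Sum>p\<in>legged L D \<times> D. F (?f p))"
    unfolding img[symmetric] by (subst sum.reindex[OF inj]) (simp add: comp_def)
  also have "\<dots> = (\<Sum>m\<in>legged L D. \<Sum>z\<in>D. F (add_leg b m z))"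
    by (subst sum.cartesian_product) (simp add: case_prod_beta)
  finally show ?thesis .
qed

section \<open>Duality\<close>

text \<open>The darts and edges are kept; because \<open>\<alpha>\<close> is an involution, vertices
  and faces trade places, and so do root vertex and root face.\<close>

definition dual_map :: "cmap \<Rightarrow> cmap" where "dual_map m = (fst m \<circ> snd m, snd m)"

lemma dual_map_dual_map: "m \<in> legged L X \<Longrightarrow> dual_map (dual_map m) = m"
  by (cases m) (auto simp: dual_map_def fun_eq_iff leggedD(3))

lemma dual_map_legged:
  assumes "m \<in> legged L X" shows "dual_map m \<in> legged L X"
proof -
  obtain \<sigma> \<alpha> where m: "m = (\<sigma>, \<alpha>)" by (cases m)
  note l = leggedD[OF assms[unfolded m]]
  have e: "\<sigma> \<circ> \<alpha> \<circ> \<alpha> = \<sigma>" using l(3) by auto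
  have "closed_under (\<sigma> \<circ> \<alpha>) S \<longleftrightarrow> closed_under \<sigma> S" if "closed_under \<alpha> S" for S
    using that e closed_under_comp by metis
  then have "transitive_on X (\<sigma> \<circ> \<alpha>) \<alpha>" using l(6) unfolding transitive_on_def by blast
  moreover have "planar X (\<sigma> \<circ> \<alpha>) \<alpha>" using l(7) unfolding planar_def e by (simp add: add.commute)
  moreover have "\<sigma> \<circ> \<alpha> permutes X" using l permutes_compose by blast
  ultimately show ?thesis using l unfolding m dual_map_def legged_def by auto
qed

lemma dual_map_bij: "bij_betw dual_map (legged L X) (legged L X)"
  by (rule bij_betw_byWitness[where f' = dual_map]) (auto simp: dual_map_dual_map dual_map_legged)

lemma dual_map_sum: "(\<Sum>m\<in>legged L X. F (dual_map m)) = (\<Sum>m\<in>legged L X. F m)"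
  using dual_map_bij by (rule sum.reindex_bij_betw)

section \<open>Root edge decompositions\<close>

text \<open>The condition says that both sides of the root edge lie in one face. For planar maps
  this characterises isthmuses, by \<open>nonisthmic_cut\<close> and
  \<open>isthmic_decompose\<close>, and it is easier to use than disconnection.\<close>

definition isthmic :: "nat set \<Rightarrow> nat \<Rightarrow> cmap set" where
  "isthmic X a = {m \<in> legged {} X. snd m a \<in> orb (fst m \<circ> snd m) a}"

definition nonisthmic :: "nat set \<Rightarrow> nat \<Rightarrow> cmap set" where
  "nonisthmic X a = {m \<in> legged {} X. snd m a \<notin> orb (fst m \<circ> snd m) a}"

definition add_edge :: "nat \<Rightarrow> nat \<Rightarrow> cmap \<Rightarrow> cmap" where
  "add_edge a b m = (fst m, snd m \<circ> sw a b)"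

lemma add_edge_invol:
  assumes "\<And>x. \<alpha> (\<alpha> x) = x" "\<alpha> a = a" "\<alpha> b = b"
  shows "(\<alpha> \<circ> sw a b) ((\<alpha> \<circ> sw a b) x) = x"
proof -
  have "\<alpha> x = \<alpha> y \<longleftrightarrow> x = y" for x y by (metis assms(1))
  then show ?thesis using assms by (auto simp: Transposition.transpose_def)
qed

section \<open>Cutting the root edge and fusing two legs\<close>

lemma legged_edge_cut:
  assumes "(\<sigma>, \<alpha>) \<in> legged {} X" "finite X" "a \<in> X"
  shows "edge_cut X \<sigma> \<alpha> a (\<alpha> a)"
proof
  show "perm_on \<sigma> X" using assms leggedD(1) permutes_perm_on by blast
  show "invol_on \<alpha> X" using assms legged_invol by blast
  show "a \<noteq> \<alpha> a" using leggedD(5)[OF assms(1,3)] by auto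
qed (use assms in auto)

lemma cut_fixpoints:
  assumes "(\<sigma>, \<alpha>) \<in> legged {} X" "a \<in> X"
  shows "{x \<in> X. (\<alpha> \<circ> sw a (\<alpha> a)) x = x} = {a, \<alpha> a}"
    and "\<alpha> \<circ> sw a (\<alpha> a) permutes X"
    and "(\<alpha> \<circ> sw a (\<alpha> a)) ((\<alpha> \<circ> sw a (\<alpha> a)) x) = x"
proof -
  note l = leggedD[OF assms(1)]
  have X: "\<alpha> a \<in> X" using assms permutes_mem[OF l(2)] by blast
  show "{x \<in> X. (\<alpha> \<circ> sw a (\<alpha> a)) x = x} = {a, \<alpha> a}"
    using l(3,5) assms X by (auto simp: Transposition.transpose_def)
  show "\<alpha> \<circ> sw a (\<alpha> a) permutes X" using permutes_comp_sw[OF l(2) assms(2) X] .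
  have i: "\<alpha> x = \<alpha> y \<longleftrightarrow> x = y" for x y by (metis l(3))
  show "(\<alpha> \<circ> sw a (\<alpha> a)) ((\<alpha> \<circ> sw a (\<alpha> a)) x) = x"
    using l(3) i by (auto simp: Transposition.transpose_def)
qed

lemma add_edge_basics:
  assumes "(\<sigma>, \<beta>) \<in> {(\<sigma>, \<beta>). \<sigma> permutes X \<and> \<beta> permutes X \<and> (\<forall>x. \<beta> (\<beta> x) = x) \<and> {x \<in> X. \<beta> x = x} = {a, b}}"
    "finite X" "a \<noteq> b"
  shows "edge_cut X \<sigma> (\<beta> \<circ> sw a b) a b" "\<beta> \<circ> sw a b permutes X"
    "\<forall>x. (\<beta> \<circ> sw a b) ((\<beta> \<circ> sw a b) x) = x" "{x \<in> X. (\<beta> \<circ> sw a b) x = x} = {}"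
proof -
  have s: "\<sigma> permutes X" and p: "\<beta> permutes X" and i: "\<And>x. \<beta> (\<beta> x) = x" and f: "{x \<in> X. \<beta> x = x} = {a, b}"
    using assms by auto
  have X: "a \<in> X" "b \<in> X" "\<beta> a = a" "\<beta> b = b" using f by auto
  show q: "\<beta> \<circ> sw a b permutes X" using permutes_comp_sw[OF p] X by blast
  show j: "\<forall>x. (\<beta> \<circ> sw a b) ((\<beta> \<circ> sw a b) x) = x" using add_edge_invol i X by blast
  show "{x \<in> X. (\<beta> \<circ> sw a b) x = x} = {}"
    using X f assms(3) by (auto simp: Transposition.transpose_def)
  show "edge_cut X \<sigma> (\<beta> \<circ> sw a b) a b"
  proof
    show "perm_on \<sigma> X" using s assms(2) permutes_perm_on by blast
    show "invol_on (\<beta> \<circ> sw a b) X"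
      using j assms(2) permutes_mem[OF q] unfolding invol_on_def closed_under_def by blast
  qed (use X assms(3) in auto)
qed

text \<open>The cut merges the two faces at the root edge. Afterwards \<open>a\<close> and its
  partner lie in one face, which a disconnection would have to separate. One face and one edge are
  lost, so Euler's relation persists.\<close>

lemma nonisthmic_cut:
  assumes "(\<sigma>, \<alpha>) \<in> nonisthmic X a" "finite X" "a \<in> X"
  shows "(\<sigma>, \<alpha> \<circ> sw a (\<alpha> a)) \<in> legged {a, \<alpha> a} X" "\<alpha> a \<in> orb (\<sigma> \<circ> (\<alpha> \<circ> sw a (\<alpha> a))) a"
proof -
  have m: "(\<sigma>, \<alpha>) \<in> legged {} X" and n: "\<alpha> a \<notin> orb (\<sigma> \<circ> \<alpha>) a"
    using assms by (auto simp: nonisthmic_def)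
  note l = leggedD[OF m]
  interpret edge_cut X \<sigma> \<alpha> a "\<alpha> a" by (rule legged_edge_cut[OF m assms(2,3)])
  note mg = orb_merge[OF face_perm(1) a b n, folded face_cut]
  show o: "\<alpha> a \<in> orb (\<sigma> \<circ> \<alpha>') a" using mg(1) orb_self by blast
  have "transitive_on X \<sigma> \<alpha>'"
  proof (rule ccontr)
    assume "\<not> transitive_on X \<sigma> \<alpha>'"
    then obtain S where S: "a \<in> S" "\<alpha> a \<notin> S" "closed_under \<sigma> S" "closed_under \<alpha>' S"
      by (rule disconnected[OF l(6)])
    have "orb (\<sigma> \<circ> \<alpha>') a \<subseteq> S" by (rule orb_least[OF S(1) closed_under_comp[OF S(3,4)]])
    then show False using S(2) o by (metis subsetD)
  qed
  moreover have "planar X \<sigma> \<alpha>'"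
    using l(7) nonfix mg(4) unfolding planar_def distrib_left by linarith
  ultimately show "(\<sigma>, \<alpha>') \<in> legged {a, \<alpha> a} X"
    using l(1) cut_fixpoints[OF m a] unfolding legged_def by blast
qed

text \<open>Fusing two legs of the same face splits this face in two, which balances the additional
  edge in Euler's relation.\<close>

lemma add_edge_nonisthmic:
  assumes "(\<sigma>, \<beta>) \<in> legged {a, b} X" "b \<in> orb (\<sigma> \<circ> \<beta>) a" "finite X" "a \<noteq> b"
  shows "(\<sigma>, \<beta> \<circ> sw a b) \<in> nonisthmic X a" "(\<beta> \<circ> sw a b) a = b"
    "cyc (\<sigma> \<circ> (\<beta> \<circ> sw a b)) X = cyc (\<sigma> \<circ> \<beta>) X + 1"
proof -
  note l = leggedD[OF assms(1)]
  have base: "(\<sigma>, \<beta>) \<in> {(\<sigma>, \<beta>). \<sigma> permutes X \<and> \<beta> permutes X \<and> (\<forall>x. \<beta> (\<beta> x) = x) \<and> {x \<in> X. \<beta> x = x} = {a, b}}"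
    using assms(1) unfolding legged_def by auto
  note r = add_edge_basics[OF base assms(3,4)]
  let ?\<alpha> = "\<beta> \<circ> sw a b"
  interpret edge_cut X \<sigma> ?\<alpha> a b by (rule r(1))
  have c: "?\<alpha> \<circ> sw a b = \<beta>" by (rule comp_transpose_twice)
  have fb: "\<sigma> \<circ> ?\<alpha> = (\<sigma> \<circ> \<beta>) \<circ> sw a b" by auto
  have pf: "perm_on (\<sigma> \<circ> \<beta>) X" using face_perm(2) unfolding c .
  note sp = orb_split[OF pf a assms(2,4), folded fb]
  show "?\<alpha> a = b" by (rule ab)
  show "cyc (\<sigma> \<circ> ?\<alpha>) X = cyc (\<sigma> \<circ> \<beta>) X + 1" using sp(4) .
  have "transitive_on X \<sigma> ?\<alpha>" unfolding transitive_on_def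
  proof (intro conjI allI impI)
    fix S assume S: "S \<subseteq> X" "S \<noteq> {}" "closed_under \<sigma> S" "closed_under ?\<alpha> S"
    have "a \<in> S \<longleftrightarrow> b \<in> S" using S(4) ab ba unfolding closed_under_def by metis
    then have "closed_under \<beta> S" using closed_iff[of S] S(4) unfolding c by blast
    then show "S = X" using l(6) S unfolding transitive_on_def by blast
  qed (use a in auto)
  moreover have "planar X \<sigma> ?\<alpha>"
    using l(7) nonfix sp(4) unfolding planar_def distrib_left c by linarith
  ultimately have "(\<sigma>, ?\<alpha>) \<in> legged {} X" using l(1) r unfolding legged_def by blast
  then show "(\<sigma>, ?\<alpha>) \<in> nonisthmic X a" using sp(1) ab unfolding nonisthmic_def by simp
qed

lemma nonisthmic_sum_aux:
  fixes F :: "cmap \<Rightarrow> 'a :: comm_monoid_add"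
  assumes fX: "finite X" and a: "a \<in> X"
  shows "(\<Sum>m\<in>nonisthmic X a. F m) =
    (\<Sum>b\<in>X - {a}. \<Sum>m\<in>{m \<in> legged {a, b} X. b \<in> orb (fst m \<circ> snd m) a}. F (add_edge a b m))"
proof -
  let ?B = "\<lambda>b. {m \<in> legged {a, b} X. b \<in> orb (fst m \<circ> snd m) a}"
  let ?D = "SIGMA b:X - {a}. ?B b"
  let ?f = "\<lambda>(b, m). add_edge a b m"
  have inj: "inj_on ?f ?D"
  proof (rule inj_onI)
    fix p p' assume pp: "p \<in> ?D" "p' \<in> ?D" "?f p = ?f p'"
    obtain b \<sigma> \<beta> b' \<sigma>' \<beta>' where p: "p = (b, (\<sigma>, \<beta>))" "p' = (b', (\<sigma>', \<beta>'))"
      by (metis surj_pair)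
    have m: "(\<sigma>, \<beta>) \<in> legged {a, b} X" "(\<sigma>', \<beta>') \<in> legged {a, b'} X"
      and o: "b \<in> orb (\<sigma> \<circ> \<beta>) a" "b' \<in> orb (\<sigma>' \<circ> \<beta>') a" and n: "b \<noteq> a" "b' \<noteq> a"
      and e: "add_edge a b (\<sigma>, \<beta>) = add_edge a b' (\<sigma>', \<beta>')"
      using pp unfolding p by auto
    have e1: "\<sigma> = \<sigma>'" "\<beta> \<circ> sw a b = \<beta>' \<circ> sw a b'" using e by (auto simp: add_edge_def)
    have "b = b'"
      using add_edge_nonisthmic(2)[OF m(1) o(1) fX] add_edge_nonisthmic(2)[OF m(2) o(2) fX] n e1 by metis
    moreover have "\<beta> = \<beta>'" using e1 \<open>b = b'\<close> comp_transpose_twice by metis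
    ultimately show "p = p'" using e1 p by simp
  qed
  have img: "?f ` ?D = nonisthmic X a"
  proof
    show "?f ` ?D \<subseteq> nonisthmic X a"
      by (auto simp: add_edge_def intro!: add_edge_nonisthmic(1)[OF _ _ fX])
    show "nonisthmic X a \<subseteq> ?f ` ?D"
    proof
      fix m assume mm: "m \<in> nonisthmic X a"
      obtain \<sigma> \<alpha> where m: "m = (\<sigma>, \<alpha>)" by (cases m)
      note c = nonisthmic_cut[OF mm[unfolded m] fX a]
      have "(\<sigma>, \<alpha>) \<in> legged {} X" using mm m by (simp add: nonisthmic_def)
      note ec = legged_edge_cut[OF this fX a]
      have "\<alpha> a \<in> X - {a}" using edge_cut.b[OF ec] edge_cut.neq[OF ec] by auto
      then have mem: "(\<alpha> a, (\<sigma>, \<alpha> \<circ> sw a (\<alpha> a))) \<in> ?D" using c by auto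
      have eq: "?f (\<alpha> a, (\<sigma>, \<alpha> \<circ> sw a (\<alpha> a))) = m" unfolding m add_edge_def
        by (simp add: comp_transpose_twice)
      show "m \<in> ?f ` ?D" using imageI[OF mem, of ?f] unfolding eq .
    qed
  qed
  have "(\<Sum>m\<in>nonisthmic X a. F m) = (\<Sum>p\<in>?D. F (?f p))"
    unfolding img[symmetric] by (subst sum.reindex[OF inj]) (simp add: comp_def)
  also have "\<dots> = (\<Sum>b\<in>X - {a}. \<Sum>m\<in>?B b. F (add_edge a b m))"
    by (subst sum.Sigma) (auto simp: fX finite_legged case_prod_beta)
  finally show ?thesis .
qed

text \<open>After the cut the second leg \<open>b\<close> is erased as well. It had to share a face
  with \<open>a\<close>, so its possible positions are the corners of one face, and the remaining
  map carries the single leg \<open>a\<close>.\<close>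

lemma nonisthmic_sum:
  fixes F :: "cmap \<Rightarrow> 'a :: comm_monoid_add"
  assumes fX: "finite X" and a: "a \<in> X"
  shows "(\<Sum>m\<in>nonisthmic X a. F m) =
    (\<Sum>b\<in>X - {a}. \<Sum>m\<in>legged {a} (X - {b}). \<Sum>z\<in>orb (fst m \<circ> snd m) a.
       F (add_edge a b (add_leg b m (snd m z))))"
  unfolding nonisthmic_sum_aux[OF assms]
proof (rule sum.cong[OF refl])
  fix b assume b: "b \<in> X - {a}"
  let ?c = "\<lambda>m. b \<in> orb (fst m \<circ> snd m) a"
  let ?D = "X - {b}"
  have iX: "insert b ?D = X" "insert b {a} = {a, b}" using b by auto
  have "(\<Sum>m\<in>{m \<in> legged {a, b} X. ?c m}. F (add_edge a b m)) =
      (\<Sum>m\<in>legged {a, b} X. if ?c m then F (add_edge a b m) else 0)"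
    by (rule sum.inter_filter) (simp add: fX finite_legged)
  also have "\<dots> = (\<Sum>m\<in>legged {a} ?D. \<Sum>z\<in>?D. if ?c (add_leg b m z) then F (add_edge a b (add_leg b m z))
    else 0)"
    using add_leg_sum[of ?D b "{a}" "\<lambda>m. if ?c m then F (add_edge a b m) else 0"] fX a b iX by auto
  also have "\<dots> = (\<Sum>m\<in>legged {a} ?D. \<Sum>z\<in>orb (fst m \<circ> snd m) a. F (add_edge a b (add_leg b m (snd m z))))"
  proof (rule sum.cong[OF refl])
    fix m assume mm: "m \<in> legged {a} ?D"
    obtain \<sigma> \<alpha> where m: "m = (\<sigma>, \<alpha>)" by (cases m)
    note l = leggedD[OF mm[unfolded m]]
    have pf: "\<sigma> \<circ> \<alpha> permutes ?D" using l permutes_compose by blast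
    have aD: "a \<in> ?D" using a b by auto
    have fixb: "\<alpha> b = b" using permutes_fixes[OF l(2)] by blast
    have c: "?c (add_leg b m z) \<longleftrightarrow> \<alpha> z \<in> orb (\<sigma> \<circ> \<alpha>) a" if z: "z \<in> ?D" for z
    proof -
      have f: "fst (add_leg b m z) \<circ> snd (add_leg b m z) = (\<sigma> \<circ> \<alpha>) \<circ> sw (\<alpha> z) b"
        unfolding m add_leg_def using face_add_leg[of \<alpha> b \<sigma> z] l(3) fixb by simp
      have zD: "\<alpha> z \<in> ?D" using z permutes_mem[OF l(2)] by blast
      have P: "perm_on (\<sigma> \<circ> \<alpha>) ?D" using permutes_perm_on[OF pf] fX by simp
      have "b \<notin> orb (\<sigma> \<circ> \<alpha>) a" using perm_on_orb_subset[OF P aD] by blast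
      then have "?c (add_leg b m z) \<longleftrightarrow> a \<in> orb (\<sigma> \<circ> \<alpha>) (\<alpha> z)"
        unfolding f using orb_add_point(2)[OF pf _ zD _ aD, of b] fX by auto
      then show ?thesis using orb_sym[OF P] aD zD by blast
    qed
    have P: "perm_on (\<sigma> \<circ> \<alpha>) ?D" using permutes_perm_on[OF pf] fX by simp
    have oD: "orb (\<sigma> \<circ> \<alpha>) a \<subseteq> ?D" using perm_on_orb_subset[OF P aD] .
    have "(\<Sum>z\<in>?D. if ?c (add_leg b m z) then F (add_edge a b (add_leg b m z)) else 0) =
       (\<Sum>z\<in>{z \<in> ?D. \<alpha> z \<in> orb (\<sigma> \<circ> \<alpha>) a}. F (add_edge a b (add_leg b m z)))"
      using c fX by (subst sum.inter_filter) (auto intro: sum.cong)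
    also have "\<dots> = (\<Sum>z\<in>orb (\<sigma> \<circ> \<alpha>) a. F (add_edge a b (add_leg b m (\<alpha> z))))"
      by (rule sum.reindex_bij_witness[where i = \<alpha> and j = \<alpha>])
        (use l(3) oD permutes_mem[OF l(2)] in auto)
    finally show "(\<Sum>z\<in>?D. if ?c (add_leg b m z) then F (add_edge a b (add_leg b m z)) else 0) =
       (\<Sum>z\<in>orb (fst m \<circ> snd m) a. F (add_edge a b (add_leg b m (snd m z))))" using m by simp
  qed
  finally show "(\<Sum>m\<in>{m \<in> legged {a, b} X. ?c m}. F (add_edge a b m)) =
    (\<Sum>m\<in>legged {a} ?D. \<Sum>z\<in>orb (fst m \<circ> snd m) a. F (add_edge a b (add_leg b m (snd m z))))" .
qed

section \<open>Isthmic root edges: gluing two maps along their legs\<close>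

definition join :: "nat \<Rightarrow> nat \<Rightarrow> cmap \<Rightarrow> cmap \<Rightarrow> cmap" where
  "join a b m1 m2 = (fst m1 \<circ> fst m2, (snd m1 \<circ> snd m2) \<circ> sw a b)"

lemma disjoint_comp:
  assumes "p permutes S" "q permutes T" "S \<inter> T = {}"
  shows "x \<in> S \<Longrightarrow> (p \<circ> q) x = p x" "x \<in> T \<Longrightarrow> (p \<circ> q) x = q x" "p \<circ> q permutes S \<union> T"
proof -
  show "(p \<circ> q) x = p x" if "x \<in> S"
  proof -
    have "x \<notin> T" using that assms(3) by blast
    then show ?thesis using permutes_fixes[OF assms(2)] by simp
  qed
  show "(p \<circ> q) x = q x" if "x \<in> T"
  proof -
    have "q x \<notin> S" using that assms(3) permutes_mem[OF assms(2)] by blast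
    then show ?thesis using permutes_fixes[OF assms(1)] by simp
  qed
  have "p permutes S \<union> T" "q permutes S \<union> T"
    using permutes_subset[OF assms(1)] permutes_subset[OF assms(2)] by auto
  then show "p \<circ> q permutes S \<union> T" using permutes_compose by blast
qed

text \<open>\<open>\<beta>\<close> is the disjoint union of the two involutions, with legs
  \<open>a\<close> and \<open>b\<close>; \<open>\<alpha>\<close> fuses these legs into an
  isthmus.\<close>

locale glue =
  fixes S1 S2 :: "nat set" and \<sigma>1 \<alpha>1 \<sigma>2 \<alpha>2 :: "nat \<Rightarrow> nat" and a b :: nat
  assumes fin: "finite S1" "finite S2" and disj: "S1 \<inter> S2 = {}"
    and m1: "(\<sigma>1, \<alpha>1) \<in> legged {a} S1" and m2: "(\<sigma>2, \<alpha>2) \<in> legged {b} S2"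
begin

abbreviation "X \<equiv> S1 \<union> S2"
abbreviation "\<sigma> \<equiv> \<sigma>1 \<circ> \<sigma>2"
abbreviation "\<beta> \<equiv> \<alpha>1 \<circ> \<alpha>2"
abbreviation "\<alpha> \<equiv> \<beta> \<circ> sw a b"

lemmas l1 = leggedD[OF m1] and l2 = leggedD[OF m2]

lemma ab: "a \<in> S1" "b \<in> S2" "a \<noteq> b" "\<alpha>1 a = a" "\<alpha>2 b = b"
  using l1(4) l2(4) disj l1(5) l2(5) by auto

lemmas s = disjoint_comp[OF l1(1) l2(1) disj] and t = disjoint_comp[OF l1(2) l2(2) disj]

lemma mem: "x \<in> S1 \<Longrightarrow> \<sigma>1 x \<in> S1" "x \<in> S2 \<Longrightarrow> \<sigma>2 x \<in> S2" "x \<in> S1 \<Longrightarrow> \<alpha>1 x \<in> S1" "x \<in> S2 \<Longrightarrow> \<alpha>2 x \<in> S2"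
  using permutes_mem[OF l1(1)] permutes_mem[OF l2(1)] permutes_mem[OF l1(2)] permutes_mem[OF l2(2)] by blast+

lemma closed: "closed_under \<sigma> S1" "closed_under \<sigma> S2" "closed_under \<beta> S1" "closed_under \<beta> S2"
  unfolding closed_under_def using s(1,2) t(1,2) mem by (metis (no_types))+

lemma beta_invol: "\<beta> (\<beta> x) = x"
proof -
  consider "x \<in> S1" | "x \<in> S2" | "x \<notin> X" by blast
  then show ?thesis
  proof cases
    case 1
    then show ?thesis using t(1)[of x] t(1)[of "\<alpha>1 x"] mem(3) l1(3) by metis
  next
    case 2
    then show ?thesis using t(2)[of x] t(2)[of "\<alpha>2 x"] mem(4) l2(3) by metis
  next
    case 3
    then show ?thesis using permutes_fixes[OF t(3)] by metis
  qed
qed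

lemma beta_fix: "{x \<in> X. \<beta> x = x} = {a, b}"
proof -
  have "\<beta> x = x \<longleftrightarrow> x = a" if "x \<in> S1" for x using t(1)[OF that] l1(5)[OF that] by auto
  moreover have "\<beta> x = x \<longleftrightarrow> x = b" if "x \<in> S2" for x using t(2)[OF that] l2(5)[OF that] by auto
  ultimately show ?thesis using ab by blast
qed

lemma base: "(\<sigma>, \<beta>) \<in> {(\<sigma>, \<beta>). \<sigma> permutes X \<and> \<beta> permutes X \<and> (\<forall>x. \<beta> (\<beta> x) = x) \<and> {x \<in> X. \<beta> x = x} = {a, b}}"
  using s(3) t(3) beta_invol beta_fix by blast

lemma finX: "finite X" using fin by simp

lemmas r = add_edge_basics[OF base finX ab(3)]

lemma face: "x \<in> S1 \<Longrightarrow> (\<sigma> \<circ> \<beta>) x = (\<sigma>1 \<circ> \<alpha>1) x" "x \<in> S2 \<Longrightarrow> (\<sigma> \<circ> \<beta>) x = (\<sigma>2 \<circ> \<alpha>2) x"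
  using s(1)[of "\<alpha>1 x"] s(2)[of "\<alpha>2 x"] t(1)[of x] t(2)[of x] mem(3,4)[of x] by (metis comp_apply)+

lemma perms: "perm_on \<sigma> S1" "perm_on \<sigma> S2" "perm_on (\<sigma> \<circ> \<beta>) S1" "perm_on (\<sigma> \<circ> \<beta>) S2" "perm_on \<sigma> X"
  "perm_on (\<sigma> \<circ> \<beta>) X"
proof -
  show p: "perm_on \<sigma> X" using permutes_perm_on[OF s(3) finX] .
  show q: "perm_on (\<sigma> \<circ> \<beta>) X" using permutes_perm_on[OF permutes_compose[OF t(3) s(3)] finX] .
  show "perm_on \<sigma> S1" "perm_on \<sigma> S2" "perm_on (\<sigma> \<circ> \<beta>) S1" "perm_on (\<sigma> \<circ> \<beta>) S2"
    using perm_on_subset[OF p] perm_on_subset[OF q] closed closed_under_comp by (meson Un_upper1 Un_upper2)+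
qed

lemma cyc_vertex: "cyc \<sigma> X = cyc \<sigma>1 S1 + cyc \<sigma>2 S2"
proof -
  have "cyc \<sigma> S1 = cyc \<sigma>1 S1" by (rule cyc_cong[OF closed(1)]) (rule s(1))
  moreover have "cyc \<sigma> S2 = cyc \<sigma>2 S2" by (rule cyc_cong[OF closed(2)]) (rule s(2))
  ultimately show ?thesis unfolding cyc_Un[OF perms(1,2) disj] by argo
qed

lemma cyc_face: "cyc (\<sigma> \<circ> \<beta>) X = cyc (\<sigma>1 \<circ> \<alpha>1) S1 + cyc (\<sigma>2 \<circ> \<alpha>2) S2"
proof -
  have "cyc (\<sigma> \<circ> \<beta>) S1 = cyc (\<sigma>1 \<circ> \<alpha>1) S1"
    by (rule cyc_cong[OF closed_under_comp[OF closed(1,3)]]) (rule face(1))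
  moreover have "cyc (\<sigma> \<circ> \<beta>) S2 = cyc (\<sigma>2 \<circ> \<alpha>2) S2"
    by (rule cyc_cong[OF closed_under_comp[OF closed(2,4)]]) (rule face(2))
  ultimately show ?thesis unfolding cyc_Un[OF perms(3,4) disj] by argo
qed

lemma nonfix_split: "nonfix \<beta> X = nonfix \<alpha>1 S1 + nonfix \<alpha>2 S2"
proof -
  have "nonfix \<beta> S1 = nonfix \<alpha>1 S1" by (rule nonfix_cong) (rule t(1))
  moreover have "nonfix \<beta> S2 = nonfix \<alpha>2 S2" by (rule nonfix_cong) (rule t(2))
  ultimately show ?thesis unfolding nonfix_Un[OF fin disj] by argo
qed

lemma orb_vertex: "x \<in> S1 \<Longrightarrow> orb \<sigma> x = orb \<sigma>1 x" "x \<in> S2 \<Longrightarrow> orb \<sigma> x = orb \<sigma>2 x"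
  by (rule orb_cong[OF _ closed(1)], assumption, rule s(1), assumption)
    (rule orb_cong[OF _ closed(2)], assumption, rule s(2), assumption)

lemma orb_face: "x \<in> S1 \<Longrightarrow> orb (\<sigma> \<circ> \<beta>) x = orb (\<sigma>1 \<circ> \<alpha>1) x" "x \<in> S2 \<Longrightarrow> orb (\<sigma> \<circ> \<beta>) x = orb (\<sigma>2 \<circ> \<alpha>2) x"
  by (rule orb_cong[OF _ closed_under_comp[OF closed(1,3)]], assumption, rule face(1), assumption)
    (rule orb_cong[OF _ closed_under_comp[OF closed(2,4)]], assumption, rule face(2), assumption)

lemma not_in: "b \<notin> orb (\<sigma> \<circ> \<beta>) a" "b \<notin> orb \<sigma> a"
  using perm_on_orb_subset[OF perms(3) ab(1)] perm_on_orb_subset[OF perms(1) ab(1)] ab(2) disj by auto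

lemma face_join:
  "orb (\<sigma> \<circ> \<alpha>) a = orb (\<sigma>1 \<circ> \<alpha>1) a \<union> orb (\<sigma>2 \<circ> \<alpha>2) b"
  "orb (\<sigma>1 \<circ> \<alpha>1) a \<inter> orb (\<sigma>2 \<circ> \<alpha>2) b = {}"
  "cyc (\<sigma> \<circ> \<alpha>) X + 1 = cyc (\<sigma>1 \<circ> \<alpha>1) S1 + cyc (\<sigma>2 \<circ> \<alpha>2) S2"
proof -
  have fb: "\<sigma> \<circ> \<alpha> = (\<sigma> \<circ> \<beta>) \<circ> sw a b" by auto
  note m = orb_merge[OF perms(6) UnI1[OF ab(1)] UnI2[OF ab(2)] not_in(1), folded fb]
  show "orb (\<sigma> \<circ> \<alpha>) a = orb (\<sigma>1 \<circ> \<alpha>1) a \<union> orb (\<sigma>2 \<circ> \<alpha>2) b"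
    unfolding m(1) orb_face(1)[OF ab(1)] orb_face(2)[OF ab(2)] ..
  show "cyc (\<sigma> \<circ> \<alpha>) X + 1 = cyc (\<sigma>1 \<circ> \<alpha>1) S1 + cyc (\<sigma>2 \<circ> \<alpha>2) S2"
    using m(4) cyc_face by argo
  show "orb (\<sigma>1 \<circ> \<alpha>1) a \<inter> orb (\<sigma>2 \<circ> \<alpha>2) b = {}"
    using perm_on_orb_subset[OF perms(3) ab(1)] perm_on_orb_subset[OF perms(4) ab(2)] orb_face ab disj by auto
qed

text \<open>Fusing merges the faces of the two legs, so v1 + v2 - (e1 + e2 + 1) + (f1 + f2 - 1) = 2.
  A closed set contains both or neither of \<open>a\<close> and \<open>b\<close>, hence both
  components or neither.\<close>

lemma join_isthmic: "(\<sigma>, \<alpha>) \<in> isthmic X a"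
proof -
  have "transitive_on X \<sigma> \<alpha>" unfolding transitive_on_def
  proof (intro conjI allI impI)
    fix S assume S: "S \<subseteq> X" "S \<noteq> {}" "closed_under \<sigma> S" "closed_under \<alpha> S"
    have "a \<in> S \<longleftrightarrow> b \<in> S" using S(4) edge_cut.ab[OF r(1)] edge_cut.ba[OF r(1)] unfolding closed_under_def
      by metis
    then have cb: "closed_under \<beta> S" using edge_cut.closed_iff[OF r(1), of S] S(4)
      unfolding comp_transpose_twice by blast
    have c1: "closed_under \<sigma>1 (S \<inter> S1)" "closed_under \<alpha>1 (S \<inter> S1)"
      using S(3) cb s(1) t(1) mem(1,3) unfolding closed_under_def by (metis IntE IntI)+
    have c2: "closed_under \<sigma>2 (S \<inter> S2)" "closed_under \<alpha>2 (S \<inter> S2)"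
      using S(3) cb s(2) t(2) mem(2,4) unfolding closed_under_def by (metis IntE IntI)+
    have i1: "S \<inter> S1 = {} \<or> S1 \<subseteq> S" using l1(6) c1 unfolding transitive_on_def by blast
    have i2: "S \<inter> S2 = {} \<or> S2 \<subseteq> S" using l2(6) c2 unfolding transitive_on_def by blast
    show "S = X" using i1 i2 S(1,2) ab \<open>a \<in> S \<longleftrightarrow> b \<in> S\<close> by blast
  qed (use ab in auto)
  moreover have "planar X \<sigma> \<alpha>"
    using l1(7) l2(7) edge_cut.nonfix[OF r(1)] nonfix_split face_join(3) cyc_vertex
    unfolding planar_def distrib_left comp_transpose_twice by linarith
  ultimately have "(\<sigma>, \<alpha>) \<in> legged {} X" using s(3) r unfolding legged_def by blast
  moreover have "b \<in> orb (\<sigma> \<circ> \<alpha>) a" using face_join(1) orb_self by blast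
  ultimately show ?thesis using edge_cut.ab[OF r(1)] unfolding isthmic_def by simp
qed

lemma restricts: "\<sigma>1 = perm_restrict \<sigma> S1" "\<alpha>1 = perm_restrict \<beta> S1" "\<sigma>2 = perm_restrict \<sigma> S2"
  "\<alpha>2 = perm_restrict \<beta> S2"
  unfolding perm_restrict_def fun_eq_iff
  using s(1,2) t(1,2) permutes_fixes[OF l1(1)] permutes_fixes[OF l1(2)] permutes_fixes[OF l2(1)]
    permutes_fixes[OF l2(2)]
  by (metis (full_types))+

end

lemma perm_restrict_permutes:
  assumes "p permutes X" "finite X" "S \<subseteq> X" "closed_under p S"
  shows "perm_restrict p S permutes S"
proof -
  have "bij_betw p S S"
    using perm_on_subset[OF permutes_perm_on[OF assms(1,2)] assms(3,4)] by (simp add: perm_on_def)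
  then have "bij_betw (perm_restrict p S) S S"
    by (subst bij_betw_cong[where g = p]) (simp_all add: perm_restrict_def)
  then show ?thesis by (intro bij_imp_permutes) (simp_all add: perm_restrict_def)
qed

text \<open>Cutting splits the face shared by both sides, which raises v - e + f to 4. By
  \<open>genus_bound\<close> the cut map cannot be connected; and since neither part exceeds 2, both
  attain it and are planar.\<close>

lemma isthmic_decompose:
  assumes mm: "(\<sigma>, \<alpha>) \<in> isthmic X a" and fX: "finite X" and a: "a \<in> X"
  obtains S m1 m2 where "S \<subseteq> X" "a \<in> S" "\<alpha> a \<in> X - S" "m1 \<in> legged {a} S" "m2 \<in> legged {\<alpha> a} (X - S)"
    "join a (\<alpha> a) m1 m2 = (\<sigma>, \<alpha>)"
proof -
  have m: "(\<sigma>, \<alpha>) \<in> legged {} X" and n: "\<alpha> a \<in> orb (\<sigma> \<circ> \<alpha>) a"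
    using mm by (auto simp: isthmic_def)
  note l = leggedD[OF m]
  interpret edge_cut X \<sigma> \<alpha> a "\<alpha> a" by (rule legged_edge_cut[OF m fX a])
  note sp = orb_split[OF face_perm(1) a n neq, folded face_cut]
  \<comment> \<open>The constant 8 is twice the 4 in \<open>planar\<close>: the Euler relation of
    two components instead of one.\<close>
  have pl: "2 * cyc \<sigma> X + 2 * cyc (\<sigma> \<circ> \<alpha>') X = nonfix \<alpha>' X + 8"
    using l(7) nonfix sp(4) unfolding planar_def distrib_left by linarith
  have "\<not> transitive_on X \<sigma> \<alpha>'"
    using genus_bound[OF perm inv'] pl by auto
  then obtain S where S: "S \<subseteq> X" "a \<in> S" "\<alpha> a \<notin> S" "closed_under \<sigma> S" "closed_under \<alpha>' S"
    "transitive_on S \<sigma> \<alpha>'" "transitive_on (X - S) \<sigma> \<alpha>'"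
    by (rule disconnected[OF l(6)])
  let ?T = "X - S"
  have p': "perm_on \<alpha>' X" using inv' invol_on_perm by blast
  have D: "closed_under \<sigma> ?T" "closed_under \<alpha>' ?T"
    using perm_on_Diff[OF perm S(1,4)] perm_on_Diff[OF p' S(1,5)] by auto
  have u: "S \<union> ?T = X" and dj: "S \<inter> ?T = {}" using S(1) by auto
  have fS: "finite S" "finite ?T" using fX S(1) finite_subset by auto
  note cf = cut_fixpoints[OF m a]
  have pS: "perm_on \<sigma> S" "perm_on \<sigma> ?T" "perm_on (\<sigma> \<circ> \<alpha>') S" "perm_on (\<sigma> \<circ> \<alpha>') ?T"
    using perm_on_subset[OF perm] perm_on_subset[OF face_perm(2)] S D closed_under_comp
      by (meson Diff_subset)+
  have iS: "invol_on \<alpha>' S" "invol_on \<alpha>' ?T"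
    using invol_on_subset[OF inv'] S D by (meson Diff_subset)+
  have g: "2 * (cyc \<sigma> S + cyc (\<sigma> \<circ> \<alpha>') S) \<le> nonfix \<alpha>' S + 4"
    "2 * (cyc \<sigma> ?T + cyc (\<sigma> \<circ> \<alpha>') ?T) \<le> nonfix \<alpha>' ?T + 4"
    using genus_bound[OF pS(1) iS(1) S(6)] genus_bound[OF pS(2) iS(2) S(7)] .
  have e: "cyc \<sigma> X = cyc \<sigma> S + cyc \<sigma> ?T" "cyc (\<sigma> \<circ> \<alpha>') X = cyc (\<sigma> \<circ> \<alpha>') S + cyc (\<sigma> \<circ> \<alpha>') ?T"
    "nonfix \<alpha>' X = nonfix \<alpha>' S + nonfix \<alpha>' ?T"
    using cyc_Un[OF pS(1,2) dj] cyc_Un[OF pS(3,4) dj] nonfix_Un[OF fS dj] unfolding u .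
  have pl2: "planar S \<sigma> \<alpha>'" "planar ?T \<sigma> \<alpha>'"
    using g pl e unfolding planar_def distrib_left by linarith+
  have part: "(perm_restrict \<sigma> U, perm_restrict \<alpha>' U) \<in> legged {c} U"
    if U: "U \<subseteq> X" "closed_under \<sigma> U" "closed_under \<alpha>' U" "transitive_on U \<sigma> \<alpha>'" "planar U \<sigma> \<alpha>'"
      "U \<inter> {a, \<alpha> a} = {c}" for U c
  proof -
    have r: "perm_restrict \<sigma> U x = \<sigma> x" "perm_restrict \<alpha>' U x = \<alpha>' x" if "x \<in> U" for x
      using that by (simp_all add: perm_restrict_def)
    have cl: "closed_under (perm_restrict \<sigma> U) U" "closed_under (perm_restrict \<alpha>' U) U"
      using U(2,3) r unfolding closed_under_def by metis+
    have "transitive_on U (perm_restrict \<sigma> U) (perm_restrict \<alpha>' U)"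
      by (rule iffD2[OF transitive_on_cong U(4)]) (rule r, assumption)+
    moreover have "cyc (perm_restrict \<sigma> U) U = cyc \<sigma> U"
      using cyc_cong[of "perm_restrict \<sigma> U" U \<sigma>, OF cl(1) r(1)] .
    moreover have "cyc (perm_restrict \<sigma> U \<circ> perm_restrict \<alpha>' U) U = cyc (\<sigma> \<circ> \<alpha>') U"
    proof (rule cyc_cong[OF closed_under_comp[OF cl]])
      fix y assume y: "y \<in> U"
      then have "\<alpha>' y \<in> U" using U(3) unfolding closed_under_def by blast
      then show "(perm_restrict \<sigma> U \<circ> perm_restrict \<alpha>' U) y = (\<sigma> \<circ> \<alpha>') y"
        using y unfolding perm_restrict_def by simp
    qed
    moreover have "nonfix (perm_restrict \<alpha>' U) U = nonfix \<alpha>' U"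
      using nonfix_cong[of U "perm_restrict \<alpha>' U" "\<alpha>'", OF r(2)] .
    moreover have "perm_restrict \<sigma> U permutes U" "perm_restrict \<alpha>' U permutes U"
      using perm_restrict_permutes[OF l(1) fX U(1,2)] perm_restrict_permutes[OF cf(2) fX U(1,3)] .
    moreover have "perm_restrict \<alpha>' U (perm_restrict \<alpha>' U x) = x" for x
    proof (cases "x \<in> U")
      case True
      then have "\<alpha>' x \<in> U" using U(3) unfolding closed_under_def by blast
      then show ?thesis unfolding r(2)[OF True] using r(2) cf(3) by metis
    qed (simp add: perm_restrict_def)
    moreover have "{x \<in> U. perm_restrict \<alpha>' U x = x} = {c}"
    proof -
      have "{x \<in> U. perm_restrict \<alpha>' U x = x} = U \<inter> {x \<in> X. \<alpha>' x = x}"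
        using r(2) U(1) by (auto simp del: comp_apply)
      then show ?thesis unfolding cf(1) U(6) .
    qed
    ultimately show ?thesis using U(5) unfolding legged_def planar_def by simp
  qed
  have i: "S \<inter> {a, \<alpha> a} = {a}" "?T \<inter> {a, \<alpha> a} = {\<alpha> a}" using S b by auto
  have P: "(perm_restrict \<sigma> S, perm_restrict \<alpha>' S) \<in> legged {a} S"
    "(perm_restrict \<sigma> ?T, perm_restrict \<alpha>' ?T) \<in> legged {\<alpha> a} ?T"
    using part[OF S(1,4,5,6) pl2(1) i(1)] part[OF _ D S(7) pl2(2) i(2)] by auto
  have comp: "perm_restrict p S \<circ> perm_restrict p ?T = p"
    if "p permutes X" "closed_under p S" "closed_under p ?T" for p
  proof
    fix x
    consider "x \<in> S" | "x \<in> ?T" | "x \<notin> X" using S(1) by blast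
    then show "(perm_restrict p S \<circ> perm_restrict p ?T) x = p x"
    proof cases
      case 1 then show ?thesis by (simp add: perm_restrict_def)
    next
      case 2
      then have "p x \<in> ?T" using that(3) unfolding closed_under_def by blast
      then show ?thesis using 2 by (simp add: perm_restrict_def)
    next
      case 3
      then show ?thesis using permutes_fixes[OF that(1) 3] S(1) by (auto simp: perm_restrict_def)
    qed
  qed
  have "join a (\<alpha> a) (perm_restrict \<sigma> S, perm_restrict \<alpha>' S) (perm_restrict \<sigma> ?T, perm_restrict \<alpha>' ?T) =
    (\<sigma>, \<alpha>)"
    unfolding join_def using comp[OF l(1) S(4) D(1)] comp[OF cf(2) S(5) D(2)]
      by (simp add: comp_transpose_twice)
  then show ?thesis using that[OF S(1,2) _ P] S(3) b by blast
qed

lemma glueI: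
  assumes "finite X" "S \<subseteq> X" "m1 \<in> legged {a} S" "m2 \<in> legged {b} (X - S)"
  shows "glue S (X - S) (fst m1) (snd m1) (fst m2) (snd m2) a b"
  by unfold_locales (use assms finite_subset in auto)

text \<open>Fusing legs does not alter the vertices, so the two ends of an isthmus stay at vertices
  of different parts.\<close>

lemma isthmic_not_loop:
  assumes "m \<in> isthmic X a" "finite X" "a \<in> X"
  shows "snd m a \<notin> orb (fst m) a"
proof -
  obtain \<sigma> \<alpha> where m: "m = (\<sigma>, \<alpha>)" by (cases m)
  obtain S m1 m2 where S: "S \<subseteq> X" "m1 \<in> legged {a} S" "m2 \<in> legged {\<alpha> a} (X - S)"
    "join a (\<alpha> a) m1 m2 = (\<sigma>, \<alpha>)"
    using isthmic_decompose[OF assms(1)[unfolded m] assms(2,3)] by metis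
  interpret glue S "X - S" "fst m1" "snd m1" "fst m2" "snd m2" a "\<alpha> a"
    by (rule glueI[OF assms(2) S(1-3)])
  have "\<sigma> = fst m1 \<circ> fst m2" using S(4) by (simp add: join_def)
  then show ?thesis using not_in(2) m by simp
qed

text \<open>Everything is read off from the joined map: \<open>b\<close> is the partner of
  \<open>a\<close>, \<open>S\<close> is the component of \<open>a\<close> after the cut, and the two
  maps are the restrictions to \<open>S\<close> and its complement.\<close>

lemma join_inj:
  assumes fX: "finite X" and S: "S \<subseteq> X" "S' \<subseteq> X"
    and m: "m1 \<in> legged {a} S" "m2 \<in> legged {b} (X - S)"
    and m': "m1' \<in> legged {a} S'" "m2' \<in> legged {b'} (X - S')"
    and e: "join a b m1 m2 = join a b' m1' m2'"
  shows "b = b'" "S = S'" "m1 = m1'" "m2 = m2'"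
proof -
  interpret A: glue S "X - S" "fst m1" "snd m1" "fst m2" "snd m2" a b by (rule glueI[OF fX S(1) m])
  interpret B: glue S' "X - S'" "fst m1'" "snd m1'" "fst m2'" "snd m2'" a b' by (rule glueI[OF fX S(2) m'])
  have e1: "A.\<sigma> = B.\<sigma>" and e2: "A.\<alpha> = B.\<alpha>" using e by (auto simp: join_def)
  show b: "b = b'" using edge_cut.ab[OF A.r(1)] edge_cut.ab[OF B.r(1)] unfolding e2 by metis
  have e3: "A.\<beta> = B.\<beta>" using e2 unfolding b by (metis comp_transpose_twice)
  have cI: "closed_under A.\<sigma> (S \<inter> S')" "closed_under A.\<beta> (S \<inter> S')"
    using A.closed(1,3) B.closed(1,3) unfolding e1 e3 closed_under_def by blast+
  have t: "transitive_on S A.\<sigma> A.\<beta>" by (rule iffD2[OF transitive_on_cong A.l1(6)]) (rule A.s(1) A.t(1),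
    assumption)+
  have t': "transitive_on S' A.\<sigma> A.\<beta>" unfolding e1 e3
    by (rule iffD2[OF transitive_on_cong B.l1(6)]) (rule B.s(1) B.t(1), assumption)+
  have a: "a \<in> S \<inter> S'" using A.ab(1) B.ab(1) by blast
  have "S \<inter> S' = S" using transitive_on_single_orbit[OF t _ _ a cI] a by blast
  moreover have "S \<inter> S' = S'" using transitive_on_single_orbit[OF t' _ _ a cI] a by blast
  ultimately show SS: "S = S'" by simp
  show "m1 = m1'" using A.restricts(1,2) B.restricts(1,2) unfolding e1 e3 SS by (metis prod_eqI)
  show "m2 = m2'" using A.restricts(3,4) B.restricts(3,4) unfolding e1 e3 SS by (metis prod_eqI)
qed

text \<open>Here \<open>S\<close> stands for the darts of the first part without \<open>a\<close>,
  so that its size is the number of darts besides the leg, the index used by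
  \<open>leg_sum\<close>.\<close>

lemma isthmic_sum:
  fixes F :: "cmap \<Rightarrow> 'a :: comm_monoid_add"
  assumes fX: "finite X" and a: "a \<in> X"
  shows "(\<Sum>m\<in>isthmic X a. F m) =
    (\<Sum>b\<in>X - {a}. \<Sum>S\<in>Pow (X - {a, b}). \<Sum>m1\<in>legged {a} (insert a S).
       \<Sum>m2\<in>legged {b} (X - insert a S). F (join a b m1 m2))"
proof -
  let ?E = "\<lambda>b S. legged {a} (insert a S) \<times> legged {b} (X - insert a S)"
  let ?D = "SIGMA b:X - {a}. SIGMA S:Pow (X - {a, b}). ?E b S"
  let ?f = "\<lambda>(b, S, m1, m2). join a b m1 m2"
  have inj: "inj_on ?f ?D"
  proof (rule inj_onI)
    fix p p' assume pp: "p \<in> ?D" "p' \<in> ?D" "?f p = ?f p'"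
    obtain b S m1 m2 b' S' m1' m2' where p: "p = (b, S, m1, m2)" "p' = (b', S', m1', m2')"
      by (metis surj_pair)
    have *: "insert a S \<subseteq> X" "insert a S' \<subseteq> X" "a \<notin> S" "a \<notin> S'"
      "m1 \<in> legged {a} (insert a S)" "m2 \<in> legged {b} (X - insert a S)"
      "m1' \<in> legged {a} (insert a S')" "m2' \<in> legged {b'} (X - insert a S')"
      "join a b m1 m2 = join a b' m1' m2'"
      using pp a unfolding p by auto
    note j = join_inj[OF fX *(1,2,5-9)]
    have "S = S'" using j(2) insert_ident[OF *(3,4)] by blast
    then show "p = p'" unfolding p using j by blast
  qed
  have img: "?f ` ?D = isthmic X a"
  proof
    show "?f ` ?D \<subseteq> isthmic X a"
    proof
      fix m assume "m \<in> ?f ` ?D"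
      then obtain p where p: "p \<in> ?D" "m = ?f p" by blast
      obtain b S m1 m2 where pe: "p = (b, S, m1, m2)" by (metis surj_pair)
      have *: "b \<in> X - {a}" "S \<subseteq> X - {a, b}" "m1 \<in> legged {a} (insert a S)"
        "m2 \<in> legged {b} (X - insert a S)" "m = join a b m1 m2"
        using p unfolding pe by auto
      have i: "insert a S \<subseteq> X" using * a by auto
      interpret glue "insert a S" "X - insert a S" "fst m1" "snd m1" "fst m2" "snd m2" a b
        by (rule glueI[OF fX i *(3,4)])
      have u: "insert a S \<union> (X - insert a S) = X" using i by auto
      show "m \<in> isthmic X a" using join_isthmic unfolding *(5) join_def u .
    qed
    show "isthmic X a \<subseteq> ?f ` ?D"
    proof
      fix m assume mm: "m \<in> isthmic X a"
      obtain \<sigma> \<alpha> where m: "m = (\<sigma>, \<alpha>)" by (cases m)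
      obtain S m1 m2 where S: "S \<subseteq> X" "a \<in> S" "\<alpha> a \<in> X - S" "m1 \<in> legged {a} S" "m2 \<in> legged {\<alpha> a} (X - S)"
        "join a (\<alpha> a) m1 m2 = (\<sigma>, \<alpha>)"
        using isthmic_decompose[OF mm[unfolded m] fX a] by metis
      have i: "insert a (S - {a}) = S" using S by auto
      have mem: "(\<alpha> a, S - {a}, m1, m2) \<in> ?D" using S a unfolding mem_Sigma_iff i by auto
      have eq: "?f (\<alpha> a, S - {a}, m1, m2) = m" using S(6) m by simp
      show "m \<in> ?f ` ?D" using imageI[OF mem, of ?f] unfolding eq .
    qed
  qed
  have finE: "finite (legged {a} (insert a S))" "finite (legged {c} (X - S'))" if "S \<subseteq> X - {a, b}"
    for b c S S'
    using that fX finite_subset[OF that] by (auto intro!: finite_legged)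
  have "(\<Sum>m\<in>isthmic X a. F m) = (\<Sum>p\<in>?D. F (?f p))"
    unfolding img[symmetric] by (subst sum.reindex[OF inj]) (simp add: comp_def)
  also have "\<dots> = (\<Sum>b\<in>X - {a}. \<Sum>p\<in>(SIGMA S:Pow (X - {a, b}). ?E b S). F (?f (b, p)))"
    by (subst sum.Sigma) (auto simp: fX finE case_prod_beta intro!: finite_SigmaI)
  also have "\<dots> = (\<Sum>b\<in>X - {a}. \<Sum>S\<in>Pow (X - {a, b}). \<Sum>p\<in>?E b S. F (?f (b, S, p)))"
    by (intro sum.cong refl, subst sum.Sigma)
      (auto simp: fX finE case_prod_beta intro!: finite_SigmaI)
  also have "\<dots> = (\<Sum>b\<in>X - {a}. \<Sum>S\<in>Pow (X - {a, b}). \<Sum>m1\<in>legged {a} (insert a S).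
       \<Sum>m2\<in>legged {b} (X - insert a S). F (join a b m1 m2))"
    by (intro sum.cong refl) (simp add: sum.cartesian_product case_prod_beta)
  finally show ?thesis .
qed

section \<open>Loops and nonloops by duality\<close>

definition loops :: "nat set \<Rightarrow> nat \<Rightarrow> cmap set" where
  "loops X a = {m \<in> legged {} X. snd m a \<in> orb (fst m) a}"

definition nonloops :: "nat set \<Rightarrow> nat \<Rightarrow> cmap set" where
  "nonloops X a = {m \<in> legged {} X. snd m a \<notin> orb (fst m) a}"

lemma dual_map_loops: "bij_betw dual_map (isthmic X a) (loops X a)"
  "bij_betw dual_map (nonisthmic X a) (nonloops X a)"
proof -
  have f: "fst (dual_map m) = fst m \<circ> snd m" "snd (dual_map m) = snd m" for m by (auto simp: dual_map_def)
  have d: "fst m \<circ> snd m \<circ> snd m = fst m" if "m \<in> legged {} X" for m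
    using dual_map_dual_map[OF that] unfolding dual_map_def by (metis fst_conv snd_conv)
  have d': "\<sigma> \<circ> \<alpha> \<circ> \<alpha> = \<sigma>" if "(\<sigma>, \<alpha>) \<in> legged {} X" for \<sigma> \<alpha>
    using d[OF that] by simp
  show "bij_betw dual_map (isthmic X a) (loops X a)" "bij_betw dual_map (nonisthmic X a) (nonloops X a)"
    by (rule bij_betw_byWitness[where f' = dual_map];
      auto simp: isthmic_def nonisthmic_def loops_def nonloops_def dual_map_dual_map dual_map_legged f
        d' simp del: comp_apply)+
qed

lemma loops_sum: "(\<Sum>m\<in>loops X a. F m) = (\<Sum>m\<in>isthmic X a. F (dual_map m))"
  by (rule sum.reindex_bij_betw[OF dual_map_loops(1), symmetric])

lemma nonloops_sum: "(\<Sum>m\<in>nonloops X a. F m) = (\<Sum>m\<in>nonisthmic X a. F (dual_map m))"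
  by (rule sum.reindex_bij_betw[OF dual_map_loops(2), symmetric])

section \<open>Potts polynomials\<close>

definition eval_q :: "nat \<Rightarrow> rat poly poly \<Rightarrow> rat poly" where
  "eval_q n P = map_poly (\<lambda>c. poly c (of_nat n)) P"

definition toK :: "rat poly poly \<Rightarrow> K" where "toK P = Fract [:P:] 1"

definition represents :: "rat poly poly \<Rightarrow> (nat \<Rightarrow> rat poly) \<Rightarrow> bool" where
  "represents P f \<longleftrightarrow> (\<forall>n\<ge>1. eval_q n P = f n)"

definition polyrep :: "(nat \<Rightarrow> rat poly) \<Rightarrow> bool" where
  "polyrep f \<longleftrightarrow> (\<exists>P. represents P f)"

text \<open>Mirrors the definite description in \<open>potts\<close>, for arbitrary functions of the
  number of colours. Identities between colour sums at every positive integer thereby become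
  identities in K, as soon as the sums are known to be polynomial.\<close>

definition interpK :: "(nat \<Rightarrow> rat poly) \<Rightarrow> K" where
  "interpK f = toK (THE P. represents P f)"

lemma coeff_eval_q: "coeff (eval_q n P) i = poly (coeff P i) (of_nat n)"
  by (simp add: eval_q_def coeff_map_poly)

lemma eval_q_hom: "eval_q n (P + Q) = eval_q n P + eval_q n Q" "eval_q n (P * Q) = eval_q n P * eval_q n Q"
  by (rule poly_eqI, simp add: coeff_eval_q coeff_mult poly_sum)+

lemma eval_q_const: "eval_q n [:c:] = [:poly c (of_nat n):]"
  by (rule poly_eqI) (simp add: coeff_eval_q coeff_pCons split: nat.split)

lemma eval_q_nu: "eval_q n [:0, 1:] = [:0, 1:]"
  by (rule poly_eqI) (simp add: coeff_eval_q coeff_pCons split: nat.split)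

text \<open>For each power of \<nu>, the difference of the coefficients is a polynomial in q that
  vanishes at all positive integers.\<close>

lemma represents_unique:
  assumes "represents P f" "represents Q f" shows "P = Q"
proof (rule poly_eqI)
  fix i
  have "poly (coeff P i - coeff Q i) (of_nat n) = 0" if "n \<ge> 1" for n
    using assms that coeff_eval_q unfolding represents_def by (metis eq_iff_diff_eq_0 poly_diff)
  then have "(of_nat ` {1..} :: rat set) \<subseteq> {x. poly (coeff P i - coeff Q i) x = 0}" by auto
  moreover have "infinite (of_nat ` {1..} :: rat set)"
    by (subst finite_image_iff) (auto simp: inj_on_def infinite_Ici)
  ultimately have "infinite {x. poly (coeff P i - coeff Q i) x = 0}" using finite_subset by blast
  then show "coeff P i = coeff Q i" using poly_roots_finite[of "coeff P i - coeff Q i"] by auto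
qed

lemma interpK_eq: "represents P f \<Longrightarrow> interpK f = toK P"
  unfolding interpK_def using represents_unique by (metis the_equality)

lemma toK_hom: "toK (P + Q) = toK P + toK Q" "toK (P * Q) = toK P * toK Q"
  by (simp_all add: toK_def mult.commute)

lemma represents_hom:
  "represents P f \<Longrightarrow> represents Q g \<Longrightarrow> represents (P + Q) (\<lambda>n. f n + g n)"
  "represents P f \<Longrightarrow> represents Q g \<Longrightarrow> represents (P * Q) (\<lambda>n. f n * g n)"
  by (simp_all add: represents_def eval_q_hom)

lemma interpK_hom:
  assumes "polyrep f" "polyrep g"
  shows "interpK (\<lambda>n. f n + g n) = interpK f + interpK g" "interpK (\<lambda>n. f n * g n) = interpK f * interpK g"
proof -
  obtain P Q where P: "represents P f" and Q: "represents Q g" using assms by (auto simp: polyrep_def)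
  show "interpK (\<lambda>n. f n + g n) = interpK f + interpK g"
    unfolding interpK_eq[OF represents_hom(1)[OF P Q]] interpK_eq[OF P] interpK_eq[OF Q] toK_hom ..
  show "interpK (\<lambda>n. f n * g n) = interpK f * interpK g"
    unfolding interpK_eq[OF represents_hom(2)[OF P Q]] interpK_eq[OF P] interpK_eq[OF Q] toK_hom ..
qed

lemma polyrep_hom:
  assumes "polyrep f" "polyrep g"
  shows "polyrep (\<lambda>n. f n + g n)" "polyrep (\<lambda>n. f n * g n)"
proof -
  obtain P Q where P: "represents P f" and Q: "represents Q g" using assms by (auto simp: polyrep_def)
  show "polyrep (\<lambda>n. f n + g n)" "polyrep (\<lambda>n. f n * g n)"
    using represents_hom(1)[OF P Q] represents_hom(2)[OF P Q] unfolding polyrep_def by blast+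
qed

lemma interpK_cong: "(\<And>n. n \<ge> 1 \<Longrightarrow> f n = g n) \<Longrightarrow> interpK f = interpK g"
  by (simp add: interpK_def represents_def)

lemma represents_nu: "represents ([:0, 1:] - 1) (\<lambda>n. [:0, 1:] - 1)"
proof -
  have e: "([:0, 1:] - 1 :: rat poly poly) = [:0, 1:] + [:- 1:]"
    "([:0, 1:] - 1 :: rat poly) = [:0, 1:] + [:- 1:]"
    by (simp_all add: one_pCons)
  have "eval_q n [:- 1:] = [:- 1:]" for n by (simp add: eval_q_const)
  then show ?thesis unfolding represents_def e eval_q_hom eval_q_nu by simp
qed

lemma interpK_nu: "interpK (\<lambda>n. [:0, 1:] - 1) = nuK - 1"
  unfolding interpK_eq[OF represents_nu] by (simp add: toK_def nuK_def one_pCons One_fract_def)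

lemma represents_q: "represents [:[:0, 1:]:] of_nat"
  by (simp add: represents_def eval_q_const of_nat_poly)

lemma interpK_q: "interpK of_nat = qK"
  unfolding interpK_eq[OF represents_q] by (simp add: toK_def qK_def)

lemma polyrep_nu: "polyrep (\<lambda>n. [:0, 1:] - 1)" and polyrep_q: "polyrep of_nat"
  using represents_nu represents_q polyrep_def by blast+

lemma polyrep_q_power: "polyrep (\<lambda>n. of_nat (n ^ k))"
proof (induction k)
  case 0
  have "represents 1 (\<lambda>n. 1)" by (simp add: represents_def eval_q_const one_pCons)
  then show ?case by (auto simp: polyrep_def)
next
  case (Suc k)
  show ?case using polyrep_hom(2)[OF polyrep_q Suc] by simp
qed

text \<open>The pairs in \<open>P\<close> are darts forced to have equal colours: \<open>P\<close> generates the vertices, and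
  contracting an edge enlarges \<open>P\<close>.\<close>

definition colset :: "nat set \<Rightarrow> (nat \<times> nat) set \<Rightarrow> nat \<Rightarrow> (nat \<Rightarrow> nat) set" where
  "colset X P n = {c. (\<forall>d\<in>X. c d \<in> {1..n}) \<and> (\<forall>d. d \<notin> X \<longrightarrow> c d = 0) \<and> (\<forall>(u, v)\<in>P. c u = c v)}"

lemma finite_colset: "finite X \<Longrightarrow> finite (colset X P n)"
proof -
  assume "finite X"
  then have "finite {c. (\<forall>d. (d \<in> X \<longrightarrow> c d \<in> {1..n}) \<and> (d \<notin> X \<longrightarrow> c d = 0))}"
    using finite_set_of_finite_funs[of X "{1..n}" 0] by simp
  then show ?thesis by (rule rev_finite_subset) (auto simp: colset_def)
qed

text \<open>Admissible colourings are the functions constant on the classes of the equivalence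
  relation generated by \<open>P\<close>. The exponent is the number of classes meeting
  \<open>X\<close>, counted through the representatives \<open>rep\<close>; it does not depend on
  \<open>n\<close>.\<close>

lemma card_colset:
  assumes "finite X" "P \<subseteq> X \<times> X"
  shows "\<exists>k. \<forall>n. card (colset X P n) = n ^ k"
proof -
  define R where "R = (P \<union> P\<inverse>)\<^sup>*"
  have symR: "sym R" unfolding R_def by (intro sym_rtrancl) (auto simp: sym_def)
  have transR: "trans R" unfolding R_def by (rule trans_rtrancl)
  define rep where "rep x = (SOME y. (x, y) \<in> R)" for x
  have rep: "(x, rep x) \<in> R" for x unfolding rep_def by (rule someI[of _ x]) (simp add: R_def)
  have rep_eq: "rep x = rep y" if "(x, y) \<in> R" for x y
  proof -
    have "(x, z) \<in> R \<longleftrightarrow> (y, z) \<in> R" for z using that symR transR by (meson symD transD)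
    then show ?thesis by (simp add: rep_def)
  qed
  have RX: "y \<in> X" if "(x, y) \<in> R" "x \<in> X" for x y
    using that unfolding R_def by (induction rule: rtrancl_induct) (use assms in auto)
  have col: "c x = c y" if "(x, y) \<in> R" "c \<in> colset X P n" for c n x y
    using that unfolding R_def by (induction rule: rtrancl_induct) (auto simp: colset_def)
  have "card (colset X P n) = n ^ card (rep ` X)" for n
  proof -
    have "bij_betw (\<lambda>c. restrict c (rep ` X)) (colset X P n) (rep ` X \<rightarrow>\<^sub>E {1..n})"
    proof (rule bij_betw_byWitness[where f' = "\<lambda>g x. if x \<in> X then g (rep x) else 0"])
      show "\<forall>c\<in>colset X P n. (\<lambda>x. if x \<in> X then restrict c (rep ` X) (rep x) else 0) = c"
      proof (intro ballI ext)
        fix c x assume c: "c \<in> colset X P n"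
        show "(if x \<in> X then restrict c (rep ` X) (rep x) else 0) = c x"
          using col[OF rep[of x] c] c by (auto simp: colset_def)
      qed
      show "\<forall>g\<in>rep ` X \<rightarrow>\<^sub>E {1..n}. restrict (\<lambda>x. if x \<in> X then g (rep x) else 0) (rep ` X) = g"
      proof
        fix g assume g: "g \<in> rep ` X \<rightarrow>\<^sub>E {1..n}"
        have "rep (rep x) = rep x" "rep x \<in> X" if "x \<in> X" for x
          using rep_eq[OF rep[of x]] RX[OF rep that] by auto
        then show "restrict (\<lambda>x. if x \<in> X then g (rep x) else 0) (rep ` X) = g"
          using g by (auto simp: fun_eq_iff PiE_def extensional_def)
      qed
      show "(\<lambda>c. restrict c (rep ` X)) ` colset X P n \<subseteq> rep ` X \<rightarrow>\<^sub>E {1..n}"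
        using RX[OF rep] by (auto simp: colset_def)
      show "(\<lambda>g x. if x \<in> X then g (rep x) else 0) ` (rep ` X \<rightarrow>\<^sub>E {1..n}) \<subseteq> colset X P n"
      proof clarify
        fix g assume g: "g \<in> rep ` X \<rightarrow>\<^sub>E {1..n}"
        have "rep u = rep v" if "(u, v) \<in> P" for u v
          using rep_eq[of u v] that by (auto simp: R_def)
        then show "(\<lambda>x. if x \<in> X then g (rep x) else 0) \<in> colset X P n"
          using g assms(2) by (auto simp: colset_def)
      qed
    qed
    then have "card (colset X P n) = card (rep ` X \<rightarrow>\<^sub>E {1..n})" by (rule bij_betw_same_card)
    also have "\<dots> = n ^ card (rep ` X)" using assms(1) by (simp add: card_PiE)
    finally show ?thesis .
  qed
  then show ?thesis by blast
qed

text \<open>The Fortuin-Kasteleyn expansion: an edge weight is 1 plus \<nu> - 1 times the indicator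
  of equal colours, and the indicator is absorbed by adding a pair to \<open>P\<close>. When all
  edges are expanded, \<open>card_colset\<close> leaves a power of \<open>n\<close>.\<close>

lemma colour_sum_polyrep:
  assumes "finite X" "finite E" "E \<subseteq> X" "P \<subseteq> X \<times> X" "\<And>d. d \<in> E \<Longrightarrow> \<alpha> d \<in> X"
  shows "polyrep (\<lambda>n. \<Sum>c\<in>colset X P n. \<Prod>d\<in>E. if c d = c (\<alpha> d) then [:0, 1:] else 1)"
  using assms(2-5)
proof (induction E arbitrary: P rule: finite_induct)
  case empty
  obtain k where "\<And>n. card (colset X P n) = n ^ k" using card_colset[OF assms(1) empty(2)] by blast
  then show ?case using polyrep_q_power[of k] by simp
next
  case (insert e E)
  let ?w = "\<lambda>c. \<Prod>d\<in>E. if c d = c (\<alpha> d) then [:0, 1:] else (1 :: rat poly)"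
  let ?Q = "Set.insert (e, \<alpha> e) P"
  have e: "(\<Sum>c\<in>colset X P n. \<Prod>d\<in>Set.insert e E. if c d = c (\<alpha> d) then [:0, 1:] else 1)
     = (\<Sum>c\<in>colset X P n. ?w c) + ([:0, 1:] - 1) * (\<Sum>c\<in>colset X ?Q n. ?w c)" for n
  proof -
    have "colset X ?Q n = {c \<in> colset X P n. c e = c (\<alpha> e)}" by (auto simp: colset_def)
    then have "(\<Sum>c\<in>colset X ?Q n. ?w c) = (\<Sum>c\<in>colset X P n. if c e = c (\<alpha> e) then ?w c else 0)"
      using finite_colset[OF assms(1)] by (simp add: sum.inter_filter)
    then have "(\<Sum>c\<in>colset X P n. ?w c) + ([:0, 1:] - 1) * (\<Sum>c\<in>colset X ?Q n. ?w c)
      = (\<Sum>c\<in>colset X P n. ?w c + ([:0, 1:] - 1) * (if c e = c (\<alpha> e) then ?w c else 0))"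
      by (simp add: sum.distrib sum_distrib_left)
    also have "\<dots> = (\<Sum>c\<in>colset X P n. \<Prod>d\<in>Set.insert e E. if c d = c (\<alpha> d) then [:0, 1:] else 1)"
      using insert(1,2) by (intro sum.cong refl) (simp add: algebra_simps)
    finally show ?thesis by simp
  qed
  have "polyrep (\<lambda>n. \<Sum>c\<in>colset X P n. ?w c)" "polyrep (\<lambda>n. \<Sum>c\<in>colset X ?Q n. ?w c)"
    using insert by auto
  then show ?case unfolding e by (rule polyrep_hom(1)[OF _ polyrep_hom(2)[OF polyrep_nu]])
qed

section \<open>Colour sums under deletion, contraction and gluing\<close>

definition monochr :: "nat set \<Rightarrow> (nat \<Rightarrow> nat) \<Rightarrow> (nat \<Rightarrow> nat) \<Rightarrow> nat" where
  "monochr X \<alpha> c = card {d \<in> X. d < \<alpha> d \<and> c d = c (\<alpha> d)}"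

text \<open>Counting darts instead of edges avoids the condition \<open>d < \<alpha> d\<close>,
  which relabelling does not preserve.\<close>

definition monochr_darts :: "nat set \<Rightarrow> (nat \<Rightarrow> nat) \<Rightarrow> (nat \<Rightarrow> nat) \<Rightarrow> nat" where
  "monochr_darts X \<alpha> c = card {d \<in> X. \<alpha> d \<noteq> d \<and> c d = c (\<alpha> d)}"

lemma monochr_darts_eq:
  assumes "invol_on \<alpha> X" shows "monochr_darts X \<alpha> c = 2 * monochr X \<alpha> c"
proof -
  let ?A = "{d \<in> X. d < \<alpha> d \<and> c d = c (\<alpha> d)}" and ?B = "{d \<in> X. \<alpha> d < d \<and> c d = c (\<alpha> d)}"
  have f: "finite X" and cl: "\<And>x. x \<in> X \<Longrightarrow> \<alpha> x \<in> X" and i: "\<And>x. x \<in> X \<Longrightarrow> \<alpha> (\<alpha> x) = x"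
    using assms by (auto simp: invol_on_def closed_under_def)
  have "bij_betw \<alpha> ?A ?B" by (rule bij_betw_byWitness[where f' = \<alpha>]) (auto simp: i cl)
  then have "card ?A = card ?B" by (rule bij_betw_same_card)
  moreover have "{d \<in> X. \<alpha> d \<noteq> d \<and> c d = c (\<alpha> d)} = ?A \<union> ?B" by auto
  moreover have "card (?A \<union> ?B) = card ?A + card ?B" by (rule card_Un_disjoint) (use f in auto)
  ultimately show ?thesis unfolding monochr_def monochr_darts_def by simp
qed

definition colour_sum :: "nat set \<Rightarrow> (nat \<times> nat) set \<Rightarrow> (nat \<Rightarrow> nat) \<Rightarrow> nat \<Rightarrow> rat poly" where
  "colour_sum X P \<alpha> n = (\<Sum>c\<in>colset X P n. monom 1 (monochr X \<alpha> c))"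

definition vertex_rel :: "nat set \<Rightarrow> (nat \<Rightarrow> nat) \<Rightarrow> (nat \<times> nat) set" where
  "vertex_rel X \<sigma> = {(\<sigma> d, d) | d. d \<in> X}"

lemma prod_if_power: "finite E \<Longrightarrow> (\<Prod>d\<in>E. if Q d then x else 1) = x ^ card {d \<in> E. Q d}"
  by (simp add: prod.If_cases Int_def)

lemma polyrep_colour_sum:
  assumes "finite X" "P \<subseteq> X \<times> X" "closed_under \<alpha> X"
  shows "polyrep (colour_sum X P \<alpha>)"
proof -
  let ?E = "{d \<in> X. d < \<alpha> d}"
  have "monom 1 (monochr X \<alpha> c) = (\<Prod>d\<in>?E. if c d = c (\<alpha> d) then [:0, 1:] else (1 :: rat poly))" for c
  proof -
    have "{d \<in> ?E. c d = c (\<alpha> d)} = {d \<in> X. d < \<alpha> d \<and> c d = c (\<alpha> d)}" by auto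
    then show ?thesis using assms(1) by (simp add: prod_if_power monochr_def monom_altdef)
  qed
  then have "colour_sum X P \<alpha> = (\<lambda>n. \<Sum>c\<in>colset X P n. \<Prod>d\<in>?E. if c d = c (\<alpha> d) then [:0, 1:] else 1)"
    by (simp add: colour_sum_def fun_eq_iff)
  then show ?thesis using colour_sum_polyrep[of X ?E P \<alpha>] assms by (simp add: closed_under_def)
qed

text \<open>Deletion and contraction. Contracting means here that the ends are forced to have equal
  colours by a pair in \<open>P\<close>; the darts and the rotation are left as they are.\<close>

lemma colset_cut:
  assumes "edge_cut X \<sigma> \<alpha> a b"
  shows "colour_sum X P \<alpha> n = colour_sum X P (\<alpha> \<circ> sw a b) n
    + ([:0, 1:] - 1) * colour_sum X (insert (a, b) P) (\<alpha> \<circ> sw a b) n"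
proof -
  interpret edge_cut X \<sigma> \<alpha> a b by fact
  have f: "finite X" using inv by (simp add: invol_on_def)
  have m: "monochr X \<alpha> c = monochr X \<alpha>' c + (if c a = c b then 1 else 0)" for c
  proof -
    have A: "{d \<in> X. \<alpha> d \<noteq> d \<and> c d = c (\<alpha> d)} =
      {d \<in> X. \<alpha>' d \<noteq> d \<and> c d = c (\<alpha>' d)} \<union> (if c a = c b then {a, b} else {})" (is "?L = ?R")
    proof (rule set_eqI)
      fix d
      show "d \<in> ?L \<longleftrightarrow> d \<in> ?R"
        by (cases "d = a"; cases "d = b"; use cut_simps ab ba neq a b in \<open>simp del: comp_apply\<close>)
    qed
    have "monochr_darts X \<alpha> c = monochr_darts X \<alpha>' c + (if c a = c b then 2 else 0)"
      unfolding monochr_darts_def A using f neq cut_simps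
      by (subst card_Un_disjoint) (auto simp del: comp_apply)
    then show ?thesis unfolding monochr_darts_eq[OF inv] monochr_darts_eq[OF inv'] by (simp split: if_splits)
  qed
  have "colset X (insert (a, b) P) n = {c \<in> colset X P n. c a = c b}" by (auto simp: colset_def)
  then have "colour_sum X (insert (a, b) P) \<alpha>' n = (\<Sum>c\<in>colset X P n. if c a =
    c b then monom 1 (monochr X \<alpha>' c) else 0)"
    unfolding colour_sum_def using finite_colset[OF f] by (simp add: sum.inter_filter)
  then have "colour_sum X P \<alpha>' n + ([:0, 1:] - 1) * colour_sum X (insert (a, b) P) \<alpha>' n =
    (\<Sum>c\<in>colset X P n. monom 1 (monochr X \<alpha>' c) + ([:0, 1:] - 1) * (if c a =
      c b then monom 1 (monochr X \<alpha>' c) else 0))"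
    unfolding colour_sum_def by (simp add: sum.distrib sum_distrib_left)
  also have "\<dots> = (\<Sum>c\<in>colset X P n. monom 1 (monochr X \<alpha> c))"
    by (intro sum.cong refl) (simp add: m monom_altdef algebra_simps)
  finally show ?thesis by (simp add: colour_sum_def)
qed

text \<open>A leg belongs to no edge, and its colour is dictated by the vertex it is attached
  to.\<close>

lemma colour_sum_leg:
  assumes "finite D" "b \<notin> D" "z \<in> D" "\<alpha> b = b" "closed_under \<alpha> D" "\<sigma> permutes D"
  shows "colour_sum (insert b D) (vertex_rel (insert b D) (\<sigma> \<circ> sw z b)) \<alpha> n =
    colour_sum D (vertex_rel D \<sigma>) \<alpha> n"
proof -
  have sb: "\<sigma> b = b" using permutes_fixes[OF assms(6,2)] .
  have zb: "z \<noteq> b" using assms by auto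
  let ?X = "insert b D" and ?s = "\<sigma> \<circ> sw z b"
  have ss: "?s b = \<sigma> z" "?s z = b" "\<And>x. x \<noteq> z \<Longrightarrow> x \<noteq> b \<Longrightarrow> ?s x = \<sigma> x" using sb by auto
  have sD: "\<sigma> x \<in> D" "\<sigma> x \<noteq> b" if "x \<in> D" for x using that permutes_mem[OF assms(6)] assms(2) by auto
  have m: "monochr ?X \<alpha> c = monochr D \<alpha> c'" if "\<And>x. x \<in> D \<Longrightarrow> c x = c' x" for c c'
  proof -
    have "{d \<in> ?X. d < \<alpha> d \<and> c d = c (\<alpha> d)} = {d \<in> D. d < \<alpha> d \<and> c' d = c' (\<alpha> d)}"
      using that assms(4,5) unfolding closed_under_def by auto
    then show ?thesis by (simp add: monochr_def)
  qed
  have i: "c(b := c z) \<in> colset ?X (vertex_rel ?X ?s) n" if c: "c \<in> colset D (vertex_rel D \<sigma>) n" for c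
  proof -
    have "(c(b := c z)) (?s x) = (c(b := c z)) x" if x: "x \<in> ?X" for x
    proof -
      consider "x = b" | "x = z" | "x \<in> D" "x \<noteq> z" "x \<noteq> b" using x by blast
      then show ?thesis
      proof cases
        case 1
        then show ?thesis unfolding 1 ss using c assms(3) sD[OF assms(3)]
          by (auto simp: colset_def vertex_rel_def)
      next
        case 2
        then show ?thesis unfolding 2 ss using zb by simp
      next
        case 3
        then show ?thesis unfolding ss(3)[OF 3(2,3)] using c sD[OF 3(1)]
          by (auto simp: colset_def vertex_rel_def)
      qed
    qed
    then show ?thesis using c assms unfolding colset_def vertex_rel_def by (auto simp del: comp_apply)
  qed
  have j: "c(b := 0) \<in> colset D (vertex_rel D \<sigma>) n" "c b = c z"
    if c: "c \<in> colset ?X (vertex_rel ?X ?s) n" for c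
  proof -
    have e: "c (?s x) = c x" if "x \<in> ?X" for x using c that
      by (auto simp: colset_def vertex_rel_def simp del: comp_apply)
    show bz: "c b = c z" using e[of z] ss(2) assms(3) by auto
    have "c (\<sigma> x) = c x" if "x \<in> D" for x
    proof (cases "x = z")
      case True then show ?thesis using e[of b] ss(1) bz by simp
    next
      case False
      then show ?thesis using e[of x] ss(3)[of x] that assms(2) by (metis insertI2)
    qed
    then show "c(b := 0) \<in> colset D (vertex_rel D \<sigma>) n"
      using c sD assms(2) unfolding colset_def vertex_rel_def by auto
  qed
  show ?thesis unfolding colour_sum_def
  proof (rule sum.reindex_bij_witness[where i = "\<lambda>c. c(b := c z)" and j = "\<lambda>c. c(b := 0)"])
    fix c assume c: "c \<in> colset ?X (vertex_rel ?X ?s) n"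
    show "(c(b := 0))(b := (c(b := 0)) z) = c" using j(2)[OF c] zb by auto
    show "c(b := 0) \<in> colset D (vertex_rel D \<sigma>) n" using j(1)[OF c] .
    have "monochr ?X \<alpha> c = monochr D \<alpha> (c(b := 0))" by (rule m) (use assms(2) in auto)
    then show "monom 1 (monochr D \<alpha> (c(b := 0))) = monom 1 (monochr ?X \<alpha> c)" by simp
  next
    fix c assume c: "c \<in> colset D (vertex_rel D \<sigma>) n"
    show "(c(b := c z))(b := 0) = c" using c assms(2) by (auto simp: colset_def)
    show "c(b := c z) \<in> colset ?X (vertex_rel ?X ?s) n" using i[OF c] .
  qed
qed

text \<open>A colouring that agrees on \<open>a\<close> and \<open>b\<close> cannot detect a
  transposition of them. Splitting or merging the vertices at \<open>a\<close> and \<open>b\<close>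
  is thus invisible once the edge is contracted.\<close>

lemma colset_swap:
  assumes "a \<in> X" "b \<in> X"
  shows "colset X (insert (a, b) (vertex_rel X (\<tau> \<circ> sw a b))) n = colset X (insert (a, b) (vertex_rel X \<tau>)) n"
proof -
  have "(\<forall>d\<in>X. c ((\<tau> \<circ> sw a b) d) = c d) \<longleftrightarrow> (\<forall>d\<in>X. c (\<tau> d) = c d)" if "c a = c b" for c :: "nat \<Rightarrow> nat"
  proof -
    have c: "c (sw a b d) = c d" for d using that by (auto simp: Transposition.transpose_def)
    have X: "sw a b d \<in> X \<longleftrightarrow> d \<in> X" for d using assms by (auto simp: Transposition.transpose_def)
    have "c (\<tau> d) = c d" if "\<forall>d\<in>X. c ((\<tau> \<circ> sw a b) d) = c d" "d \<in> X" for d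
      using that(1)[rule_format, of "sw a b d"] that(2) X c by simp
    moreover have "c ((\<tau> \<circ> sw a b) d) = c d" if "\<forall>d\<in>X. c (\<tau> d) = c d" "d \<in> X" for d
      using that(1)[rule_format, of "sw a b d"] that(2) X c by simp
    ultimately show ?thesis by blast
  qed
  then show ?thesis unfolding colset_def vertex_rel_def by (auto simp del: comp_apply)
qed

lemma colset_orb:
  assumes "perm_on \<tau> X" "a \<in> X" "b \<in> orb \<tau> a"
  shows "colset X (insert (a, b) (vertex_rel X \<tau>)) n = colset X (vertex_rel X \<tau>) n"
proof -
  have "c a = c b" if c: "c \<in> colset X (vertex_rel X \<tau>) n" for c
  proof -
    have "closed_under \<tau> {x \<in> X. c x = c a}"
      using c perm_on_closed[OF assms(1)] by (auto simp: closed_under_def colset_def vertex_rel_def)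
    then have "orb \<tau> a \<subseteq> {x \<in> X. c x = c a}" by (intro orb_least) (use assms in auto)
    then show ?thesis using assms(3) by auto
  qed
  then show ?thesis by (auto simp: colset_def)
qed

text \<open>Exchanging the colours \<open>k\<close> and \<open>l\<close> keeps all monochromatic
  edges. This gives the factor \<open>n\<close> in \<open>colour_sum_identify\<close>.\<close>

lemma colour_symmetry:
  assumes "k \<in> {1..n}" "l \<in> {1..n}"
  shows "(\<Sum>c\<in>{c \<in> colset X P n. c b = k}. monom (1 :: rat) (monochr X \<alpha> c)) =
         (\<Sum>c\<in>{c \<in> colset X P n. c b = l}. monom 1 (monochr X \<alpha> c))"
proof (rule sum.reindex_bij_witness[where i = "\<lambda>c. sw k l \<circ> c" and j = "\<lambda>c. sw k l \<circ> c"])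
  have 0: "sw k l 0 = 0" using assms by (auto simp: Transposition.transpose_def)
  have r: "sw k l x \<in> {1..n} \<longleftrightarrow> x \<in> {1..n}" for x using assms by (auto simp: Transposition.transpose_def)
  have c: "sw k l \<circ> c \<in> colset X P n" if "c \<in> colset X P n" for c
    using that 0 r unfolding colset_def by (auto simp del: atLeastAtMost_iff)
  have "sw k l u = sw k l v \<longleftrightarrow> u = v" for u v by (metis Transposition.transpose_involutory)
  then have m: "monochr X \<alpha> (sw k l \<circ> c) = monochr X \<alpha> c" for c by (simp add: monochr_def)
  show "sw k l \<circ> (sw k l \<circ> c) = c" "sw k l \<circ> (sw k l \<circ> c) = c" for c by (auto simp: fun_eq_iff)
  show "sw k l \<circ> f \<in> {c \<in> colset X P n. c b = l}" if "f \<in> {c \<in> colset X P n. c b = k}" for f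
    using c that by simp
  show "sw k l \<circ> f \<in> {c \<in> colset X P n. c b = k}" if "f \<in> {c \<in> colset X P n. c b = l}" for f
    using c that by simp
  show "monom 1 (monochr X \<alpha> (sw k l \<circ> f)) = monom (1 :: rat) (monochr X \<alpha> f)" for f by (simp add: m)
qed

context glue
begin

lemma monochr_glue: "monochr X \<beta> (\<lambda>x. c1 x + c2 x) = monochr S1 \<alpha>1 c1 + monochr S2 \<alpha>2 c2"
  if "\<And>x. x \<notin> S1 \<Longrightarrow> c1 x = 0" "\<And>x. x \<notin> S2 \<Longrightarrow> c2 x = 0" for c1 c2
proof -
  let ?c = "\<lambda>x. c1 x + c2 x"
  have c: "?c x = c1 x" if "x \<in> S1" for x using that disj \<open>\<And>x. x \<notin> S2 \<Longrightarrow> c2 x = 0\<close> by auto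
  have d: "?c x = c2 x" if "x \<in> S2" for x using that disj \<open>\<And>x. x \<notin> S1 \<Longrightarrow> c1 x = 0\<close> by auto
  have "{d \<in> X. d < \<beta> d \<and> ?c d = ?c (\<beta> d)} =
    {d \<in> S1. d < \<alpha>1 d \<and> c1 d = c1 (\<alpha>1 d)} \<union> {d \<in> S2. d < \<alpha>2 d \<and> c2 d = c2 (\<alpha>2 d)}"
    using t(1,2) c d mem(3,4) by (auto simp del: comp_apply)
  then show ?thesis unfolding monochr_def
    using fin disj by (subst card_Un_disjoint[symmetric]) auto
qed

text \<open>Colourings are 0 outside their dart set, so the pointwise sum of two of them is their
  common extension.\<close>

lemma colset_glue:
  "bij_betw (\<lambda>(c1, c2) x. c1 x + c2 x) (colset S1 (vertex_rel S1 \<sigma>1) n \<times> colset S2 (vertex_rel S2 \<sigma>2) n)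
    (colset X (vertex_rel X \<sigma>) n)"
proof (rule bij_betw_byWitness[where f' = "\<lambda>c. (\<lambda>x. if x \<in> S1 then c x else 0,
  \<lambda>x. if x \<in> S2 then c x else 0)"])
  have dj: "x \<in> S1 \<Longrightarrow> x \<notin> S2" "x \<in> S2 \<Longrightarrow> x \<notin> S1" for x using disj by auto
  show "\<forall>p\<in>colset S1 (vertex_rel S1 \<sigma>1) n \<times> colset S2 (vertex_rel S2 \<sigma>2) n.
    (\<lambda>x. if x \<in> S1 then (case p of (c1, c2) \<Rightarrow> \<lambda>x. c1 x + c2 x) x else 0,
     \<lambda>x. if x \<in> S2 then (case p of (c1, c2) \<Rightarrow> \<lambda>x. c1 x + c2 x) x else 0) = p"
    using dj by (auto simp: colset_def fun_eq_iff)
  show "\<forall>c\<in>colset X (vertex_rel X \<sigma>) n. (case (\<lambda>x. if x \<in> S1 then c x else 0,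
    \<lambda>x. if x \<in> S2 then c x else 0) of
    (c1, c2) \<Rightarrow> \<lambda>x. c1 x + c2 x) = c"
    using dj by (auto simp: colset_def fun_eq_iff)
  show "(\<lambda>(c1, c2) x. c1 x + c2 x) ` (colset S1 (vertex_rel S1 \<sigma>1) n \<times> colset S2 (vertex_rel S2 \<sigma>2) n) \<subseteq>
    colset X (vertex_rel X \<sigma>) n"
  proof clarify
    fix c1 c2 assume c: "c1 \<in> colset S1 (vertex_rel S1 \<sigma>1) n" "c2 \<in> colset S2 (vertex_rel S2 \<sigma>2) n"
    have e1: "c1 x + c2 x = c1 x" if "x \<in> S1" for x using c(2) dj(1)[OF that] by (simp add: colset_def)
    have e2: "c1 x + c2 x = c2 x" if "x \<in> S2" for x using c(1) dj(2)[OF that] by (simp add: colset_def)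
    have "c1 (\<sigma> x) + c2 (\<sigma> x) = c1 x + c2 x" if "x \<in> X" for x
      using that
    proof
      assume x: "x \<in> S1"
      then show ?thesis unfolding s(1)[OF x] e1[OF x] e1[OF mem(1)[OF x]] using c(1)
        by (auto simp: colset_def vertex_rel_def)
    next
      assume x: "x \<in> S2"
      then show ?thesis unfolding s(2)[OF x] e2[OF x] e2[OF mem(2)[OF x]] using c(2)
        by (auto simp: colset_def vertex_rel_def)
    qed
    moreover have "c1 x + c2 x \<in> {1..n}" if "x \<in> X" for x
      using that
    proof
      assume "x \<in> S1" then show ?thesis unfolding e1[OF \<open>x \<in> S1\<close>] using c(1) by (auto simp: colset_def)
    next
      assume "x \<in> S2" then show ?thesis unfolding e2[OF \<open>x \<in> S2\<close>] using c(2) by (auto simp: colset_def)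
    qed
    moreover have "c1 x + c2 x = 0" if "x \<notin> X" for x using c that by (auto simp: colset_def)
    ultimately show "(\<lambda>x. c1 x + c2 x) \<in> colset X (vertex_rel X \<sigma>) n"
      unfolding colset_def vertex_rel_def by (auto simp del: comp_apply atLeastAtMost_iff)
  qed
  show "(\<lambda>c. (\<lambda>x. if x \<in> S1 then c x else 0, \<lambda>x. if x \<in> S2 then c x else 0)) ` colset X (vertex_rel X \<sigma>) n
    \<subseteq> colset S1 (vertex_rel S1 \<sigma>1) n \<times> colset S2 (vertex_rel S2 \<sigma>2) n"
  proof clarify
    fix c assume c: "c \<in> colset X (vertex_rel X \<sigma>) n"
    have "c (\<sigma> x) = c x" if "x \<in> X" for x using c that by
      (auto simp: colset_def vertex_rel_def simp del: comp_apply)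
    then have "c (\<sigma>1 x) = c x" if "x \<in> S1" for x using s(1)[OF that] that by (metis UnI1)
    moreover have "c (\<sigma>2 x) = c x" if "x \<in> S2" for x
      using s(2)[OF that] that \<open>\<And>x. x \<in> X \<Longrightarrow> c (\<sigma> x) = c x\<close> by (metis UnI2)
    ultimately show "(\<lambda>x. if x \<in> S1 then c x else 0) \<in> colset S1 (vertex_rel S1 \<sigma>1) n \<and>
        (\<lambda>x. if x \<in> S2 then c x else 0) \<in> colset S2 (vertex_rel S2 \<sigma>2) n"
      using c mem(1,2) by (auto simp: colset_def vertex_rel_def)
  qed
qed

lemma colset_nonmem: "c \<in> colset S P n \<Longrightarrow> x \<notin> S \<Longrightarrow> c x = 0"
  by (simp add: colset_def)

lemma colour_sum_glue: "colour_sum X (vertex_rel X \<sigma>) \<beta> n =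
  colour_sum S1 (vertex_rel S1 \<sigma>1) \<alpha>1 n * colour_sum S2 (vertex_rel S2 \<sigma>2) \<alpha>2 n"
proof -
  let ?C = "colset S1 (vertex_rel S1 \<sigma>1) n \<times> colset S2 (vertex_rel S2 \<sigma>2) n"
  have "colour_sum X (vertex_rel X \<sigma>) \<beta> n = (\<Sum>p\<in>?C. monom 1 (monochr X \<beta> ((\<lambda>(c1, c2) x. c1 x + c2 x) p)))"
    unfolding colour_sum_def by (rule sum.reindex_bij_betw[OF colset_glue, symmetric])
  also have "\<dots> = (\<Sum>(c1, c2)\<in>?C. monom 1 (monochr S1 \<alpha>1 c1) * monom 1 (monochr S2 \<alpha>2 c2))"
    by (intro sum.cong refl) (auto simp: monochr_glue colset_nonmem mult_monom)
  also have "\<dots> = colour_sum S1 (vertex_rel S1 \<sigma>1) \<alpha>1 n * colour_sum S2 (vertex_rel S2 \<sigma>2) \<alpha>2 n"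
    unfolding colour_sum_def sum_product sum.cartesian_product ..
  finally show ?thesis .
qed

text \<open>For a fixed colouring of the first part, the second part must show one prescribed colour
  at \<open>b\<close>. By symmetry each of the \<open>n\<close> colours accounts for the same share
  of its colour sum.\<close>

lemma colour_sum_identify:
  "of_nat n * colour_sum X (insert (a, b) (vertex_rel X \<sigma>)) \<beta> n =
    colour_sum S1 (vertex_rel S1 \<sigma>1) \<alpha>1 n * colour_sum S2 (vertex_rel S2 \<sigma>2) \<alpha>2 n"
proof -
  let ?C1 = "colset S1 (vertex_rel S1 \<sigma>1) n" and ?C2 = "colset S2 (vertex_rel S2 \<sigma>2) n"
  let ?G = "\<lambda>k. \<Sum>c\<in>{c \<in> ?C2. c b = k}. monom (1 :: rat) (monochr S2 \<alpha>2 c)"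
  have fC: "finite ?C1" "finite ?C2" using fin finite_colset by blast+
  have val: "c a \<in> {1..n}" if "c \<in> ?C1" for c using that ab(1) unfolding colset_def by blast
  have val2: "c b \<in> {1..n}" if "c \<in> ?C2" for c using that ab(2) unfolding colset_def by blast
  have Gc: "?G k = ?G l" if "k \<in> {1..n}" "l \<in> {1..n}" for k l by (rule colour_symmetry[OF that])
  have Z2: "colour_sum S2 (vertex_rel S2 \<sigma>2) \<alpha>2 n = (\<Sum>k\<in>{1..n}. ?G k)"
    unfolding colour_sum_def by (rule sum.group[symmetric]) (use fC val2 in auto)
  have cs: "colset X (insert (a, b) (vertex_rel X \<sigma>)) n = {c \<in> colset X (vertex_rel X \<sigma>) n. c a = c b}"
    by (auto simp: colset_def)
  have "colour_sum X (insert (a, b) (vertex_rel X \<sigma>)) \<beta> n =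
     (\<Sum>c\<in>colset X (vertex_rel X \<sigma>) n. if c a = c b then monom 1 (monochr X \<beta> c) else 0)"
    unfolding colour_sum_def cs using finite_colset[OF finX] by (rule sum.inter_filter)
  also have "\<dots> = (\<Sum>p\<in>?C1 \<times> ?C2. (\<lambda>c. if c a = c b then monom 1 (monochr X \<beta> c) else 0)
    ((\<lambda>(c1, c2) x. c1 x + c2 x) p))"
    by (rule sum.reindex_bij_betw[OF colset_glue, symmetric])
  also have "\<dots> = (\<Sum>(c1, c2)\<in>?C1 \<times> ?C2. if c2 b = c1 a then monom 1 (monochr S1 \<alpha>1 c1) * monom 1
    (monochr S2 \<alpha>2 c2) else 0)"
  proof (intro sum.cong refl, clarify)
    fix c1 c2 assume c: "c1 \<in> ?C1" "c2 \<in> ?C2"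
    have "a \<notin> S2" "b \<notin> S1" using ab disj by auto
    then have "c2 a = 0" "c1 b = 0" using c colset_nonmem by auto
    then show "(\<lambda>c. if c a = c b then monom 1 (monochr X \<beta> c) else 0) (\<lambda>x. c1 x + c2 x) =
        (if c2 b = c1 a then monom 1 (monochr S1 \<alpha>1 c1) * monom 1 (monochr S2 \<alpha>2 c2) else (0 :: rat poly))"
      using monochr_glue[of c1 c2] c colset_nonmem by (auto simp: mult_monom simp del: comp_apply)
  qed
  also have "\<dots> = (\<Sum>c1\<in>?C1. \<Sum>c2\<in>?C2. if c2 b = c1 a then monom 1 (monochr S1 \<alpha>1 c1) * monom 1
    (monochr S2 \<alpha>2 c2) else 0)"
    by (rule sum.cartesian_product[symmetric])
  also have "\<dots> = (\<Sum>c1\<in>?C1. monom 1 (monochr S1 \<alpha>1 c1) * ?G (c1 a))"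
    by (intro sum.cong refl) (simp add: sum.inter_filter[OF fC(2)] sum_distrib_left if_distrib cong: if_cong)
  finally have B: "colour_sum X (insert (a, b) (vertex_rel X \<sigma>)) \<beta> n =
    (\<Sum>c1\<in>?C1. monom 1 (monochr S1 \<alpha>1 c1) * ?G (c1 a))" .
  have "of_nat n * colour_sum X (insert (a, b) (vertex_rel X \<sigma>)) \<beta> n =
    (\<Sum>c1\<in>?C1. monom 1 (monochr S1 \<alpha>1 c1) * (of_nat n * ?G (c1 a)))"
    unfolding B sum_distrib_left by (intro sum.cong refl) (simp only: mult.left_commute)
  also have "\<dots> = (\<Sum>c1\<in>?C1. monom 1 (monochr S1 \<alpha>1 c1) * (\<Sum>k\<in>{1..n}. ?G k))"
  proof (intro sum.cong refl)
    fix c1 assume c: "c1 \<in> ?C1"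
    have "(\<Sum>k\<in>{1..n}. ?G k) = (\<Sum>k\<in>{1..n}. ?G (c1 a))" by (intro sum.cong refl Gc val[OF c])
    then show "monom 1 (monochr S1 \<alpha>1 c1) * (of_nat n * ?G (c1 a)) =
      monom 1 (monochr S1 \<alpha>1 c1) * (\<Sum>k\<in>{1..n}. ?G k)"
      by simp
  qed
  also have "\<dots> = colour_sum S1 (vertex_rel S1 \<sigma>1) \<alpha>1 n * colour_sum S2 (vertex_rel S2 \<sigma>2) \<alpha>2 n"
    unfolding Z2 colour_sum_def[of S1] sum_distrib_right ..
  finally show ?thesis .
qed

end

section \<open>Relabelling\<close>

text \<open>Used with bijections of all natural numbers, so that a map can be moved to a different
  dart set and not only permuted within its own.\<close>

definition relab :: "(nat \<Rightarrow> nat) \<Rightarrow> (nat \<Rightarrow> nat) \<Rightarrow> nat \<Rightarrow> nat" where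
  "relab \<pi> p = \<pi> \<circ> p \<circ> inv \<pi>"

definition relab_map :: "(nat \<Rightarrow> nat) \<Rightarrow> cmap \<Rightarrow> cmap" where
  "relab_map \<pi> m = (relab \<pi> (fst m), relab \<pi> (snd m))"

lemma relab_apply: "bij \<pi> \<Longrightarrow> relab \<pi> p (\<pi> x) = \<pi> (p x)"
  by (simp add: relab_def bij_is_inj)

lemma relab_comp: "bij \<pi> \<Longrightarrow> relab \<pi> p \<circ> relab \<pi> q = relab \<pi> (p \<circ> q)"
  by (auto simp: relab_def fun_eq_iff bij_is_inj)

lemma relab_inv: "bij \<pi> \<Longrightarrow> relab (inv \<pi>) (relab \<pi> p) = p"
  by (auto simp: relab_def fun_eq_iff bij_is_inj inv_inv_eq)

lemma relab_permutes:
  assumes "bij \<pi>" "p permutes X" shows "relab \<pi> p permutes \<pi> ` X"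
proof -
  have "bij p" using assms(2) by (rule permutes_bij)
  with bij_imp_bij_inv[OF assms(1)] have "bij (p \<circ> inv \<pi>)" by (rule bij_comp)
  then have "bij (\<pi> \<circ> (p \<circ> inv \<pi>))" using assms(1) by (rule bij_comp)
  then have "bij (relab \<pi> p)" unfolding relab_def by (simp only: comp_assoc)
  moreover have "relab \<pi> p x = x" if "x \<notin> \<pi> ` X" for x
  proof -
    have "\<pi> (inv \<pi> x) = x" using assms(1) by (simp add: bij_is_surj surj_f_inv_f)
    then have "inv \<pi> x \<notin> X" using that by force
    then have "p (inv \<pi> x) = inv \<pi> x" by (rule permutes_fixes[OF assms(2)])
    then show ?thesis using assms(1) by (simp add: relab_def bij_is_surj surj_f_inv_f)
  qed
  ultimately show ?thesis unfolding permutes_def by (metis bij_pointE)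
qed

lemma relab_orb:
  assumes "bij \<pi>" shows "orb (relab \<pi> p) (\<pi> x) = \<pi> ` orb p x"
proof -
  have "(relab \<pi> p ^^ k) (\<pi> x) = \<pi> ((p ^^ k) x)" for k
    by (induction k) (simp_all add: relab_apply[OF assms])
  then show ?thesis unfolding orb_def by auto
qed

lemma relab_card_orb:
  "bij \<pi> \<Longrightarrow> card (orb (relab \<pi> p) (\<pi> x)) = card (orb p x)"
  by (simp add: relab_orb card_image bij_is_inj inj_on_subset[OF bij_is_inj])

lemma relab_cyc: assumes "bij \<pi>" shows "cyc (relab \<pi> p) (\<pi> ` X) = cyc p X"
proof -
  have "orb (relab \<pi> p) ` \<pi> ` X = (\<lambda>A. \<pi> ` A) ` orb p ` X"
    unfolding image_image relab_orb[OF assms] ..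
  moreover have "inj_on (\<lambda>A. \<pi> ` A) (orb p ` X)"
    using assms by (metis bij_is_inj inj_image_eq_iff inj_onI)
  ultimately show ?thesis by (simp add: cyc_def card_image)
qed

lemma relab_closed: "bij \<pi> \<Longrightarrow> closed_under (relab \<pi> p) (\<pi> ` S) \<longleftrightarrow> closed_under p S"
  by (auto simp: closed_under_def relab_apply inj_image_mem_iff bij_is_inj)

lemma relab_nonfix:
  assumes "bij \<pi>" shows "nonfix (relab \<pi> p) (\<pi> ` X) = nonfix p X"
proof -
  have "{x \<in> \<pi> ` X. relab \<pi> p x \<noteq> x} = \<pi> ` {x \<in> X. p x \<noteq> x}"
    using assms by (auto simp: relab_apply inj_eq bij_is_inj)
  then show ?thesis using assms by (simp add: nonfix_def card_image bij_is_inj inj_on_subset[OF bij_is_inj])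
qed

lemma relab_transitive_on:
  assumes "bij \<pi>" "transitive_on X \<sigma> \<alpha>" shows "transitive_on (\<pi> ` X) (relab \<pi> \<sigma>) (relab \<pi> \<alpha>)"
  unfolding transitive_on_def
proof (intro conjI allI impI)
  show "\<pi> ` X \<noteq> {}" using assms(2) by (simp add: transitive_on_def)
  fix S assume S: "S \<subseteq> \<pi> ` X" "S \<noteq> {}" "closed_under (relab \<pi> \<sigma>) S" "closed_under (relab \<pi> \<alpha>) S"
  then obtain T where T: "T \<subseteq> X" "S = \<pi> ` T" by (meson subset_imageE)
  then have "T = X" using assms S relab_closed[OF assms(1)] unfolding transitive_on_def by simp
  then show "S = \<pi> ` X" using T by simp
qed

lemma relab_map_legged:
  assumes "bij \<pi>" "m \<in> legged L X" shows "relab_map \<pi> m \<in> legged (\<pi> ` L) (\<pi> ` X)"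
proof -
  obtain \<sigma> \<alpha> where m: "m = (\<sigma>, \<alpha>)" by (cases m)
  note l = leggedD[OF assms(2)[unfolded m]]
  have "relab \<pi> \<alpha> (relab \<pi> \<alpha> x) = x" for x
    using assms(1) l(3) by (simp add: relab_def bij_is_inj bij_is_surj surj_f_inv_f)
  moreover have "{x \<in> \<pi> ` X. relab \<pi> \<alpha> x = x} = \<pi> ` L"
    using l(4,5) assms(1) by (auto simp: relab_apply inj_eq bij_is_inj)
  moreover have "planar (\<pi> ` X) (relab \<pi> \<sigma>) (relab \<pi> \<alpha>)"
    using l(7) by (simp add: planar_def relab_comp relab_cyc relab_nonfix assms(1))
  ultimately show ?thesis
    using relab_permutes[OF assms(1)] relab_transitive_on[OF assms(1)] l
      unfolding m relab_map_def legged_def by simp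
qed

lemma relab_map_legged_bij:
  assumes "bij \<pi>" shows "bij_betw (relab_map \<pi>) (legged L X) (legged (\<pi> ` L) (\<pi> ` X))"
proof (rule bij_betw_byWitness[where f' = "relab_map (inv \<pi>)"])
  have i: "bij (inv \<pi>)" using assms by (rule bij_imp_bij_inv)
  show "\<forall>m\<in>legged L X. relab_map (inv \<pi>) (relab_map \<pi> m) = m"
    by (auto simp: relab_map_def relab_inv[OF assms])
  show "\<forall>m\<in>legged (\<pi> ` L) (\<pi> ` X). relab_map \<pi> (relab_map (inv \<pi>) m) = m"
    using relab_inv[OF i] assms by (auto simp: relab_map_def inv_inv_eq)
  show "relab_map \<pi> ` legged L X \<subseteq> legged (\<pi> ` L) (\<pi> ` X)" using relab_map_legged[OF assms] by blast
  show "relab_map (inv \<pi>) ` legged (\<pi> ` L) (\<pi> ` X) \<subseteq> legged L X"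
    using relab_map_legged[OF i, of _ "\<pi> ` L" "\<pi> ` X"] assms by (auto simp: image_comp bij_is_inj)
qed

lemma relab_map_colour_sum:
  assumes "bij \<pi>" "invol_on \<alpha> X"
  shows "colour_sum (\<pi> ` X) (vertex_rel (\<pi> ` X) (relab \<pi> \<sigma>)) (relab \<pi> \<alpha>) n =
    colour_sum X (vertex_rel X \<sigma>) \<alpha> n"
  unfolding colour_sum_def
proof (rule sum.reindex_bij_witness[where i = "\<lambda>c. c \<circ> inv \<pi>" and j = "\<lambda>c. c \<circ> \<pi>"])
  have ip: "inv \<pi> (\<pi> x) = x" "\<pi> (inv \<pi> x) = x" for x using assms(1)
    by (simp_all add: bij_is_inj bij_is_surj surj_f_inv_f)
  have mem: "inv \<pi> x \<in> X \<longleftrightarrow> x \<in> \<pi> ` X" for x using ip by (metis image_iff)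
  show "(c \<circ> \<pi>) \<circ> inv \<pi> = c" "(c \<circ> inv \<pi>) \<circ> \<pi> = c" for c :: "nat \<Rightarrow> nat" by (simp_all add: fun_eq_iff ip)
  show "c \<circ> \<pi> \<in> colset X (vertex_rel X \<sigma>) n" if "c \<in> colset (\<pi> ` X) (vertex_rel (\<pi> ` X) (relab \<pi> \<sigma>)) n" for c
    using that assms(1) by (auto simp: colset_def vertex_rel_def relab_apply inj_image_mem_iff bij_is_inj)
  show "c \<circ> inv \<pi> \<in> colset (\<pi> ` X) (vertex_rel (\<pi> ` X) (relab \<pi> \<sigma>)) n"
    if "c \<in> colset X (vertex_rel X \<sigma>) n" for c
    using that assms(1) by (auto simp: colset_def vertex_rel_def relab_apply ip mem)
  have inv': "invol_on (relab \<pi> \<alpha>) (\<pi> ` X)"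
    using assms by (auto simp: invol_on_def relab_closed relab_apply)
  show "monom 1 (monochr X \<alpha> (c \<circ> \<pi>)) = monom (1 :: rat) (monochr (\<pi> ` X) (relab \<pi> \<alpha>) c)" for c
  proof -
    have "{d \<in> \<pi> ` X. relab \<pi> \<alpha> d \<noteq> d \<and> c d = c (relab \<pi> \<alpha> d)} =
       \<pi> ` {d \<in> X. \<alpha> d \<noteq> d \<and> (c \<circ> \<pi>) d = (c \<circ> \<pi>) (\<alpha> d)}"
      using assms(1) by (auto simp: relab_apply inj_eq bij_is_inj)
    then have "monochr_darts (\<pi> ` X) (relab \<pi> \<alpha>) c = monochr_darts X \<alpha> (c \<circ> \<pi>)"
      using assms(1) by (simp add: monochr_darts_def card_image bij_is_inj inj_on_subset[OF bij_is_inj])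
    then show ?thesis using monochr_darts_eq[OF assms(2)] monochr_darts_eq[OF inv'] by simp
  qed
qed

text \<open>A bijection from \<open>X\<close> to \<open>Y\<close> extends to all natural numbers by
  sending \<open>Y - X\<close>, which has as many elements as \<open>X - Y\<close>, onto the latter
  and fixing everything else.\<close>

lemma ex_relabelling:
  fixes X Y :: "nat set"
  assumes "finite X" "finite Y" "card X = card Y" "a \<in> X" "b \<in> Y"
  obtains \<pi> where "bij \<pi>" "\<pi> ` X = Y" "\<pi> a = b"
proof -
  have "card (X - {a}) = card (Y - {b})" using assms by simp
  then obtain f where f: "bij_betw f (X - {a}) (Y - {b})"
    using assms finite_same_card_bij by (metis finite_Diff)
  define g where "g = f(a := b)"
  have g: "bij_betw g X Y"
  proof -
    have "bij_betw g (X - {a}) (Y - {b})" using f by (subst bij_betw_cong[where g = f]) (auto simp: g_def)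
    then have "bij_betw g ((X - {a}) \<union> {a}) ((Y - {b}) \<union> {b})"
      by (intro bij_betw_combine) (auto simp: g_def bij_betw_def)
    then show ?thesis using assms by (simp add: insert_absorb)
  qed
  have "card (Y - X) = card (X - Y)"
    using assms by (metis card_le_sym_Diff card_less_sym_Diff le_antisym order.refl linorder_neqE_nat
      nless_le)
  then obtain h where h: "bij_betw h (Y - X) (X - Y)"
    using assms finite_same_card_bij by (metis finite_Diff)
  define \<pi> where "\<pi> x = (if x \<in> X then g x else if x \<in> Y then h x else x)" for x
  have 1: "bij_betw \<pi> X Y" using g by (subst bij_betw_cong[where g = g]) (auto simp: \<pi>_def)
  have 2: "bij_betw \<pi> (Y - X) (X - Y)" using h by (subst bij_betw_cong[where g = h]) (auto simp: \<pi>_def)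
  have 3: "bij_betw \<pi> (- (X \<union> Y)) (- (X \<union> Y))" using bij_betw_id
    by (subst bij_betw_cong[where g = id]) (auto simp: \<pi>_def)
  have "bij_betw \<pi> (X \<union> (Y - X)) (Y \<union> (X - Y))" using 1 2 by (rule bij_betw_combine) auto
  then have "bij_betw \<pi> (X \<union> (Y - X) \<union> - (X \<union> Y)) (Y \<union> (X - Y) \<union> - (X \<union> Y))"
    using 3 by (rule bij_betw_combine) auto
  moreover have "X \<union> (Y - X) \<union> - (X \<union> Y) = UNIV" "Y \<union> (X - Y) \<union> - (X \<union> Y) = UNIV" by auto
  ultimately have "bij \<pi>" by simp
  moreover have "\<pi> ` X = Y" using 1 by (simp add: bij_betw_def)
  moreover have "\<pi> a = b" using assms by (simp add: \<pi>_def g_def)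
  ultimately show ?thesis by (rule that)
qed

section \<open>Rooted maps as orbits of relabellings\<close>

text \<open>The set reached from \<open>r\<close> is closed. Conversely, a closed set without
  \<open>r\<close> has a closed complement containing \<open>r\<close>, because the generators are
  permutations of a finite set.\<close>

lemma transitive_on_rtrancl:
  assumes "\<sigma> permutes D" "\<alpha> permutes D" "finite D" "r \<in> D"
  shows "transitive_on D \<sigma> \<alpha> \<longleftrightarrow> (\<forall>d\<in>D. (r, d) \<in> ({(x, \<sigma> x) | x. x \<in> D} \<union> {(x, \<alpha> x) | x. x \<in> D})\<^sup>*)"
    (is "_ \<longleftrightarrow> (\<forall>d\<in>D. (r, d) \<in> ?R\<^sup>*)")
proof
  have P: "perm_on \<sigma> D" "perm_on \<alpha> D" using assms permutes_perm_on by auto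
  assume t: "transitive_on D \<sigma> \<alpha>"
  let ?S = "{d \<in> D. (r, d) \<in> ?R\<^sup>*}"
  have st: "(r, \<sigma> x) \<in> ?R\<^sup>*" "(r, \<alpha> x) \<in> ?R\<^sup>*" if "(r, x) \<in> ?R\<^sup>*" "x \<in> D" for x
  proof -
    have "(x, \<sigma> x) \<in> ?R" "(x, \<alpha> x) \<in> ?R" using that(2) by auto
    then show "(r, \<sigma> x) \<in> ?R\<^sup>*" "(r, \<alpha> x) \<in> ?R\<^sup>*" using that(1) by (meson rtrancl.rtrancl_into_rtrancl)+
  qed
  have "closed_under \<sigma> ?S" "closed_under \<alpha> ?S"
    using st permutes_mem[OF assms(1)] permutes_mem[OF assms(2)] by (auto simp: closed_under_def)
  then have "?S = D" using t assms(4) by (intro transitive_on_single_orbit[OF t, of r]) auto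
  then show "\<forall>d\<in>D. (r, d) \<in> ?R\<^sup>*" by blast
next
  have P: "perm_on \<sigma> D" "perm_on \<alpha> D" using assms permutes_perm_on by auto
  assume *: "\<forall>d\<in>D. (r, d) \<in> ?R\<^sup>*"
  have reach: "S = D" if S: "S \<subseteq> D" "r \<in> S" "closed_under \<sigma> S" "closed_under \<alpha> S" for S
  proof -
    have "d \<in> S" if "(r, d) \<in> ?R\<^sup>*" for d
      using that by (induction rule: rtrancl_induct) (use S in \<open>auto simp: closed_under_def\<close>)
    then show ?thesis using * S(1) by blast
  qed
  show "transitive_on D \<sigma> \<alpha>" unfolding transitive_on_def
  proof (intro conjI allI impI)
    fix S assume S: "S \<subseteq> D" "S \<noteq> {}" "closed_under \<sigma> S" "closed_under \<alpha> S"
    show "S = D"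
    proof (cases "r \<in> S")
      case False
      have "D - S = D" using reach[of "D - S"] perm_on_Diff[OF P(1) S(1,3)] perm_on_Diff[OF P(2) S(1,4)]
        False assms(4) by blast
      then show ?thesis using S by blast
    qed (use reach S in blast)
  qed (use assms in auto)
qed

lemma planar_map_iff:
  assumes "e \<ge> 1" shows "is_planar_map e m \<longleftrightarrow> m \<in> legged {} (darts e)"
proof -
  obtain \<sigma> \<alpha> where m: "m = (\<sigma>, \<alpha>)" by (cases m)
  have f: "finite (darts e)" "0 \<in> darts e" "card (darts e) = 2 * e" using assms by (auto simp: darts_def)
  have nf: "nonfix \<alpha> (darts e) = 2 * e" if "\<forall>d\<in>darts e. \<alpha> d \<noteq> d"
  proof -
    have "{x \<in> darts e. \<alpha> x \<noteq> x} = darts e" using that by auto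
    then show ?thesis using f by (simp add: nonfix_def)
  qed
  have inv: "(\<forall>d\<in>darts e. \<alpha> (\<alpha> d) = d) \<longleftrightarrow> (\<forall>d. \<alpha> (\<alpha> d) = d)" if "\<alpha> permutes darts e"
    using permutes_fixes[OF that] by metis
  have pl: "planar (darts e) \<sigma> \<alpha> \<longleftrightarrow> int (nverts e m) - int e + int (nfaces e m) = 2" if "\<forall>d\<in>darts e. \<alpha> d \<noteq> d"
    unfolding planar_def nf[OF that] nverts_def nfaces_def cyc_def m distrib_left by auto
  show ?thesis
  proof
    assume "is_planar_map e m"
    then have *: "\<sigma> permutes darts e" "\<alpha> permutes darts e" "\<forall>d\<in>darts e. \<alpha> d \<noteq> d" "\<forall>d\<in>darts e. \<alpha> (\<alpha> d) = d"
      "\<forall>d\<in>darts e. (0, d) \<in> ({(x, \<sigma> x) | x. x \<in> darts e} \<union> {(x, \<alpha> x) | x. x \<in> darts e})\<^sup>*"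
      "int (nverts e m) - int e + int (nfaces e m) = 2"
      unfolding is_planar_map_def Let_def m by auto
    show "m \<in> legged {} (darts e)"
      unfolding m legged_def
      using * transitive_on_rtrancl[OF *(1,2) f(1,2)] pl[OF *(3)] inv[OF *(2)] by auto
  next
    assume "m \<in> legged {} (darts e)"
    note l = leggedD[OF this[unfolded m]]
    have nf: "\<forall>d\<in>darts e. \<alpha> d \<noteq> d" using l(5) by blast
    show "is_planar_map e m"
      unfolding is_planar_map_def Let_def
      using l(1,2,3) nf pl[OF nf] l(6,7) transitive_on_rtrancl[OF l(1,2) f(1,2)] unfolding m by simp
  qed
qed

text \<open>The darts on which both relabellings agree form a set closed under rotation and
  involution, and it contains the root.\<close>

lemma relabel_rigid:
  assumes "m \<in> legged L X" "bij \<pi>" "bij \<rho>" "relab_map \<pi> m = relab_map \<rho> m" "r \<in> X" "\<pi> r = \<rho> r" "x \<in> X"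
  shows "\<pi> x = \<rho> x"
proof -
  obtain \<sigma> \<alpha> where m: "m = (\<sigma>, \<alpha>)" by (cases m)
  note l = leggedD[OF assms(1)[unfolded m]]
  have e: "relab \<pi> \<sigma> = relab \<rho> \<sigma>" "relab \<pi> \<alpha> = relab \<rho> \<alpha>" using assms(4) by (auto simp: m relab_map_def)
  let ?S = "{x \<in> X. \<pi> x = \<rho> x}"
  have "\<pi> (\<sigma> x) = \<rho> (\<sigma> x)" "\<pi> (\<alpha> x) = \<rho> (\<alpha> x)" if "\<pi> x = \<rho> x" for x
    using relab_apply[OF assms(2), of _ x] relab_apply[OF assms(3), of _ x] e that by metis+
  then have "closed_under \<sigma> ?S" "closed_under \<alpha> ?S"
    using permutes_mem[OF l(1)] permutes_mem[OF l(2)] by (auto simp: closed_under_def)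
  then have "?S = X" using assms(5,6) by (intro transitive_on_single_orbit[OF l(6), of r]) auto
  then show ?thesis using assms(7) by blast
qed

text \<open>Every isomorphism class is an orbit under the relabellings that fix dart 0. By rigidity
  the action is free, so each class has (2e - 1)! elements, and the invariance of \<open>g\<close>
  makes the chosen representative immaterial.\<close>

lemma rooted_maps_sum:
  fixes g :: "cmap \<Rightarrow> 'a :: comm_ring_1"
  assumes e: "e \<ge> 1"
    and inv: "\<And>\<pi> m. bij \<pi> \<Longrightarrow> \<pi> ` darts e = darts e \<Longrightarrow> \<pi> 0 = 0 \<Longrightarrow> m \<in> legged {} (darts e) \<Longrightarrow>
      g (relab_map \<pi> m) = g m"
  shows "(\<Sum>m\<in>legged {} (darts e). g m) = of_nat (fact (2 * e - 1)) * (\<Sum>C\<in>rooted_maps e. g (SOME m. m \<in> C))"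
proof -
  let ?D = "darts e" and ?A = "legged {} (darts e)"
  have f: "finite ?D" "0 \<in> ?D" "card ?D = 2 * e" using e by (auto simp: darts_def)
  let ?P = "{\<pi>. \<pi> permutes ?D - {0}}"
  have P_iff: "\<pi> permutes ?D \<and> \<pi> 0 = 0 \<longleftrightarrow> \<pi> \<in> ?P" for \<pi>
  proof
    assume "\<pi> permutes ?D \<and> \<pi> 0 = 0"
    then show "\<pi> \<in> ?P" using permutes_superset[of \<pi> ?D "?D - {0}"] by auto
  next
    assume "\<pi> \<in> ?P"
    then show "\<pi> permutes ?D \<and> \<pi> 0 = 0"
      using permutes_subset[of \<pi> "?D - {0}" ?D] permutes_fixes[of \<pi> "?D - {0}" 0] by auto
  qed
  have cP: "card ?P = fact (2 * e - 1)"
    using card_permutations[of "?D - {0}" "2 * e - 1"] f by simp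
  define cl where "cl m = (\<lambda>\<pi>. relab_map \<pi> m) ` ?P" for m
  have cls: "map_iso e `` {m} = cl m" for m
  proof -
    have "map_iso e `` {m} = {relab_map \<pi> m | \<pi>. \<pi> permutes ?D \<and> \<pi> 0 = 0}"
      unfolding map_iso_def by (cases m) (auto simp: relab_map_def relab_def)
    then show ?thesis unfolding P_iff cl_def by auto
  qed
  have Pb: "bij \<pi>" "\<pi> ` ?D = ?D" "\<pi> 0 = 0" if "\<pi> \<in> ?P" for \<pi>
    using that P_iff permutes_bij permutes_image by metis+
  have clA: "cl m \<subseteq> ?A" if "m \<in> ?A" for m
    unfolding cl_def using relab_map_legged[OF Pb(1) that] Pb(2) by force
  have card_cl: "card (cl m) = fact (2 * e - 1)" if m: "m \<in> ?A" for m
  proof -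
    have "inj_on (\<lambda>\<pi>. relab_map \<pi> m) ?P"
    proof (rule inj_onI)
      fix \<pi> \<rho> assume p: "\<pi> \<in> ?P" "\<rho> \<in> ?P" "relab_map \<pi> m = relab_map \<rho> m"
      have "\<pi> x = \<rho> x" if "x \<in> ?D" for x
        by (rule relabel_rigid[OF m Pb(1)[OF p(1)] Pb(1)[OF p(2)] p(3) f(2) _ that])
          (simp only: Pb(3)[OF p(1)] Pb(3)[OF p(2)])
      moreover have "\<pi> x = \<rho> x" if "x \<notin> ?D" for x
        using p that permutes_fixes[of \<pi> "?D - {0}" x] permutes_fixes[of \<rho> "?D - {0}" x] by simp
      ultimately show "\<pi> = \<rho>" by blast
    qed
    then show ?thesis unfolding cl_def by (simp add: card_image cP)
  qed
  have relab_map_relab_map: "relab_map \<pi> (relab_map \<rho> m) = relab_map (\<pi> \<circ> \<rho>) m" if "\<pi> \<in> ?P" "\<rho> \<in> ?P" for \<pi> \<rho> m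
    using Pb(1)[OF that(1)] Pb(1)[OF that(2)] by (simp add: relab_map_def relab_def o_inv_distrib comp_assoc)
  have cl_eq: "cl m' = cl m" if h: "m' \<in> cl m" for m m'
  proof -
    obtain \<rho> where r: "\<rho> \<in> ?P" "m' = relab_map \<rho> m" using h unfolding cl_def by blast
    have ri: "inv \<rho> \<in> ?P" using r(1) by (simp add: permutes_inv)
    have m: "m = relab_map (inv \<rho>) m'" unfolding r(2) using relab_inv[OF Pb(1)[OF r(1)]]
      by (simp add: relab_map_def)
    have sub: "cl (relab_map \<tau> k) \<subseteq> cl k" if "\<tau> \<in> ?P" for \<tau> k
    proof
      fix y assume "y \<in> cl (relab_map \<tau> k)"
      then obtain \<pi> where p: "\<pi> \<in> ?P" "y = relab_map \<pi> (relab_map \<tau> k)" unfolding cl_def by blast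
      have "\<pi> \<circ> \<tau> \<in> ?P" using p(1) that permutes_compose by blast
      then show "y \<in> cl k" unfolding p(2) relab_map_relab_map[OF p(1) that] cl_def by blast
    qed
    have "cl m' \<subseteq> cl m" unfolding r(2) by (rule sub[OF r(1)])
    moreover have "cl m \<subseteq> cl m'" using sub[OF ri, of m'] unfolding m[symmetric] .
    ultimately show ?thesis by blast
  qed
  have self: "m \<in> cl m" for m
    unfolding cl_def by (rule image_eqI[of _ _ id]) (auto simp: relab_map_def relab_def permutes_id)
  have RM: "rooted_maps e = cl ` ?A"
    unfolding rooted_maps_def quotient_def planar_map_iff[OF e] using cls by auto
  have U: "\<Union> (rooted_maps e) = ?A" unfolding RM using clA self by blast
  have "(\<Sum>m\<in>?A. g m) = (\<Sum>m\<in>\<Union> (rooted_maps e). g m)" unfolding U ..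
  also have "\<dots> = (\<Sum>C\<in>rooted_maps e. \<Sum>m\<in>C. g m)"
  proof (rule sum.Union_disjoint[unfolded comp_def])
    show "\<forall>C\<in>rooted_maps e. finite C" unfolding RM using clA finite_legged[OF f(1)] finite_subset by blast
    show "\<forall>C\<in>rooted_maps e. \<forall>B\<in>rooted_maps e. C \<noteq> B \<longrightarrow> C \<inter> B = {}"
      unfolding RM using cl_eq by blast
  qed
  also have "\<dots> = (\<Sum>C\<in>rooted_maps e. of_nat (fact (2 * e - 1)) * g (SOME m. m \<in> C))"
  proof (rule sum.cong[OF refl])
    fix C assume "C \<in> rooted_maps e"
    then obtain m where m: "m \<in> ?A" "C = cl m" unfolding RM by blast
    define m0 where "m0 = (SOME m. m \<in> C)"
    have m0: "m0 \<in> C" unfolding m0_def using self m(2) by (metis someI)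
    have m0A: "m0 \<in> ?A" using m0 clA m by blast
    have C: "C = cl m0" using cl_eq m0 m(2) by blast
    have "g m' = g m0" if h: "m' \<in> C" for m'
    proof -
      obtain \<pi> where p: "\<pi> \<in> ?P" "m' = relab_map \<pi> m0" using h unfolding C cl_def by blast
      show ?thesis unfolding p(2) by (rule inv[OF Pb(1)[OF p(1)] Pb(2)[OF p(1)] Pb(3)[OF p(1)] m0A])
    qed
    then have "(\<Sum>m\<in>C. g m) = of_nat (card C) * g m0" by simp
    then show "(\<Sum>m\<in>C. g m) = of_nat (fact (2 * e - 1)) * g (SOME m. m \<in> C)"
      using card_cl m m0_def by simp
  qed
  finally show ?thesis by (simp add: sum_distrib_left)
qed

section \<open>Weighted sums over labelled maps\<close>

lemma kc_hom [simp]: "kc 0 = 0" "kc 1 = 1" "kc (c + d) = kc c + kc d" "kc (c * d) = kc c * kc d"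
  by (simp_all add: kc_def cK_def Zero_fract_def[symmetric] One_fract_def[symmetric]
    fls_const_mult_const fls_plus_const mult.commute one_pCons flip: one_pCons)

lemma kc_diff [simp]: "kc (c - d) = kc c - kc d"
  using kc_hom(3)[of "c - d" d] by simp

lemma kc_eq_0_iff [simp]: "kc c = 0 \<longleftrightarrow> c = 0"
proof
  assume "kc c = 0"
  then have "fls_nth (kc c) 0 = 0" by simp
  then have "Fract [:c:] 1 = Fract 0 1"
    unfolding kc_def cK_def Zero_fract_def by simp
  then show "c = 0" by (simp add: eq_fract)
qed simp

lemma funpow_in_orb: "(p ^^ k) x \<in> orb p x"
  by (auto simp: orb_def)

text \<open>Source of the divided differences. Inserting \<open>b\<close> after \<open>z\<close> in
  the cycle of \<open>a\<close> and then splitting at \<open>a\<close> and \<open>b\<close> cuts the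
  cycle in two; as \<open>z\<close> runs through it, the piece containing \<open>a\<close> takes
  every length from 1 to the full length once.\<close>

lemma sum_orbit_positions:
  fixes f :: "nat \<Rightarrow> 'a :: comm_monoid_add"
  assumes p: "p permutes D" and D: "finite D" and a: "a \<in> D" and b: "b \<notin> D"
  shows "(\<Sum>z\<in>orb p a. f (card (orb (p \<circ> sw z b \<circ> sw a b) a))) = (\<Sum>k\<in>{1..card (orb p a)}. f k)"
proof -
  have P: "perm_on p D" using permutes_perm_on p D by blast
  define m where "m = (LEAST m. m > 0 \<and> (p ^^ m) a = a)"
  have ex: "\<exists>m. m > 0 \<and> (p ^^ m) a = a" using perm_on_period[OF P a] by blast
  have m: "m > 0" "(p ^^ m) a = a" using LeastI_ex[OF ex] unfolding m_def by auto
  have least: "(p ^^ i) a \<noteq> a" if "0 < i" "i < m" for i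
    using not_less_Least[of i "\<lambda>m. m > 0 \<and> (p ^^ m) a = a"] that unfolding m_def by auto
  have pinj: "inj (p ^^ i)" for i
    using permutes_inj[OF p] by (induction i) (auto intro: inj_compose)
  have ne: "(p ^^ i) a \<noteq> (p ^^ j) a" if "i < j" "j - i < m" for i j
  proof
    assume e: "(p ^^ i) a = (p ^^ j) a"
    have "(p ^^ j) a = (p ^^ i) ((p ^^ (j - i)) a)"
      using that funpow_add[of i "j - i" p] by simp
    then have "a = (p ^^ (j - i)) a" using e injD[OF pinj[of i]] by metis
    then show False using least[of "j - i"] that by simp
  qed
  have inj: "inj_on (\<lambda>i. (p ^^ i) a) {u..<u + m}" for u
  proof (rule inj_onI)
    fix i j assume ij: "i \<in> {u..<u + m}" "j \<in> {u..<u + m}" "(p ^^ i) a = (p ^^ j) a"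
    show "i = j"
    proof (rule linorder_cases[of i j])
      assume "i < j"
      moreover have "u \<le> i" "j < u + m" using ij by auto
      ultimately have "j - i < m" by linarith
      then show ?thesis using ne[of i j] ij \<open>i < j\<close> by simp
    next
      assume "j < i"
      moreover have "u \<le> j" "i < u + m" using ij by auto
      ultimately have "i - j < m" by linarith
      then show ?thesis using ne[of j i] ij \<open>j < i\<close> by simp
    qed
  qed
  have orb: "orb p a = (\<lambda>i. (p ^^ i) a) ` {0..<0 + m}"
  proof
    have "closed_under p ((\<lambda>i. (p ^^ i) a) ` {0..<0 + m})"
      unfolding closed_under_def
    proof clarsimp
      fix i assume "i < m"
      show "p ((p ^^ i) a) \<in> (\<lambda>i. (p ^^ i) a) ` {0..<m}"
      proof (cases "Suc i = m")
        case True
        then have "p ((p ^^ i) a) = (p ^^ 0) a" using m(2) by auto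
        then show ?thesis using m(1) by (intro image_eqI[of _ _ 0]) auto
      next
        case False
        then show ?thesis using \<open>i < m\<close> by (intro image_eqI[of _ _ "Suc i"]) auto
      qed
    qed
    moreover have "a \<in> (\<lambda>i. (p ^^ i) a) ` {0..<0 + m}" using m(1) by (intro image_eqI[of _ _ 0]) auto
    ultimately show "orb p a \<subseteq> (\<lambda>i. (p ^^ i) a) ` {0..<0 + m}" by (rule orb_least[rotated])
  qed (auto simp: orb_def)
  have card: "card (orb p a) = m" unfolding orb card_image[OF inj] by simp
  have oD: "orb p a \<subseteq> D" using perm_on_orb_subset[OF P a] .
  \<comment> \<open>The modified permutation jumps from \<open>a\<close> directly behind
    \<open>z\<close> and then follows the old cycle home, so the new orbit consists of the iterates
    \<open>j + 1\<close> to \<open>m\<close>, the last one being \<open>a\<close>.\<close>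
  have main: "card (orb (p \<circ> sw z b \<circ> sw a b) a) = m - j" if j: "j < m" and z: "z = (p ^^ j) a" for j z
  proof -
    define q where "q = p \<circ> sw z b \<circ> sw a b"
    let ?T = "(\<lambda>i. (p ^^ i) a) ` {Suc j..<Suc (j + (m - j))}"
    have nb: "(p ^^ i) a \<noteq> b" for i
    proof -
      have "(p ^^ i) a \<in> orb p a" by (rule funpow_in_orb)
      then show ?thesis using oD b by blast
    qed
    have qa: "q a = (p ^^ Suc j) a" using nb[of j] nb[of 0] z
      by (auto simp: q_def Transposition.transpose_def)
    have qi: "q ((p ^^ i) a) = (p ^^ Suc i) a" if "j < i" "i < m" for i
      using nb[of i] least[of i] ne[of j i] that z less_imp_diff_less[of i m j]
      by (auto simp: q_def Transposition.transpose_def)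
    have it: "(q ^^ Suc k) a = (p ^^ (j + Suc k)) a" if "j + Suc k \<le> m" for k
      using that
    proof (induction k)
      case 0 then show ?case using qa by (simp del: funpow.simps(2) add: funpow.simps(2)[of 0 q])
    next
      case (Suc k)
      then have "(q ^^ Suc k) a = (p ^^ (j + Suc k)) a" by simp
      then have "(q ^^ Suc (Suc k)) a = q ((p ^^ (j + Suc k)) a)" by simp
      also have "\<dots> = (p ^^ Suc (j + Suc k)) a" using qi[of "j + Suc k"] Suc.prems by simp
      finally show ?case by simp
    qed
    have "orb q a = ?T"
    proof
      have "closed_under q ?T"
        unfolding closed_under_def
      proof
        fix x assume "x \<in> ?T"
        then obtain i where i0: "i \<in> {Suc j..<Suc (j + (m - j))}" "x = (p ^^ i) a" by blast
        then have i: "j < i" "i \<le> m" "x = (p ^^ i) a" using j by auto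
        show "q x \<in> ?T"
        proof (cases "i = m")
          case True
          then have "q x = (p ^^ Suc j) a" using i m(2) qa by simp
          then show ?thesis using j by (intro image_eqI[of _ _ "Suc j"]) auto
        next
          case False
          then have "q x = (p ^^ Suc i) a" using i qi by simp
          then show ?thesis using j i False by (intro image_eqI[of _ _ "Suc i"]) auto
        qed
      qed
      moreover have "a \<in> ?T" using j m(2) by (intro image_eqI[of _ _ m]) auto
      ultimately show "orb q a \<subseteq> ?T" by (rule orb_least[rotated])
      show "?T \<subseteq> orb q a"
      proof
        fix x assume "x \<in> ?T"
        then obtain i where i0: "i \<in> {Suc j..<Suc (j + (m - j))}" "x = (p ^^ i) a" by blast
        then have i: "j < i" "i \<le> m" "x = (p ^^ i) a" using j by auto
        have "x = (q ^^ Suc (i - j - 1)) a" using it[of "i - j - 1"] i by simp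
        then show "x \<in> orb q a" by (metis funpow_in_orb)
      qed
    qed
    moreover have "inj_on (\<lambda>i. (p ^^ i) a) {Suc j..<Suc (j + (m - j))}"
      by (rule inj_on_subset[OF inj[of "Suc j"]]) auto
    ultimately show ?thesis unfolding q_def[symmetric] by (simp add: card_image)
  qed
  have "(\<Sum>z\<in>orb p a. f (card (orb (p \<circ> sw z b \<circ> sw a b) a))) = (\<Sum>j\<in>{0..<0 + m}. f (m - j))"
    unfolding orb sum.reindex[OF inj] comp_def[of "\<lambda>z. f _"]
    by (intro sum.cong refl arg_cong[where f = f]) (use main in auto)
  also have "\<dots> = (\<Sum>k\<in>{1..m}. f k)"
    by (rule sum.reindex_bij_witness[where i = "\<lambda>k. m - k" and j = "\<lambda>k. m - k"]) auto
  finally show ?thesis unfolding card .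
qed

lemma sum_subsets_card:
  fixes f :: "nat \<Rightarrow> 'a :: comm_semiring_1"
  assumes "finite Y"
  shows "(\<Sum>S\<in>Pow Y. f (card S)) = (\<Sum>k\<le>card Y. of_nat (card Y choose k) * f k)"
proof -
  have "(\<Sum>S\<in>Pow Y. f (card S)) = (\<Sum>k\<le>card Y. \<Sum>S\<in>{S \<in> Pow Y. card S = k}. f (card S))"
    by (rule sum.group[symmetric]) (use assms in \<open>auto simp: card_mono\<close>)
  also have "\<dots> = (\<Sum>k\<le>card Y. of_nat (card Y choose k) * f k)"
  proof (rule sum.cong[OF refl])
    fix k
    have "{S \<in> Pow Y. card S = k} = {S. S \<subseteq> Y \<and> card S = k}" by auto
    then have "card {S \<in> Pow Y. card S = k} = card Y choose k" using n_subsets[OF assms] by simp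
    then show "(\<Sum>S\<in>{S \<in> Pow Y. card S = k}. f (card S)) = of_nat (card Y choose k) * f k" by simp
  qed
  finally show ?thesis .
qed

text \<open>The factor \<open>T\<close> is left free because the terms of deletion and contraction are weighted with the
  number of vertices of the original map.\<close>

definition vweight :: "nat set \<Rightarrow> cmap \<Rightarrow> K \<Rightarrow> K" where
  "vweight X m T = wK ^ (cyc (fst m) X - 1) * T / qK"

definition pottsK :: "nat set \<Rightarrow> cmap \<Rightarrow> K" where
  "pottsK X m = interpK (colour_sum X (vertex_rel X (fst m)) (snd m))"

definition vdeg :: "nat \<Rightarrow> cmap \<Rightarrow> nat" where "vdeg a m = card (orb (fst m) a)"
definition fdeg :: "nat \<Rightarrow> cmap \<Rightarrow> nat" where "fdeg a m = card (orb (fst m \<circ> snd m) a)"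

text \<open>The leg \<open>a\<close> itself counts once in the vertex degree and once in the face degree.\<close>

definition leg_weight :: "Kr fls \<Rightarrow> Kr fls \<Rightarrow> nat set \<Rightarrow> nat \<Rightarrow> cmap \<Rightarrow> Kr fls" where
  "leg_weight x y X a m = kc (vweight X m (pottsK X m)) * x ^ (vdeg a m - 1) * y ^ (fdeg a m - 1)"

definition root_weight :: "Kr fls \<Rightarrow> Kr fls \<Rightarrow> nat set \<Rightarrow> nat \<Rightarrow> cmap \<Rightarrow> Kr fls" where
  "root_weight x y X a m = kc (vweight X m (pottsK X m)) * x ^ vdeg a m * y ^ fdeg a m"

text \<open>Indexed by the number of darts other than the leg, so there are \<open>n + 1\<close>
  darts altogether, against \<open>n\<close> in \<open>root_sum\<close>.\<close>

definition leg_sum :: "Kr fls \<Rightarrow> Kr fls \<Rightarrow> nat \<Rightarrow> Kr fls" where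
  "leg_sum x y n = (\<Sum>m\<in>legged {0} {0..n}. leg_weight x y {0..n} 0 m)"

definition root_sum :: "Kr fls \<Rightarrow> Kr fls \<Rightarrow> nat \<Rightarrow> Kr fls" where
  "root_sum x y n = (\<Sum>m\<in>legged {} {0..<n}. root_weight x y {0..<n} 0 m)"

lemma relab_map_invariants:
  assumes "bij \<pi>" "m \<in> legged L X" "finite X"
  shows "vweight (\<pi> ` X) (relab_map \<pi> m) T = vweight X m T" "pottsK (\<pi> ` X) (relab_map \<pi> m) = pottsK X m"
    "vdeg (\<pi> a) (relab_map \<pi> m) = vdeg a m" "fdeg (\<pi> a) (relab_map \<pi> m) = fdeg a m"
proof -
  have "invol_on (snd m) X" using assms legged_invol by (metis prod.collapse)
  then show "pottsK (\<pi> ` X) (relab_map \<pi> m) = pottsK X m"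
    unfolding pottsK_def by (intro interpK_cong) (simp add: relab_map_def relab_map_colour_sum assms(1))
  show "vweight (\<pi> ` X) (relab_map \<pi> m) T = vweight X m T"
    by (simp add: vweight_def relab_map_def relab_cyc assms(1))
  show "vdeg (\<pi> a) (relab_map \<pi> m) = vdeg a m" "fdeg (\<pi> a) (relab_map \<pi> m) = fdeg a m"
    by (simp_all add: vdeg_def fdeg_def relab_map_def relab_comp relab_card_orb assms(1))
qed

lemma osum_eq:
  assumes "finite X" "a \<in> X"
  shows "(\<Sum>m\<in>legged {a} X. leg_weight x y X a m) = leg_sum x y (card X - 1)"
proof -
  have "card X > 0" using assms by (auto simp: card_gt_0_iff)
  then have "card {0..card X - 1} = card X" by simp
  then obtain \<pi> where p: "bij \<pi>" "\<pi> ` {0..card X - 1} = X" "\<pi> 0 = a"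
    using ex_relabelling[of "{0..card X - 1}" X 0 a] assms by auto
  have "(\<Sum>m\<in>legged {a} X. leg_weight x y X a m) = (\<Sum>m\<in>legged {0} {0..card X - 1}.
    leg_weight x y X a (relab_map \<pi> m))"
    using sum.reindex_bij_betw[OF relab_map_legged_bij[OF p(1), of "{0}" "{0..card X - 1}"],
      of "leg_weight x y X a"] p by simp
  also have "\<dots> = leg_sum x y (card X - 1)"
    unfolding leg_sum_def leg_weight_def
    using relab_map_invariants[OF p(1), of _ "{0}" "{0..card X - 1}", unfolded p(2)]
      relab_map_invariants(3,4)[OF p(1), of _ "{0}" "{0..card X - 1}" 0, unfolded p(3)]
    by (intro sum.cong refl) simp
  finally show ?thesis .
qed

lemma rsum_eq:
  assumes "finite X" "a \<in> X"
  shows "(\<Sum>m\<in>legged {} X. root_weight x y X a m) = root_sum x y (card X)"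
proof -
  have "card X > 0" using assms by (auto simp: card_gt_0_iff)
  then obtain \<pi> where p: "bij \<pi>" "\<pi> ` {0..<card X} = X" "\<pi> 0 = a"
    using ex_relabelling[of "{0..<card X}" X 0 a] assms by auto
  have "(\<Sum>m\<in>legged {} X. root_weight x y X a m) = (\<Sum>m\<in>legged {} {0..<card X}.
    root_weight x y X a (relab_map \<pi> m))"
    using sum.reindex_bij_betw[OF relab_map_legged_bij[OF p(1), of "{}" "{0..<card X}"],
      of "root_weight x y X a"] p by simp
  also have "\<dots> = root_sum x y (card X)"
    unfolding root_sum_def root_weight_def
    using relab_map_invariants[OF p(1), of _ "{}" "{0..<card X}", unfolded p(2)]
      relab_map_invariants(3,4)[OF p(1), of _ "{}" "{0..<card X}" 0, unfolded p(3)]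
    by (intro sum.cong refl) simp
  finally show ?thesis .
qed

text \<open>The lone leg is the atomic map: it has one vertex, and its Potts polynomial q is
  cancelled by the division in \<open>vweight\<close>.\<close>

lemma leg_sum_0: "leg_sum x y 0 = 1"
proof -
  have id: "p = id" if "p permutes {0 :: nat}" for p
    using that by (simp only: permutes_sing)
  have c: "closed_under id S" for S by (simp add: closed_under_def)
  have cy: "cyc id {0} = 1" by (rule cyc_single) simp
  have t: "transitive_on {0} id id" unfolding transitive_on_def using c by blast
  have "(id, id) \<in> legged {0} {0}"
    using t cy unfolding legged_def planar_def nonfix_def by (auto simp: permutes_id)
  moreover have "m = (id, id)" if "m \<in> legged {0} {0}" for m
    using that id unfolding legged_def by auto
  ultimately have "legged {0} {0} = {(id, id)}" by blast
  moreover have "pottsK {0} (id, id) = qK"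
  proof -
    have "colour_sum {0} (vertex_rel {0} id) id n = of_nat n" for n
    proof -
      have "colset {0} (vertex_rel {0} id) n = (\<lambda>k d. if d = 0 then k else 0) ` {1..n}"
        by (auto simp: colset_def vertex_rel_def image_iff fun_eq_iff)
      moreover have "inj_on (\<lambda>k d. if d = 0 then k else 0) {1..n}"
        by (rule inj_onI) (auto dest: fun_cong[of _ _ 0])
      ultimately have c: "card (colset {0} (vertex_rel {0} id) n) = n"
        by (metis card_image card_atLeastAtMost diff_Suc_1)
      have "monochr {0} id c = 0" for c by (simp add: monochr_def)
      then show ?thesis by (simp add: colour_sum_def c)
    qed
    then have "colour_sum {0} (vertex_rel {0} id) id = of_nat" by (simp add: fun_eq_iff)
    then show ?thesis unfolding pottsK_def using interpK_q by simp
  qed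
  moreover have "qK \<noteq> 0" by (simp add: qK_def eq_fract Zero_fract_def)
  moreover have "vdeg 0 (id, id) = 1" "fdeg 0 (id, id) = 1"
    by (simp_all add: vdeg_def fdeg_def orb_def)
  ultimately show ?thesis unfolding leg_sum_def by (simp add: leg_weight_def vweight_def cy)
qed

text \<open>Erasing the leg after \<open>z\<close> leaves a map rooted at \<open>\<sigma> z\<close>,
  the dart that shares both the vertex and the face of the leg. The \<open>n\<close> possible roots
  contribute equally.\<close>

lemma leg_sum_root_sum:
  assumes "n \<ge> 1" shows "leg_sum x y n = of_nat n * root_sum x y n"
proof -
  let ?D = "{1..n}" and ?X = "{0..n}"
  have X: "insert 0 ?D = ?X" using assms by auto
  have "leg_sum x y n = (\<Sum>m\<in>legged {} ?D. \<Sum>z\<in>?D. leg_weight x y ?X 0 (add_leg 0 m z))"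
    unfolding leg_sum_def using add_leg_sum[of ?D 0 "{}" "leg_weight x y ?X 0"] assms unfolding X by simp
  also have "\<dots> = (\<Sum>m\<in>legged {} ?D. \<Sum>z\<in>?D. root_weight x y ?D (fst m z) m)"
  proof (intro sum.cong refl)
    fix m z assume mm: "m \<in> legged {} ?D" and z: "z \<in> ?D"
    obtain \<sigma> \<alpha> where m: "m = (\<sigma>, \<alpha>)" by (cases m)
    note l = leggedD[OF mm[unfolded m]]
    have D: "finite ?D" "0 \<notin> ?D" by auto
    have P: "perm_on \<sigma> ?D" "perm_on (\<sigma> \<circ> \<alpha>) ?D"
      using permutes_perm_on l D permutes_compose by blast+
    have f: "(\<sigma> \<circ> sw z 0) \<circ> \<alpha> = (\<sigma> \<circ> \<alpha>) \<circ> sw (\<alpha> z) 0"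
      using face_add_leg[of \<alpha> 0 \<sigma> z] l(3) permutes_fixes[OF l(2) D(2)] by blast
    have az: "\<alpha> z \<in> ?D" using z permutes_mem[OF l(2)] by blast
    have c1: "cyc (\<sigma> \<circ> sw z 0) ?X = cyc \<sigma> ?D" using orb_add_point(3)[OF l(1) D(1) z D(2)] unfolding X .
    have oz: "orb \<sigma> z \<subseteq> ?D" using perm_on_orb_subset[OF P(1) z] .
    have oz2: "orb (\<sigma> \<circ> \<alpha>) (\<alpha> z) \<subseteq> ?D" using perm_on_orb_subset[OF P(2) az] .
    have "orb \<sigma> (\<sigma> z) = orb \<sigma> z" using orb_image[OF P(1) z] .
    moreover have "orb (\<sigma> \<circ> sw z 0) 0 = insert 0 (orb \<sigma> z)" using orb_add_point(1)[OF l(1) D(1) z D(2)] .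
    ultimately have v: "vdeg 0 (add_leg 0 m z) - 1 = vdeg (\<sigma> z) m"
      using oz finite_subset[OF oz] by (simp add: vdeg_def add_leg_def m card_insert_if) auto
    have "orb (\<sigma> \<circ> \<alpha>) (\<sigma> z) = orb (\<sigma> \<circ> \<alpha>) (\<alpha> z)" using orb_image[OF P(2) az] l(3) by simp
    moreover have "orb ((\<sigma> \<circ> \<alpha>) \<circ> sw (\<alpha> z) 0) 0 = insert 0 (orb (\<sigma> \<circ> \<alpha>) (\<alpha> z))"
      using orb_add_point(1)[OF permutes_compose[OF l(2,1)] D(1) az D(2)] .
    ultimately have fd: "fdeg 0 (add_leg 0 m z) - 1 = fdeg (\<sigma> z) m"
      using oz2 finite_subset[OF oz2] f by (simp add: fdeg_def add_leg_def m card_insert_if) auto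
    have "closed_under \<alpha> ?D" using permutes_mem[OF l(2)] by (auto simp: closed_under_def)
    have "pottsK ?X (add_leg 0 m z) = pottsK ?D m"
      unfolding pottsK_def m add_leg_def
      using colour_sum_leg[OF D(1,2) z permutes_fixes[OF l(2) D(2)] \<open>closed_under \<alpha> ?D\<close> l(1)] unfolding X
      by (intro interpK_cong) simp
    then show "leg_weight x y ?X 0 (add_leg 0 m z) = root_weight x y ?D (fst m z) m"
      unfolding leg_weight_def root_weight_def v fd vweight_def using c1 by (simp add: m add_leg_def)
  qed
  also have "\<dots> = (\<Sum>m\<in>legged {} ?D. \<Sum>r\<in>?D. root_weight x y ?D r m)"
  proof (rule sum.cong[OF refl])
    fix m assume "m \<in> legged {} ?D"
    then have "fst m permutes ?D" by (auto simp: legged_def)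
    then show "(\<Sum>z\<in>?D. root_weight x y ?D (fst m z) m) = (\<Sum>r\<in>?D. root_weight x y ?D r m)"
      by (rule sum.reindex_bij_betw[OF permutes_imp_bij])
  qed
  also have "\<dots> = (\<Sum>r\<in>?D. \<Sum>m\<in>legged {} ?D. root_weight x y ?D r m)" by (rule sum.swap)
  also have "\<dots> = (\<Sum>r\<in>?D. root_sum x y n)" by (intro sum.cong refl) (simp add: rsum_eq)
  finally show ?thesis by simp
qed

section \<open>Tutte's recursion\<close>

definition potts_del :: "nat set \<Rightarrow> nat \<Rightarrow> cmap \<Rightarrow> K" where
  "potts_del X a m = interpK (colour_sum X (vertex_rel X (fst m)) (snd m \<circ> sw a (snd m a)))"

definition potts_con :: "nat set \<Rightarrow> nat \<Rightarrow> cmap \<Rightarrow> K" where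
  "potts_con X a m = interpK (colour_sum X (insert (a, snd m a) (vertex_rel X (fst m)))
    (snd m \<circ> sw a (snd m a)))"

lemma vertex_rel_subset: "closed_under \<sigma> X \<Longrightarrow> vertex_rel X \<sigma> \<subseteq> X \<times> X"
  by (auto simp: vertex_rel_def closed_under_def)

lemma pottsK_deletion_contraction:
  assumes "m \<in> legged {} X" "finite X" "a \<in> X"
  shows "pottsK X m = potts_del X a m + (nuK - 1) * potts_con X a m"
proof -
  obtain \<sigma> \<alpha> where m: "m = (\<sigma>, \<alpha>)" by (cases m)
  have ec: "edge_cut X \<sigma> \<alpha> a (\<alpha> a)" using legged_edge_cut assms unfolding m by blast
  interpret edge_cut X \<sigma> \<alpha> a "\<alpha> a" by (rule ec)
  have c: "closed_under \<alpha>' X" using inv' by (simp add: invol_on_def)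
  have v: "vertex_rel X \<sigma> \<subseteq> X \<times> X" using vertex_rel_subset perm_on_closed[OF perm] by blast
  have p1: "polyrep (colour_sum X (vertex_rel X \<sigma>) \<alpha>')" by (rule polyrep_colour_sum[OF assms(2) v c])
  have p2: "polyrep (colour_sum X (insert (a, \<alpha> a) (vertex_rel X \<sigma>)) \<alpha>')"
    by (rule polyrep_colour_sum[OF assms(2) _ c]) (use v a b in auto)
  have "colour_sum X (vertex_rel X \<sigma>) \<alpha> = (\<lambda>n. colour_sum X (vertex_rel X \<sigma>) \<alpha>' n
    + ([:0, 1:] - 1) * colour_sum X (insert (a, \<alpha> a) (vertex_rel X \<sigma>)) \<alpha>' n)"
    by (rule ext) (rule colset_cut[OF ec])
  then show ?thesis unfolding pottsK_def potts_del_def potts_con_def m fst_conv snd_conv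
    using interpK_hom(1)[OF p1 polyrep_hom(2)[OF polyrep_nu p2]] interpK_hom(2)[OF polyrep_nu p2]
      interpK_nu by simp
qed

lemma vweight_linear: "vweight X m (S + c * T) = vweight X m S + c * vweight X m T"
  by (simp add: vweight_def algebra_simps add_divide_distrib)

lemma card_orb_pos: "perm_on p X \<Longrightarrow> x \<in> X \<Longrightarrow> card (orb p x) > 0"
  using finite_orb orb_self card_gt_0_iff by blast

lemma cyc_pos: "perm_on p X \<Longrightarrow> x \<in> X \<Longrightarrow> cyc p X > 0"
  unfolding cyc_def by (auto simp: card_gt_0_iff perm_on_finite)

lemma qK_nonzero: "qK \<noteq> 0" by (simp add: qK_def eq_fract Zero_fract_def)

section \<open>Weights of glued maps\<close>

context glue
begin

lemma perms1: "perm_on \<sigma>1 S1" "perm_on (\<sigma>1 \<circ> \<alpha>1) S1" "perm_on \<sigma>2 S2" "perm_on (\<sigma>2 \<circ> \<alpha>2) S2"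
  using permutes_perm_on fin l1(1) l2(1) permutes_compose[OF l1(2,1)] permutes_compose[OF l2(2,1)] by blast+

lemmas pos = card_orb_pos[OF perms1(1) ab(1)] card_orb_pos[OF perms1(2) ab(1)]
  card_orb_pos[OF perms1(3) ab(2)] card_orb_pos[OF perms1(4) ab(2)]
  cyc_pos[OF perms1(1) ab(1)] cyc_pos[OF perms1(3) ab(2)]

lemma card_face_join: "card (orb (\<sigma> \<circ> \<alpha>) a) = card (orb (\<sigma>1 \<circ> \<alpha>1) a) + card (orb (\<sigma>2 \<circ> \<alpha>2) b)"
  unfolding face_join(1) using face_join(2) finite_orb perms1 ab by (intro card_Un_disjoint) auto

lemma potts_parts:
  "polyrep (colour_sum S1 (vertex_rel S1 \<sigma>1) \<alpha>1)" "polyrep (colour_sum S2 (vertex_rel S2 \<sigma>2) \<alpha>2)"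
  "polyrep (colour_sum X (insert (a, b) (vertex_rel X \<sigma>)) \<beta>)"
proof -
  have c: "closed_under \<alpha>1 S1" "closed_under \<alpha>2 S2" "closed_under \<beta> X"
    using mem(3,4) permutes_mem[OF t(3)] by (simp_all add: closed_under_def del: comp_apply)
  show "polyrep (colour_sum S1 (vertex_rel S1 \<sigma>1) \<alpha>1)" "polyrep (colour_sum S2 (vertex_rel S2 \<sigma>2) \<alpha>2)"
    using polyrep_colour_sum fin vertex_rel_subset perm_on_closed perms1 c by blast+
  show "polyrep (colour_sum X (insert (a, b) (vertex_rel X \<sigma>)) \<beta>)"
    using vertex_rel_subset[OF perm_on_closed[OF perms(5)]] ab
      by (intro polyrep_colour_sum[OF finX _ c(3)]) auto
qed

lemma potts_glue:
  "interpK (colour_sum X (vertex_rel X \<sigma>) \<beta>) = pottsK S1 (\<sigma>1, \<alpha>1) * pottsK S2 (\<sigma>2, \<alpha>2)"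
  "qK * interpK (colour_sum X (insert (a, b) (vertex_rel X \<sigma>)) \<beta>) = pottsK S1 (\<sigma>1, \<alpha>1) * pottsK S2 (\<sigma>2, \<alpha>2)"
proof -
  have e: "interpK (\<lambda>n. colour_sum S1 (vertex_rel S1 \<sigma>1) \<alpha>1 n * colour_sum S2 (vertex_rel S2 \<sigma>2) \<alpha>2 n) =
    pottsK S1 (\<sigma>1, \<alpha>1) * pottsK S2 (\<sigma>2, \<alpha>2)"
    unfolding pottsK_def using interpK_hom(2)[OF potts_parts(1,2)] by simp
  show "interpK (colour_sum X (vertex_rel X \<sigma>) \<beta>) = pottsK S1 (\<sigma>1, \<alpha>1) * pottsK S2 (\<sigma>2, \<alpha>2)"
    unfolding e[symmetric] by (rule interpK_cong) (rule colour_sum_glue)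
  have "qK * interpK (colour_sum X (insert (a, b) (vertex_rel X \<sigma>)) \<beta>) =
    interpK (\<lambda>n. of_nat n * colour_sum X (insert (a, b) (vertex_rel X \<sigma>)) \<beta> n)"
    unfolding interpK_q[symmetric] interpK_hom(2)[OF polyrep_q potts_parts(3)] ..
  also have "\<dots> = pottsK S1 (\<sigma>1, \<alpha>1) * pottsK S2 (\<sigma>2, \<alpha>2)"
    unfolding e[symmetric] by (rule interpK_cong) (rule colour_sum_identify)
  finally show "qK * interpK (colour_sum X (insert (a, b) (vertex_rel X \<sigma>)) \<beta>) =
    pottsK S1 (\<sigma>1, \<alpha>1) * pottsK S2 (\<sigma>2, \<alpha>2)" .
qed

lemma snd_join: "\<alpha> a = b" "\<alpha> \<circ> sw a b = \<beta>"
  using edge_cut.ab[OF r(1)] comp_transpose_twice by auto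

text \<open>Deletion leaves two components, whose Potts polynomials multiply. Each part carries its
  own shift of the w-exponent and its own division by q, whereas the joined map has only one of
  each; hence the factor w q. The root vertex belongs to the first part, while both parts border the
  root face.\<close>

lemma isthmic_term_del:
  "kc (vweight X (\<sigma>, \<alpha>) (potts_del X a (\<sigma>, \<alpha>))) * x ^ vdeg a (\<sigma>, \<alpha>) * y ^ fdeg a (\<sigma>, \<alpha>) =
    x * y ^ 2 * kc (wK * qK) * (leg_weight x y S1 a (\<sigma>1, \<alpha>1) * leg_weight 1 y S2 b (\<sigma>2, \<alpha>2))"
proof -
  have P: "potts_del X a (\<sigma>, \<alpha>) = pottsK S1 (\<sigma>1, \<alpha>1) * pottsK S2 (\<sigma>2, \<alpha>2)"
    unfolding potts_del_def fst_conv snd_conv snd_join by (rule potts_glue(1))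
  have v: "vdeg a (\<sigma>, \<alpha>) = card (orb \<sigma>1 a)" using orb_vertex(1)[OF ab(1)] by (simp add: vdeg_def)
  have f: "fdeg a (\<sigma>, \<alpha>) = card (orb (\<sigma>1 \<circ> \<alpha>1) a) + card (orb (\<sigma>2 \<circ> \<alpha>2) b)"
    using card_face_join by (simp add: fdeg_def)
  obtain v1 f1 f2 V1 V2 where n: "card (orb \<sigma>1 a) = Suc v1" "card (orb (\<sigma>1 \<circ> \<alpha>1) a) = Suc f1"
    "card (orb (\<sigma>2 \<circ> \<alpha>2) b) = Suc f2" "cyc \<sigma>1 S1 = Suc V1" "cyc \<sigma>2 S2 = Suc V2"
    using pos by (metis gr0_conv_Suc)
  have W: "vweight X (\<sigma>, \<alpha>) (pottsK S1 (\<sigma>1, \<alpha>1) * pottsK S2 (\<sigma>2, \<alpha>2)) =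
     (wK * qK) * vweight S1 (\<sigma>1, \<alpha>1) (pottsK S1 (\<sigma>1, \<alpha>1)) * vweight S2 (\<sigma>2, \<alpha>2) (pottsK S2 (\<sigma>2, \<alpha>2))"
    unfolding vweight_def fst_conv cyc_vertex n using qK_nonzero by (simp add: power_add field_simps)
  show ?thesis unfolding P W v f unfolding leg_weight_def vdeg_def fdeg_def fst_conv snd_conv n kc_hom
    by (simp add: power_add power2_eq_square mult_ac)
qed

text \<open>Contraction identifies a vertex of each part, so the product of the Potts polynomials is
  divided by q and only w remains. The second identity, with one y less, feeds the correction for
  isthmuses among the nonloops.\<close>

lemma isthmic_term_con:
  "kc (vweight X (\<sigma>, \<alpha>) (potts_con X a (\<sigma>, \<alpha>))) * x ^ vdeg a (\<sigma>, \<alpha>) * y ^ fdeg a (\<sigma>, \<alpha>) =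
    x * y ^ 2 * kc wK * (leg_weight x y S1 a (\<sigma>1, \<alpha>1) * leg_weight 1 y S2 b (\<sigma>2, \<alpha>2))" (is ?A)
  "kc (vweight X (\<sigma>, \<alpha>) (potts_con X a (\<sigma>, \<alpha>))) * x ^ vdeg a (\<sigma>, \<alpha>) * y ^ (fdeg a (\<sigma>, \<alpha>) - 1) =
    x * y * kc wK * (leg_weight x y S1 a (\<sigma>1, \<alpha>1) * leg_weight 1 y S2 b (\<sigma>2, \<alpha>2))" (is ?B)
proof -
  have P: "potts_con X a (\<sigma>, \<alpha>) = pottsK S1 (\<sigma>1, \<alpha>1) * pottsK S2 (\<sigma>2, \<alpha>2) / qK"
    unfolding potts_con_def fst_conv snd_conv snd_join potts_glue(2)[symmetric] using qK_nonzero by simp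
  have v: "vdeg a (\<sigma>, \<alpha>) = card (orb \<sigma>1 a)" using orb_vertex(1)[OF ab(1)] by (simp add: vdeg_def)
  have f: "fdeg a (\<sigma>, \<alpha>) = card (orb (\<sigma>1 \<circ> \<alpha>1) a) + card (orb (\<sigma>2 \<circ> \<alpha>2) b)"
    using card_face_join by (simp add: fdeg_def)
  obtain v1 f1 f2 V1 V2 where n: "card (orb \<sigma>1 a) = Suc v1" "card (orb (\<sigma>1 \<circ> \<alpha>1) a) = Suc f1"
    "card (orb (\<sigma>2 \<circ> \<alpha>2) b) = Suc f2" "cyc \<sigma>1 S1 = Suc V1" "cyc \<sigma>2 S2 = Suc V2"
    using pos by (metis gr0_conv_Suc)
  have W: "vweight X (\<sigma>, \<alpha>) (pottsK S1 (\<sigma>1, \<alpha>1) * pottsK S2 (\<sigma>2, \<alpha>2) / qK) =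
     wK * vweight S1 (\<sigma>1, \<alpha>1) (pottsK S1 (\<sigma>1, \<alpha>1)) * vweight S2 (\<sigma>2, \<alpha>2) (pottsK S2 (\<sigma>2, \<alpha>2))"
    unfolding vweight_def fst_conv cyc_vertex n using qK_nonzero by (simp add: power_add field_simps)
  show ?A ?B unfolding P W v f unfolding leg_weight_def vdeg_def fdeg_def fst_conv snd_conv n kc_hom
    by (simp_all add: power_add power2_eq_square mult_ac)
qed

text \<open>A planar map rooted at a loop is the dual of a map rooted at an isthmus. In terms of the
  undualised parts, the vertices of \<open>a\<close> and \<open>b\<close> are merged and the
  involution is the one of the join.\<close>

lemma dual_join: "dual_map (join a b (dual_map (\<sigma>1, \<alpha>1)) (dual_map (\<sigma>2, \<alpha>2))) = (\<sigma> \<circ> sw a b, \<alpha>)"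
proof -
  have "(\<sigma>1 \<circ> \<alpha>1) \<circ> (\<sigma>2 \<circ> \<alpha>2) = \<sigma> \<circ> \<beta>"
  proof
    fix x
    note d = disjoint_comp[OF permutes_compose[OF l1(2,1)] permutes_compose[OF l2(2,1)] disj]
    consider "x \<in> S1" | "x \<in> S2" | "x \<notin> X" by blast
    then show "((\<sigma>1 \<circ> \<alpha>1) \<circ> (\<sigma>2 \<circ> \<alpha>2)) x = (\<sigma> \<circ> \<beta>) x"
    proof cases
      case 1 show ?thesis by (simp only: d(1)[OF 1] face(1)[OF 1])
    next
      case 2 show ?thesis by (simp only: d(2)[OF 2] face(2)[OF 2])
    next
      case 3 show ?thesis
        by (simp only: permutes_fixes[OF d(3) 3] permutes_fixes[OF permutes_compose[OF t(3) s(3)] 3])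
    qed
  qed
  then have "(\<sigma>1 \<circ> \<alpha>1) \<circ> (\<sigma>2 \<circ> \<alpha>2) \<circ> \<alpha> = \<sigma> \<circ> sw a b"
    using beta_invol by (auto simp: fun_eq_iff)
  then show ?thesis by (simp add: dual_map_def join_def comp_assoc)
qed

text \<open>The ends of a loop have equal colours anyway, so deletion and contraction yield the same
  polynomial, that of two parts sharing a vertex. The parts have one vertex more than the whole and
  one division by q more on each side, so no constant survives.\<close>

lemma loop_term:
  "kc (vweight X (\<sigma> \<circ> sw a b, \<alpha>) (potts_del X a (\<sigma> \<circ> sw a b, \<alpha>))) * x ^ vdeg a (\<sigma> \<circ> sw a b, \<alpha>) * y ^
    fdeg a (\<sigma> \<circ> sw a b, \<alpha>) =
    x ^ 2 * y * (leg_weight x y S1 a (\<sigma>1, \<alpha>1) * leg_weight x 1 S2 b (\<sigma>2, \<alpha>2))" (is ?A)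
  "kc (vweight X (\<sigma> \<circ> sw a b, \<alpha>) (potts_del X a (\<sigma> \<circ> sw a b, \<alpha>))) * x ^ (vdeg a (\<sigma> \<circ> sw a b, \<alpha>) - 1) * y
    ^ fdeg a (\<sigma> \<circ> sw a b, \<alpha>) =
    x * y * (leg_weight x y S1 a (\<sigma>1, \<alpha>1) * leg_weight x 1 S2 b (\<sigma>2, \<alpha>2))" (is ?B)
  "kc (vweight X (\<sigma> \<circ> sw a b, \<alpha>) (potts_con X a (\<sigma> \<circ> sw a b, \<alpha>))) * x ^ vdeg a (\<sigma> \<circ> sw a b, \<alpha>) * y ^
    fdeg a (\<sigma> \<circ> sw a b, \<alpha>) =
    x ^ 2 * y * (leg_weight x y S1 a (\<sigma>1, \<alpha>1) * leg_weight x 1 S2 b (\<sigma>2, \<alpha>2))" (is ?C)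
proof -
  let ?t = "\<sigma> \<circ> sw a b"
  have X: "a \<in> X" "b \<in> X" using ab by auto
  note m = orb_merge[OF perms(5) X not_in(2)]
  have o: "b \<in> orb ?t a" using m(1) orb_self by blast
  have c2: "colset X (insert (a, b) (vertex_rel X ?t)) n = colset X (insert (a, b) (vertex_rel X \<sigma>)) n" for n
    by (rule colset_swap[OF X])
  have c1: "colset X (vertex_rel X ?t) n = colset X (insert (a, b) (vertex_rel X \<sigma>)) n" for n
    using c2 colset_orb[OF perm_on_comp_transpose[OF perms(5) X] X(1) o] by blast
  have z: "colour_sum X (vertex_rel X ?t) \<beta> = colour_sum X (insert (a, b) (vertex_rel X \<sigma>)) \<beta>"
    "colour_sum X (insert (a, b) (vertex_rel X ?t)) \<beta> = colour_sum X (insert (a, b) (vertex_rel X \<sigma>)) \<beta>"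
    unfolding colour_sum_def c1 c2 by auto
  have P: "potts_del X a (?t, \<alpha>) = pottsK S1 (\<sigma>1, \<alpha>1) * pottsK S2 (\<sigma>2, \<alpha>2) / qK"
    "potts_con X a (?t, \<alpha>) = pottsK S1 (\<sigma>1, \<alpha>1) * pottsK S2 (\<sigma>2, \<alpha>2) / qK"
    unfolding potts_del_def potts_con_def fst_conv snd_conv snd_join z potts_glue(2)[symmetric]
      using qK_nonzero by simp_all
  have v: "vdeg a (?t, \<alpha>) = card (orb \<sigma>1 a) + card (orb \<sigma>2 b)"
  proof -
    have "orb \<sigma> a \<inter> orb \<sigma> b = {}"
      using perm_on_orb_subset[OF perms(1) ab(1)] perm_on_orb_subset[OF perms(2) ab(2)] disj by blast
    then have "card (orb \<sigma> a \<union> orb \<sigma> b) = card (orb \<sigma> a) + card (orb \<sigma> b)"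
      using finite_orb perms ab by (intro card_Un_disjoint) auto
    then show ?thesis unfolding vdeg_def fst_conv m(1) orb_vertex(1)[OF ab(1)] orb_vertex(2)[OF ab(2)] .
  qed
  have tt: "?t \<circ> \<alpha> = \<sigma> \<circ> \<beta>"
  proof
    fix x
    have "\<beta> a = a" "\<beta> b = b" using beta_fix by blast+
    moreover have "\<beta> x = \<beta> y \<longleftrightarrow> x = y" for x y by (metis beta_invol)
    ultimately have "sw a b (\<beta> (sw a b x)) = \<beta> x" by (metis Transposition.transpose_def)
    then show "(?t \<circ> \<alpha>) x = (\<sigma> \<circ> \<beta>) x" by (metis comp_apply)
  qed
  have f: "fdeg a (?t, \<alpha>) = card (orb (\<sigma>1 \<circ> \<alpha>1) a)"
    unfolding fdeg_def fst_conv snd_conv tt orb_face(1)[OF ab(1)] ..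
  obtain v1 v2 f1 V1 V2 where n: "card (orb \<sigma>1 a) = Suc v1" "card (orb (\<sigma>1 \<circ> \<alpha>1) a) = Suc f1"
    "card (orb \<sigma>2 b) = Suc v2" "cyc \<sigma>1 S1 = Suc V1" "cyc \<sigma>2 S2 = Suc V2"
    using pos by (metis gr0_conv_Suc)
  have V: "cyc ?t X = Suc (V1 + V2)" using m(4) cyc_vertex n by simp
  have W: "vweight X (?t, \<alpha>) (pottsK S1 (\<sigma>1, \<alpha>1) * pottsK S2 (\<sigma>2, \<alpha>2) / qK) =
     vweight S1 (\<sigma>1, \<alpha>1) (pottsK S1 (\<sigma>1, \<alpha>1)) * vweight S2 (\<sigma>2, \<alpha>2) (pottsK S2 (\<sigma>2, \<alpha>2))"
    unfolding vweight_def fst_conv V n using qK_nonzero by (simp add: power_add field_simps)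
  show ?A ?B ?C unfolding P W v f unfolding leg_weight_def vdeg_def fdeg_def fst_conv snd_conv n kc_hom
    by (simp_all add: power_add power2_eq_square mult_ac)
qed

end

text \<open>A labelled product: \<open>b\<close> is the label of the second leg, and
  \<open>S\<close> selects the labels given to the first part besides the root.\<close>

definition conv_sum :: "nat set \<Rightarrow> nat \<Rightarrow> (nat \<Rightarrow> Kr fls) \<Rightarrow> (nat \<Rightarrow> Kr fls) \<Rightarrow> Kr fls" where
  "conv_sum X a f g = (\<Sum>b\<in>X - {a}. \<Sum>S\<in>Pow (X - {a, b}). f (card S) * g (card X - 2 - card S))"

lemma legged_pair_sum:
  assumes fX: "finite X" and a: "a \<in> X"
    and H: "\<And>S b m1 m2. S \<subseteq> X \<Longrightarrow> m1 \<in> legged {a} S \<Longrightarrow> m2 \<in> legged {b} (X - S) \<Longrightarrow>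
      H b m1 m2 = k * (leg_weight x y S a m1 * leg_weight x' y' (X - S) b m2)"
  shows "(\<Sum>b\<in>X - {a}. \<Sum>S\<in>Pow (X - {a, b}). \<Sum>m1\<in>legged {a} (insert a S).
       \<Sum>m2\<in>legged {b} (X - insert a S). H b m1 m2) = k * conv_sum X a (leg_sum x y) (leg_sum x' y')"
  unfolding conv_sum_def sum_distrib_left
proof (rule sum.cong[OF refl], rule sum.cong[OF refl])
  fix b S assume b: "b \<in> X - {a}" and S: "S \<in> Pow (X - {a, b})"
  have fS: "finite S" "a \<notin> S" "insert a S \<subseteq> X" using S fX a finite_subset by auto
  have c: "card (insert a S) - 1 = card S" using fS by simp
  have d: "card (X - insert a S) - 1 = card X - 2 - card S"
    using fS fX by (simp add: card_Diff_subset)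
  have o1: "(\<Sum>m1\<in>legged {a} (insert a S). leg_weight x y (insert a S) a m1) = leg_sum x y (card S)"
    using osum_eq[of "insert a S" a] fS unfolding c by simp
  have "b \<in> X - insert a S" using b S by auto
  then have o2: "(\<Sum>m2\<in>legged {b} (X - insert a S). leg_weight x' y' (X - insert a S) b m2) =
    leg_sum x' y' (card X - 2 - card S)"
    using osum_eq[of "X - insert a S" b] fX unfolding d by blast
  have "(\<Sum>m1\<in>legged {a} (insert a S). \<Sum>m2\<in>legged {b} (X - insert a S). H b m1 m2) =
    (\<Sum>m1\<in>legged {a} (insert a S). \<Sum>m2\<in>legged {b} (X - insert a S).
       k * (leg_weight x y (insert a S) a m1 * leg_weight x' y' (X - insert a S) b m2))"
    by (intro sum.cong refl H[OF fS(3)])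
  also have "\<dots> = k * ((\<Sum>m1\<in>legged {a} (insert a S). leg_weight x y (insert a S) a m1) *
       (\<Sum>m2\<in>legged {b} (X - insert a S). leg_weight x' y' (X - insert a S) b m2))"
    unfolding sum_product unfolding sum_distrib_left ..
  finally show "(\<Sum>m1\<in>legged {a} (insert a S). \<Sum>m2\<in>legged {b} (X - insert a S). H b m1 m2) =
    k * (leg_sum x y (card S) * leg_sum x' y' (card X - 2 - card S))" unfolding o1 o2 .
qed

lemma isthmic_eval:
  assumes fX: "finite X" and a: "a \<in> X"
    and G: "\<And>S b m1 m2. S \<subseteq> X \<Longrightarrow> m1 \<in> legged {a} S \<Longrightarrow> m2 \<in> legged {b} (X - S) \<Longrightarrow>
      G (join a b m1 m2) = k * (leg_weight x y S a m1 * leg_weight x' y' (X - S) b m2)"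
  shows "(\<Sum>m\<in>isthmic X a. G m) = k * conv_sum X a (leg_sum x y) (leg_sum x' y')"
  unfolding isthmic_sum[OF fX a]
  by (rule legged_pair_sum[OF fX a, where H = "\<lambda>b m1 m2. G (join a b m1 m2)", OF G])

text \<open>Dualising both parts permutes the sets they range over, so the summand may be written in
  terms of undualised parts, the form in which \<open>loop_term\<close> evaluates it.\<close>

lemma loops_eval:
  assumes fX: "finite X" and a: "a \<in> X"
    and G: "\<And>S b m1 m2. S \<subseteq> X \<Longrightarrow> m1 \<in> legged {a} S \<Longrightarrow> m2 \<in> legged {b} (X - S) \<Longrightarrow>
      G (dual_map (join a b (dual_map m1) (dual_map m2))) =
        k * (leg_weight x y S a m1 * leg_weight x' y' (X - S) b m2)"
  shows "(\<Sum>m\<in>loops X a. G m) = k * conv_sum X a (leg_sum x y) (leg_sum x' y')"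
proof -
  have "(\<Sum>m\<in>loops X a. G m) = (\<Sum>m\<in>isthmic X a. G (dual_map m))" by (rule loops_sum)
  also have "\<dots> = (\<Sum>b\<in>X - {a}. \<Sum>S\<in>Pow (X - {a, b}). \<Sum>m1\<in>legged {a} (insert a S).
       \<Sum>m2\<in>legged {b} (X - insert a S). G (dual_map (join a b m1 m2)))"
    by (rule isthmic_sum[OF fX a])
  also have "\<dots> = (\<Sum>b\<in>X - {a}. \<Sum>S\<in>Pow (X - {a, b}). \<Sum>m1\<in>legged {a} (insert a S).
       \<Sum>m2\<in>legged {b} (X - insert a S). G (dual_map (join a b (dual_map m1) (dual_map m2))))"
  proof (rule sum.cong[OF refl], rule sum.cong[OF refl])
    fix b S
    let ?h = "\<lambda>m1. \<Sum>m2\<in>legged {b} (X - insert a S). G (dual_map (join a b m1 m2))"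
    have "(\<Sum>m1\<in>legged {a} (insert a S). ?h m1) = (\<Sum>m1\<in>legged {a} (insert a S). ?h (dual_map m1))"
      by (rule dual_map_sum[symmetric])
    also have "\<dots> = (\<Sum>m1\<in>legged {a} (insert a S).
       \<Sum>m2\<in>legged {b} (X - insert a S). G (dual_map (join a b (dual_map m1) (dual_map m2))))"
      by (rule sum.cong[OF refl]) (rule dual_map_sum[symmetric])
    finally show "(\<Sum>m1\<in>legged {a} (insert a S). ?h m1) = (\<Sum>m1\<in>legged {a} (insert a S).
       \<Sum>m2\<in>legged {b} (X - insert a S). G (dual_map (join a b (dual_map m1) (dual_map m2))))" .
  qed
  also have "\<dots> = k * conv_sum X a (leg_sum x y) (leg_sum x' y')"
    by (rule legged_pair_sum[OF fX a, where H = "\<lambda>b m1 m2.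
      G (dual_map (join a b (dual_map m1) (dual_map m2)))", OF G])
  finally show ?thesis .
qed

lemma isthmic_sums:
  assumes fX: "finite X" and a: "a \<in> X"
  shows "(\<Sum>m\<in>isthmic X a. kc (vweight X m (potts_del X a m)) * x ^ vdeg a m * y ^ fdeg a m) =
      x * y ^ 2 * kc (wK * qK) * conv_sum X a (leg_sum x y) (leg_sum 1 y)" (is ?A)
    and "(\<Sum>m\<in>isthmic X a. kc (vweight X m (potts_con X a m)) * x ^ vdeg a m * y ^ fdeg a m) =
      x * y ^ 2 * kc wK * conv_sum X a (leg_sum x y) (leg_sum 1 y)" (is ?B)
    and "(\<Sum>m\<in>isthmic X a. kc (vweight X m (potts_con X a m)) * x ^ vdeg a m * y ^ (fdeg a m - 1)) =
      x * y * kc wK * conv_sum X a (leg_sum x y) (leg_sum 1 y)" (is ?C)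
proof -
  have T: "kc (vweight X m (potts_del X a m)) * x ^ vdeg a m * y ^ fdeg a m =
      x * y ^ 2 * kc (wK * qK) * (leg_weight x y S a m1 * leg_weight 1 y (X - S) b m2)"
    "kc (vweight X m (potts_con X a m)) * x ^ vdeg a m * y ^ fdeg a m =
      x * y ^ 2 * kc wK * (leg_weight x y S a m1 * leg_weight 1 y (X - S) b m2)"
    "kc (vweight X m (potts_con X a m)) * x ^ vdeg a m * y ^ (fdeg a m - 1) =
      x * y * kc wK * (leg_weight x y S a m1 * leg_weight 1 y (X - S) b m2)"
    if S: "S \<subseteq> X" "m1 \<in> legged {a} S" "m2 \<in> legged {b} (X - S)" and m: "m = join a b m1 m2" for S b m1 m2 m
  proof -
    interpret glue S "X - S" "fst m1" "snd m1" "fst m2" "snd m2" a b by (rule glueI[OF fX S])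
    have u: "S \<union> (X - S) = X" using S(1) by auto
    show "kc (vweight X m (potts_del X a m)) * x ^ vdeg a m * y ^ fdeg a m =
      x * y ^ 2 * kc (wK * qK) * (leg_weight x y S a m1 * leg_weight 1 y (X - S) b m2)"
      using isthmic_term_del unfolding u prod.collapse m join_def .
    show "kc (vweight X m (potts_con X a m)) * x ^ vdeg a m * y ^ fdeg a m =
      x * y ^ 2 * kc wK * (leg_weight x y S a m1 * leg_weight 1 y (X - S) b m2)"
      using isthmic_term_con(1) unfolding u prod.collapse m join_def .
    show "kc (vweight X m (potts_con X a m)) * x ^ vdeg a m * y ^ (fdeg a m - 1) =
      x * y * kc wK * (leg_weight x y S a m1 * leg_weight 1 y (X - S) b m2)"
      using isthmic_term_con(2) unfolding u prod.collapse m join_def .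
  qed
  show ?A by (rule isthmic_eval[OF fX a]) (rule T(1)[OF _ _ _ refl])
  show ?B by (rule isthmic_eval[OF fX a]) (rule T(2)[OF _ _ _ refl])
  show ?C by (rule isthmic_eval[OF fX a]) (rule T(3)[OF _ _ _ refl])
qed

lemma loops_sums:
  assumes fX: "finite X" and a: "a \<in> X"
  shows "(\<Sum>m\<in>loops X a. kc (vweight X m (potts_del X a m)) * x ^ vdeg a m * y ^ fdeg a m) =
      x ^ 2 * y * conv_sum X a (leg_sum x y) (leg_sum x 1)" (is ?A)
    and "(\<Sum>m\<in>loops X a. kc (vweight X m (potts_del X a m)) * x ^ (vdeg a m - 1) * y ^ fdeg a m) =
      x * y * conv_sum X a (leg_sum x y) (leg_sum x 1)" (is ?B)
    and "(\<Sum>m\<in>loops X a. kc (vweight X m (potts_con X a m)) * x ^ vdeg a m * y ^ fdeg a m) =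
      x ^ 2 * y * conv_sum X a (leg_sum x y) (leg_sum x 1)" (is ?C)
proof -
  have T: "kc (vweight X m (potts_del X a m)) * x ^ vdeg a m * y ^ fdeg a m =
      x ^ 2 * y * (leg_weight x y S a m1 * leg_weight x 1 (X - S) b m2)"
    "kc (vweight X m (potts_del X a m)) * x ^ (vdeg a m - 1) * y ^ fdeg a m =
      x * y * (leg_weight x y S a m1 * leg_weight x 1 (X - S) b m2)"
    "kc (vweight X m (potts_con X a m)) * x ^ vdeg a m * y ^ fdeg a m =
      x ^ 2 * y * (leg_weight x y S a m1 * leg_weight x 1 (X - S) b m2)"
    if S: "S \<subseteq> X" "m1 \<in> legged {a} S" "m2 \<in> legged {b} (X - S)"
      and m: "m = dual_map (join a b (dual_map m1) (dual_map m2))"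
    for S b m1 m2 m
  proof -
    interpret glue S "X - S" "fst m1" "snd m1" "fst m2" "snd m2" a b by (rule glueI[OF fX S])
    have u: "S \<union> (X - S) = X" using S(1) by auto
    have e: "((fst m1 \<circ> fst m2) \<circ> sw a b, (snd m1 \<circ> snd m2) \<circ> sw a b) = m"
      using dual_join unfolding m prod.collapse by simp
    show "kc (vweight X m (potts_del X a m)) * x ^ vdeg a m * y ^ fdeg a m =
      x ^ 2 * y * (leg_weight x y S a m1 * leg_weight x 1 (X - S) b m2)"
      using loop_term(1) unfolding u prod.collapse e .
    show "kc (vweight X m (potts_del X a m)) * x ^ (vdeg a m - 1) * y ^ fdeg a m =
      x * y * (leg_weight x y S a m1 * leg_weight x 1 (X - S) b m2)"
      using loop_term(2) unfolding u prod.collapse e .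
    show "kc (vweight X m (potts_con X a m)) * x ^ vdeg a m * y ^ fdeg a m =
      x ^ 2 * y * (leg_weight x y S a m1 * leg_weight x 1 (X - S) b m2)"
      using loop_term(3) unfolding u prod.collapse e .
  qed
  show ?A by (rule loops_eval[OF fX a]) (rule T(1)[OF _ _ _ refl])
  show ?B by (rule loops_eval[OF fX a]) (rule T(2)[OF _ _ _ refl])
  show ?C by (rule loops_eval[OF fX a]) (rule T(3)[OF _ _ _ refl])
qed

text \<open>The map with the single leg \<open>a\<close> receives a leg \<open>b\<close> in the
  corner after \<open>z\<close> of the face of \<open>a\<close>, and both are fused:
  \<open>\<tau>\<close> and \<open>\<beta>\<close> are the rotation and the involution of the
  resulting nonisthmic map.\<close>

locale leg_insertion =
  fixes D :: "nat set" and \<sigma> \<alpha> :: "nat \<Rightarrow> nat" and a b z :: nat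
  assumes fD: "finite D" and bD: "b \<notin> D" and m: "(\<sigma>, \<alpha>) \<in> legged {a} D"
    and z: "z \<in> orb (\<sigma> \<circ> \<alpha>) a"
begin

abbreviation "\<tau> \<equiv> \<sigma> \<circ> sw (\<alpha> z) b"
abbreviation "\<beta> \<equiv> \<alpha> \<circ> sw a b"

lemmas l = leggedD[OF m]

lemma aD: "a \<in> D" "\<alpha> a = a" "\<alpha> b = b" "a \<noteq> b"
  using l(4) l(5)[of a] permutes_fixes[OF l(2) bD] bD by auto

lemma perms: "perm_on \<sigma> D" "perm_on (\<sigma> \<circ> \<alpha>) D"
  using permutes_perm_on[OF _ fD] l(1,2) permutes_compose by blast+

lemma zD: "z \<in> D" "\<alpha> z \<in> D"
  using z perm_on_orb_subset[OF perms(2) aD(1)] permutes_mem[OF l(2)] by auto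

lemma face: "\<tau> \<circ> \<alpha> = (\<sigma> \<circ> \<alpha>) \<circ> sw z b"
  using face_add_leg[of \<alpha> b \<sigma> "\<alpha> z"] l(3) aD(3) by simp

lemma face': "\<tau> \<circ> \<beta> = (\<sigma> \<circ> \<alpha>) \<circ> sw z b \<circ> sw a b"
  using face by (metis comp_assoc)

lemma add_leg_eq: "add_leg b (\<sigma>, \<alpha>) (\<alpha> z) = (\<tau>, \<alpha>)" "add_edge a b (add_leg b (\<sigma>, \<alpha>) (\<alpha> z)) = (\<tau>, \<beta>)"
  by (simp_all add: add_leg_def add_edge_def)

lemma fp: "\<sigma> \<circ> \<alpha> permutes D" using permutes_compose[OF l(2,1)] .

lemma b_in: "b \<in> orb (\<tau> \<circ> \<alpha>) a"
proof -
  have "a \<in> orb (\<sigma> \<circ> \<alpha>) z" using orb_sym[OF perms(2) aD(1) z] .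
  then show ?thesis unfolding face using orb_add_point(2)[OF fp fD zD(1) bD aD(1)] by simp
qed

lemma legged2: "(\<tau>, \<alpha>) \<in> legged {a, b} (insert b D)"
  using add_leg_legged[OF m zD(2) bD fD] unfolding add_leg_eq by (simp add: insert_commute)

lemma cyc_faces: "cyc (\<tau> \<circ> \<beta>) (insert b D) = cyc (\<sigma> \<circ> \<alpha>) D + 1"
proof -
  have "cyc (\<tau> \<circ> \<beta>) (insert b D) = cyc (\<tau> \<circ> \<alpha>) (insert b D) + 1"
    by (rule add_edge_nonisthmic(3)[OF legged2 b_in _ aD(4)]) (use fD in simp)
  also have "cyc (\<tau> \<circ> \<alpha>) (insert b D) = cyc (\<sigma> \<circ> \<alpha>) D"
    unfolding face by (rule orb_add_point(3)[OF fp fD zD(1) bD])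
  finally show ?thesis .
qed

lemma cyc_vertices: "cyc \<tau> (insert b D) = cyc \<sigma> D"
  by (rule orb_add_point(3)[OF l(1) fD zD(2) bD])

lemma vertex_degree: "card (orb \<tau> a) - (if b \<in> orb \<tau> a then 1 else 0) = card (orb \<sigma> a)"
proof -
  have "b \<notin> orb \<sigma> a" "finite (orb \<sigma> a)"
    using perm_on_orb_subset[OF perms(1) aD(1)] bD finite_orb[OF perms(1) aD(1)] by auto
  then show ?thesis using orb_add_point(2)[OF l(1) fD zD(2) bD aD(1)] by simp
qed

lemma beta_simps: "\<beta> a = b" "\<beta> \<circ> sw a b = \<alpha>"
  using aD(3) comp_transpose_twice by auto

lemma closed_alpha: "closed_under \<alpha> D"
  using permutes_mem[OF l(2)] by (simp add: closed_under_def)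

lemma potts_del: "potts_del (insert b D) a (\<tau>, \<beta>) = pottsK D (\<sigma>, \<alpha>)"
  unfolding potts_del_def pottsK_def fst_conv snd_conv beta_simps
  by (rule interpK_cong) (rule colour_sum_leg[OF fD bD zD(2) aD(3) closed_alpha l(1)])

lemma dual_insert: "dual_map (\<tau>, \<beta>) = (\<sigma> \<circ> \<alpha> \<circ> sw z b \<circ> sw a b, \<beta>)"
  unfolding dual_map_def fst_conv snd_conv face' ..

lemma dual_face: "\<sigma> \<circ> \<alpha> \<circ> sw z b \<circ> sw a b \<circ> \<beta> = \<tau>"
proof -
  have "\<beta> (\<beta> x) = x" for x using add_edge_invol[of \<alpha> a b x] l(3) aD by blast
  then show ?thesis unfolding face'[symmetric] by (auto simp: fun_eq_iff)
qed

lemma potts_con_dual: "potts_con (insert b D) a (dual_map (\<tau>, \<beta>)) = pottsK D (dual_map (\<sigma>, \<alpha>))"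
proof -
  let ?X = "insert b D" and ?p = "\<sigma> \<circ> \<alpha> \<circ> sw z b"
  have X: "a \<in> ?X" "b \<in> ?X" "z \<in> ?X" using aD zD by auto
  have P: "perm_on ?p ?X"
    using permutes_perm_on[OF permutes_comp_sw[OF permutes_subset[OF fp subset_insertI] X(3,2)]] fD by simp
  have o: "b \<in> orb ?p a" using b_in unfolding face .
  have "colour_sum ?X (insert (a, b) (vertex_rel ?X (?p \<circ> sw a b))) \<alpha> n =
    colour_sum D (vertex_rel D (\<sigma> \<circ> \<alpha>)) \<alpha> n" for n
    unfolding colour_sum_leg[OF fD bD zD(1) aD(3) closed_alpha fp, symmetric]
    unfolding colour_sum_def colset_swap[OF X(1,2)] colset_orb[OF P X(1) o] ..
  then show ?thesis
    unfolding dual_insert unfolding potts_con_def pottsK_def dual_map_def fst_conv snd_conv beta_simps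
      by (intro interpK_cong)
qed

end

text \<open>Fusing \<open>a\<close> and \<open>b\<close> raises the degree of the root vertex just
  when \<open>b\<close> sits at that vertex. Subtracting the indicator gives a degree that does not
  depend on the corner chosen for \<open>b\<close>.\<close>

definition loop_ind :: "nat \<Rightarrow> cmap \<Rightarrow> nat" where
  "loop_ind a m = (if snd m a \<in> orb (fst m) a then 1 else 0)"

definition isthmic_ind :: "nat \<Rightarrow> cmap \<Rightarrow> nat" where
  "isthmic_ind a m = (if snd m a \<in> orb (fst m \<circ> snd m) a then 1 else 0)"

lemma geometric_Icc:
  fixes y :: "'a :: comm_ring_1"
  shows "(y - 1) * (\<Sum>k\<in>{1..n}. y ^ k) = y ^ Suc n - y"
  by (induction n) (simp_all add: algebra_simps)

lemma legged_perms:
  assumes "m \<in> legged L X" "finite X"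
  shows "perm_on (fst m) X" "perm_on (fst m \<circ> snd m) X"
proof -
  have p: "fst m permutes X" "snd m permutes X" using assms(1) by (auto simp: legged_def)
  show "perm_on (fst m) X" "perm_on (fst m \<circ> snd m) X"
    by (rule permutes_perm_on[OF p(1) assms(2)]) (rule permutes_perm_on[OF permutes_compose[OF p(2,1)]
      assms(2)])
qed

text \<open>The corner of \<open>b\<close> replaces the face weight by the sum of
  \<open>y ^ k\<close> for k from 1 to the degree, a geometric sum. The factor y - 1 stays on the
  left because y may be any element. The factor \<open>card X - 1\<close> counts the labels
  available for \<open>b\<close>.\<close>

lemma nonisthmic_sum_del:
  assumes fX: "finite X" and a: "a \<in> X"
  shows "(y - 1) * (\<Sum>m\<in>nonisthmic X a. kc (vweight X m (potts_del X a m)) * x ^ (vdeg a m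
    - loop_ind a m) * y ^ fdeg a m)
    = of_nat (card X - 1) * (x * y * (y * leg_sum x y (card X - 2) - leg_sum x 1 (card X - 2)))"
proof -
  let ?g = "\<lambda>b m. kc (vweight (X - {b}) m (pottsK (X - {b}) m)) * x ^ vdeg a m"
  have "(\<Sum>m\<in>nonisthmic X a. kc (vweight X m (potts_del X a m)) * x ^ (vdeg a m - loop_ind a m) * y ^ fdeg a m)
    = (\<Sum>b\<in>X - {a}. \<Sum>m\<in>legged {a} (X - {b}). ?g b m * (\<Sum>k\<in>{1..fdeg a m}. y ^ k))"
    unfolding nonisthmic_sum[OF fX a]
  proof (rule sum.cong[OF refl], rule sum.cong[OF refl])
    fix b m assume b: "b \<in> X - {a}" and mm: "m \<in> legged {a} (X - {b})"
    obtain \<sigma> \<alpha> where mE: "m = (\<sigma>, \<alpha>)" by (cases m)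
    have iX: "insert b (X - {b}) = X" using b by auto
    have D: "finite (X - {b})" "b \<notin> X - {b}" "a \<in> X - {b}" using fX a b by auto
    have p: "\<sigma> \<circ> \<alpha> permutes X - {b}" using mm mE leggedD(1,2) permutes_compose by blast
    let ?G = "\<lambda>m. kc (vweight X m (potts_del X a m)) * x ^ (vdeg a m - loop_ind a m) * y ^ fdeg a m"
    have "(\<Sum>z\<in>orb (\<sigma> \<circ> \<alpha>) a. ?G (add_edge a b (add_leg b m (\<alpha> z)))) =
       (\<Sum>z\<in>orb (\<sigma> \<circ> \<alpha>) a. ?g b m * y ^ card (orb (\<sigma> \<circ> \<alpha> \<circ> sw z b \<circ> sw a b) a))"
    proof (rule sum.cong[OF refl])
      fix z assume z: "z \<in> orb (\<sigma> \<circ> \<alpha>) a"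
      interpret leg_insertion "X - {b}" \<sigma> \<alpha> a b z
        by unfold_locales (use D mm mE z in auto)
      have "potts_del X a (\<tau>, \<beta>) = pottsK (X - {b}) m" using potts_del unfolding iX mE[symmetric] .
      moreover have "vweight X (\<tau>, \<beta>) T = vweight (X - {b}) m T" for T
        using cyc_vertices unfolding iX mE vweight_def by simp
      moreover have "vdeg a (\<tau>, \<beta>) - loop_ind a (\<tau>, \<beta>) = vdeg a m"
        using vertex_degree unfolding vdeg_def loop_ind_def mE fst_conv snd_conv beta_simps .
      moreover have "fdeg a (\<tau>, \<beta>) = card (orb (\<sigma> \<circ> \<alpha> \<circ> sw z b \<circ> sw a b) a)"
        unfolding fdeg_def fst_conv snd_conv face' ..
      ultimately show "?G (add_edge a b (add_leg b m (\<alpha> z))) =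
        ?g b m * y ^ card (orb (\<sigma> \<circ> \<alpha> \<circ> sw z b \<circ> sw a b) a)"
        unfolding mE add_leg_eq(2) unfolding mE[symmetric] by simp
    qed
    also have "\<dots> = ?g b m * (\<Sum>k\<in>{1..fdeg a m}. y ^ k)"
      unfolding sum_distrib_left[symmetric] sum_orbit_positions[OF p D(1,3,2)] by (simp add: fdeg_def mE)
    finally show "(\<Sum>z\<in>orb (fst m \<circ> snd m) a. ?G (add_edge a b (add_leg b m (snd m z)))) =
        ?g b m * (\<Sum>k\<in>{1..fdeg a m}. y ^ k)" unfolding mE fst_conv snd_conv .
  qed
  then have "(y - 1) * (\<Sum>m\<in>nonisthmic X a. kc (vweight X m (potts_del X a m)) * x ^ (vdeg a m
    - loop_ind a m) * y ^ fdeg a m)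
    = (\<Sum>b\<in>X - {a}. \<Sum>m\<in>legged {a} (X - {b}). (y - 1) * (?g b m * (\<Sum>k\<in>{1..fdeg a m}. y ^ k)))"
    by (simp only: sum_distrib_left)
  also have "\<dots> = (\<Sum>b\<in>X - {a}. \<Sum>m\<in>legged {a} (X - {b}).
     x * y * (y * leg_weight x y (X - {b}) a m - leg_weight x 1 (X - {b}) a m))"
  proof (rule sum.cong[OF refl], rule sum.cong[OF refl])
    fix b m assume b: "b \<in> X - {a}" and mm: "m \<in> legged {a} (X - {b})"
    have D: "finite (X - {b})" "a \<in> X - {b}" using fX a b by auto
    have p: "perm_on (fst m) (X - {b})" "perm_on (fst m \<circ> snd m) (X - {b})"
      using legged_perms[OF mm D(1)] .
    obtain v f where n: "vdeg a m = Suc v" "fdeg a m = Suc f"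
      using card_orb_pos[OF p(1) D(2)] card_orb_pos[OF p(2) D(2)] unfolding vdeg_def fdeg_def
        by (metis gr0_conv_Suc)
    have "(y - 1) * (?g b m * (\<Sum>k\<in>{1..fdeg a m}. y ^ k)) = ?g b m * ((y - 1) * (\<Sum>k\<in>{1..fdeg a m}. y ^ k))"
      by (simp only: mult.left_commute)
    also have "\<dots> = x * y * (y * leg_weight x y (X - {b}) a m - leg_weight x 1 (X - {b}) a m)"
      unfolding geometric_Icc leg_weight_def n by (simp add: algebra_simps)
    finally show "(y - 1) * (?g b m * (\<Sum>k\<in>{1..fdeg a m}. y ^ k)) =
      x * y * (y * leg_weight x y (X - {b}) a m - leg_weight x 1 (X - {b}) a m)" .
  qed
  also have "\<dots> = (\<Sum>b\<in>X - {a}. x * y * (y * leg_sum x y (card X - 2) - leg_sum x 1 (card X - 2)))"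
  proof (rule sum.cong[OF refl])
    fix b assume b: "b \<in> X - {a}"
    have c: "card (X - {b}) - 1 = card X - 2" using b fX by simp
    have D: "finite (X - {b})" "a \<in> X - {b}" using fX a b by auto
    show "(\<Sum>m\<in>legged {a} (X - {b}). x * y * (y * leg_weight x y (X - {b}) a m
      - leg_weight x 1 (X - {b}) a m)) =
      x * y * (y * leg_sum x y (card X - 2) - leg_sum x 1 (card X - 2))"
      by (simp only: sum_distrib_left[symmetric] sum_subtractf osum_eq[OF D] c)
  qed
  also have "\<dots> = of_nat (card X - 1) * (x * y * (y * leg_sum x y (card X - 2) - leg_sum x 1 (card X - 2)))"
    using a by simp
  finally show ?thesis .
qed

text \<open>The dual of \<open>nonisthmic_sum_del\<close>, with contraction in place of deletion.
  The extra w appears because contracting an edge with distinct ends loses a vertex, while the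
  weight still counts those of the original map.\<close>

lemma nonloops_sum_con:
  assumes fX: "finite X" and a: "a \<in> X"
  shows "(x - 1) * (\<Sum>m\<in>nonloops X a. kc (vweight X m (potts_con X a m)) * x ^ vdeg a m * y ^ (fdeg a m
    - isthmic_ind a m))
    = of_nat (card X - 1) * (kc wK * x * y * (x * leg_sum x y (card X - 2) - leg_sum 1 y (card X - 2)))"
proof -
  let ?g = "\<lambda>b m. kc wK * kc (vweight (X - {b}) m (pottsK (X - {b}) m)) * y ^ fdeg a m"
  let ?h = "\<lambda>b m. ?g b m * (\<Sum>k\<in>{1..vdeg a m}. x ^ k)"
  have "(\<Sum>m\<in>nonloops X a. kc (vweight X m (potts_con X a m)) * x ^ vdeg a m * y ^ (fdeg a m
    - isthmic_ind a m))
    = (\<Sum>b\<in>X - {a}. \<Sum>m\<in>legged {a} (X - {b}). ?h b (dual_map m))"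
    unfolding nonloops_sum nonisthmic_sum[OF fX a]
  proof (rule sum.cong[OF refl], rule sum.cong[OF refl])
    fix b m assume b: "b \<in> X - {a}" and mm: "m \<in> legged {a} (X - {b})"
    obtain \<sigma> \<alpha> where mE: "m = (\<sigma>, \<alpha>)" by (cases m)
    have iX: "insert b (X - {b}) = X" using b by auto
    have D: "finite (X - {b})" "b \<notin> X - {b}" "a \<in> X - {b}" using fX a b by auto
    have p: "\<sigma> \<circ> \<alpha> permutes X - {b}" using mm mE leggedD(1,2) permutes_compose by blast
    let ?G = "\<lambda>m. kc (vweight X m (potts_con X a m)) * x ^ vdeg a m * y ^ (fdeg a m - isthmic_ind a m)"
    have "(\<Sum>z\<in>orb (\<sigma> \<circ> \<alpha>) a. ?G (dual_map (add_edge a b (add_leg b m (\<alpha> z))))) =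
       (\<Sum>z\<in>orb (\<sigma> \<circ> \<alpha>) a. ?g b (dual_map m) * x ^ card (orb (\<sigma> \<circ> \<alpha> \<circ> sw z b \<circ> sw a b) a))"
    proof (rule sum.cong[OF refl])
      fix z assume z: "z \<in> orb (\<sigma> \<circ> \<alpha>) a"
      interpret leg_insertion "X - {b}" \<sigma> \<alpha> a b z
        by unfold_locales (use D mm mE z in auto)
      have P: "potts_con X a (dual_map (\<tau>, \<beta>)) = pottsK (X - {b}) (dual_map m)" using potts_con_dual
        unfolding iX mE[symmetric] .
      obtain F where F: "cyc (\<sigma> \<circ> \<alpha>) (X - {b}) = Suc F"
        using cyc_pos[OF perms(2) aD(1)] by (metis gr0_conv_Suc)
      have "fst (dual_map (\<tau>, \<beta>)) = \<tau> \<circ> \<beta>" "fst (dual_map m) = \<sigma> \<circ> \<alpha>" by (simp_all add: dual_map_def mE)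
      then have W: "vweight X (dual_map (\<tau>, \<beta>)) T = wK * vweight (X - {b}) (dual_map m) T" for T
        using cyc_faces unfolding iX vweight_def F by (simp add: F)
      have v: "vdeg a (dual_map (\<tau>, \<beta>)) = card (orb (\<sigma> \<circ> \<alpha> \<circ> sw z b \<circ> sw a b) a)"
        unfolding vdeg_def dual_insert fst_conv ..
      have e: "\<sigma> \<circ> \<alpha> \<circ> \<alpha> = \<sigma>" using l(3) by (auto simp: fun_eq_iff)
      have f: "fdeg a (dual_map (\<tau>, \<beta>)) - isthmic_ind a (dual_map (\<tau>, \<beta>)) = fdeg a (dual_map m)"
        unfolding fdeg_def isthmic_ind_def dual_insert fst_conv snd_conv dual_face beta_simps vertex_degree
        unfolding mE dual_map_def fst_conv snd_conv e ..
      show "?G (dual_map (add_edge a b (add_leg b m (\<alpha> z)))) =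
        ?g b (dual_map m) * x ^ card (orb (\<sigma> \<circ> \<alpha> \<circ> sw z b \<circ> sw a b) a)"
        unfolding mE add_leg_eq(2) unfolding mE[symmetric] P W v f by (simp add: mult_ac)
    qed
    also have "\<dots> = ?h b (dual_map m)"
      unfolding sum_distrib_left[symmetric] sum_orbit_positions[OF p D(1,3,2)]
        by (simp add: vdeg_def mE dual_map_def)
    finally show "(\<Sum>z\<in>orb (fst m \<circ> snd m) a. ?G (dual_map (add_edge a b (add_leg b m (snd m z))))) =
      ?h b (dual_map m)"
      unfolding mE fst_conv snd_conv .
  qed
  also have "\<dots> = (\<Sum>b\<in>X - {a}. \<Sum>m\<in>legged {a} (X - {b}). ?h b m)"
    by (rule sum.cong[OF refl]) (rule dual_map_sum)
  finally have "(x - 1) * (\<Sum>m\<in>nonloops X a. kc (vweight X m (potts_con X a m)) * x ^ vdeg a m * y ^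
    (fdeg a m - isthmic_ind a m))
    = (\<Sum>b\<in>X - {a}. \<Sum>m\<in>legged {a} (X - {b}). (x - 1) * ?h b m)"
    by (simp only: sum_distrib_left)
  also have "\<dots> = (\<Sum>b\<in>X - {a}. \<Sum>m\<in>legged {a} (X - {b}).
     kc wK * x * y * (x * leg_weight x y (X - {b}) a m - leg_weight 1 y (X - {b}) a m))"
  proof (rule sum.cong[OF refl], rule sum.cong[OF refl])
    fix b m assume b: "b \<in> X - {a}" and mm: "m \<in> legged {a} (X - {b})"
    have D: "finite (X - {b})" "a \<in> X - {b}" using fX a b by auto
    have p: "perm_on (fst m) (X - {b})" "perm_on (fst m \<circ> snd m) (X - {b})"
      using legged_perms[OF mm D(1)] .
    obtain v f where n: "vdeg a m = Suc v" "fdeg a m = Suc f"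
      using card_orb_pos[OF p(1) D(2)] card_orb_pos[OF p(2) D(2)] unfolding vdeg_def fdeg_def
        by (metis gr0_conv_Suc)
    have "(x - 1) * ?h b m = ?g b m * ((x - 1) * (\<Sum>k\<in>{1..vdeg a m}. x ^ k))"
      by (simp only: mult.left_commute)
    also have "\<dots> = kc wK * x * y * (x * leg_weight x y (X - {b}) a m - leg_weight 1 y (X - {b}) a m)"
      unfolding geometric_Icc leg_weight_def n by (simp add: algebra_simps)
    finally show "(x - 1) * ?h b m = kc wK * x * y * (x * leg_weight x y (X - {b}) a m
      - leg_weight 1 y (X - {b}) a m)" .
  qed
  also have "\<dots> = (\<Sum>b\<in>X - {a}. kc wK * x * y * (x * leg_sum x y (card X - 2) - leg_sum 1 y (card X - 2)))"
  proof (rule sum.cong[OF refl])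
    fix b assume b: "b \<in> X - {a}"
    have c: "card (X - {b}) - 1 = card X - 2" using b fX by simp
    have D: "finite (X - {b})" "a \<in> X - {b}" using fX a b by auto
    show "(\<Sum>m\<in>legged {a} (X - {b}). kc wK * x * y * (x * leg_weight x y (X - {b}) a m
      - leg_weight 1 y (X - {b}) a m)) =
      kc wK * x * y * (x * leg_sum x y (card X - 2) - leg_sum 1 y (card X - 2))"
      by (simp only: sum_distrib_left[symmetric] sum_subtractf osum_eq[OF D] c)
  qed
  also have "\<dots> = of_nat (card X - 1) * (kc wK * x * y * (x * leg_sum x y (card X - 2)
    - leg_sum 1 y (card X - 2)))"
    using a by simp
  finally show ?thesis .
qed

lemma conv_sum_eq:
  assumes "finite X" "a \<in> X"
  shows "conv_sum X a f g = of_nat (card X - 1) * (\<Sum>k\<le>card X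
    - 2. of_nat ((card X - 2) choose k) * (f k * g (card X - 2 - k)))"
proof -
  have "(\<Sum>S\<in>Pow (X - {a, b}). f (card S) * g (card X - 2 - card S)) =
    (\<Sum>k\<le>card X - 2. of_nat ((card X - 2) choose k) * (f k * g (card X - 2 - k)))" if "b \<in> X - {a}" for b
  proof -
    have "card (X - {a, b}) = card X - 2" using that assms by (subst card_Diff_subset) auto
    then show ?thesis using sum_subsets_card[of "X - {a, b}" "\<lambda>k. f k * g (card X - 2 - k)"] assms by simp
  qed
  then show ?thesis unfolding conv_sum_def using assms by simp
qed

definition binom_conv :: "nat \<Rightarrow> (nat \<Rightarrow> Kr fls) \<Rightarrow> (nat \<Rightarrow> Kr fls) \<Rightarrow> Kr fls" where
  "binom_conv N f g = (\<Sum>k\<le>N. of_nat (N choose k) * (f k * g (N - k)))"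

text \<open>The deleted terms are sorted by isthmus or not, the contracted terms by loop or not. The
  differences x^2 y - x y and x y^2 - x y repair the degrees of loops among the nonisthmic maps and
  of isthmuses among the nonloops. The factor N + 1 is the number of partners of the root
  dart.\<close>

theorem root_sum_recursion:
  "(x - 1) * (y - 1) * root_sum x y (N + 2) = of_nat (N + 1) *
    ((x - 1) * (y - 1) * (x * y ^ 2 * kc (wK * qK) * binom_conv N (leg_sum x y) (leg_sum 1 y)
        + (x ^ 2 * y - x * y) * binom_conv N (leg_sum x y) (leg_sum x 1)
        + kc (nuK - 1) * (x ^ 2 * y * binom_conv N (leg_sum x y) (leg_sum x 1)
          + (x * y ^ 2 - x * y) * kc wK * binom_conv N (leg_sum x y) (leg_sum 1 y)))
     + (x - 1) * (x * y * (y * leg_sum x y N - leg_sum x 1 N))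
     + kc (nuK - 1) * (y - 1) * (kc wK * x * y * (x * leg_sum x y N - leg_sum 1 y N)))"
proof -
  let ?X = "{0..<N + 2}" and ?a = "0 :: nat"
  have fX: "finite ?X" and a: "?a \<in> ?X" and c: "card ?X = N + 2" by auto
  let ?A = "\<lambda>m. kc (vweight ?X m (potts_del ?X ?a m))" and ?B = "\<lambda>m. kc (vweight ?X m (potts_con ?X ?a m))"
  let ?v = "\<lambda>m. vdeg ?a m" and ?f = "\<lambda>m. fdeg ?a m"
  let ?C = "binom_conv N (leg_sum x y) (leg_sum 1 y)" and ?D = "binom_conv N (leg_sum x y) (leg_sum x 1)"
  have cs: "conv_sum ?X ?a (leg_sum x y) (leg_sum 1 y) = of_nat (N + 1) * ?C"
    "conv_sum ?X ?a (leg_sum x y) (leg_sum x 1) = of_nat (N + 1) * ?D"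
    using conv_sum_eq[OF fX a] unfolding c binom_conv_def by simp_all
  note IS = isthmic_sums[OF fX a, of x y, unfolded cs] and LS = loops_sums[OF fX a, of x y, unfolded cs]
  have fin: "finite (legged {} ?X)" "finite (isthmic ?X ?a)" "finite (nonisthmic ?X ?a)"
    "finite (loops ?X ?a)" "finite (nonloops ?X ?a)"
    using finite_legged[OF fX] by (auto simp: isthmic_def nonisthmic_def loops_def nonloops_def)
  have U: "legged {} ?X = isthmic ?X ?a \<union> nonisthmic ?X ?a" "isthmic ?X ?a \<inter> nonisthmic ?X ?a = {}"
    "legged {} ?X = loops ?X ?a \<union> nonloops ?X ?a" "loops ?X ?a \<inter> nonloops ?X ?a = {}"
    by (auto simp: isthmic_def nonisthmic_def loops_def nonloops_def)
  have L: "loops ?X ?a = {m \<in> nonisthmic ?X ?a. snd m ?a \<in> orb (fst m) ?a}"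
    using isthmic_not_loop[OF _ fX a] by (auto simp: loops_def nonisthmic_def isthmic_def)
  have I: "isthmic ?X ?a = {m \<in> nonloops ?X ?a. snd m ?a \<in> orb (fst m \<circ> snd m) ?a}"
    using isthmic_not_loop[OF _ fX a] by (auto simp: nonloops_def isthmic_def)
  have split: "root_sum x y (N + 2) = (\<Sum>m\<in>legged {} ?X. ?A m * x ^ ?v m * y ^ ?f m)
     + kc (nuK - 1) * (\<Sum>m\<in>legged {} ?X. ?B m * x ^ ?v m * y ^ ?f m)"
    unfolding root_sum_def root_weight_def sum_distrib_left sum.distrib[symmetric]
  proof (rule sum.cong[OF refl])
    fix m assume m: "m \<in> legged {} ?X"
    show "kc (vweight ?X m (pottsK ?X m)) * x ^ ?v m * y ^ ?f m =
        ?A m * x ^ ?v m * y ^ ?f m + kc (nuK - 1) * (?B m * x ^ ?v m * y ^ ?f m)"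
      unfolding pottsK_deletion_contraction[OF m fX a] vweight_linear kc_hom
      by (simp only: distrib_right mult.assoc)
  qed
  \<comment> \<open>Loops are nonisthmic, and \<open>nonisthmic_sum_del\<close> counts them with one
    x too few; the second sum restores the true degree. The same happens to isthmuses and y in
    \<open>dB\<close>.\<close>
  have dA: "(\<Sum>m\<in>nonisthmic ?X ?a. ?A m * x ^ ?v m * y ^ ?f m) =
      (\<Sum>m\<in>nonisthmic ?X ?a. ?A m * x ^ (?v m - loop_ind ?a m) * y ^ ?f m)
    + (\<Sum>m\<in>loops ?X ?a. ?A m * x ^ ?v m * y ^ ?f m - ?A m * x ^ (?v m - 1) * y ^ ?f m)"
    unfolding L sum.inter_filter[OF fin(3)] sum.distrib[symmetric]
    by (intro sum.cong refl) (simp add: loop_ind_def)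
  have dB: "(\<Sum>m\<in>nonloops ?X ?a. ?B m * x ^ ?v m * y ^ ?f m) =
      (\<Sum>m\<in>nonloops ?X ?a. ?B m * x ^ ?v m * y ^ (?f m - isthmic_ind ?a m))
    + (\<Sum>m\<in>isthmic ?X ?a. ?B m * x ^ ?v m * y ^ ?f m - ?B m * x ^ ?v m * y ^ (?f m - 1))"
    unfolding I sum.inter_filter[OF fin(5)] sum.distrib[symmetric]
    by (intro sum.cong refl) (simp add: isthmic_ind_def)
  define n :: "Kr fls" where "n = of_nat (N + 1)"
  define NA where "NA = (\<Sum>m\<in>nonisthmic ?X ?a. ?A m * x ^ (?v m - loop_ind ?a m) * y ^ ?f m)"
  define NB where "NB = (\<Sum>m\<in>nonloops ?X ?a. ?B m * x ^ ?v m * y ^ (?f m - isthmic_ind ?a m))"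
  have NA: "(y - 1) * NA = n * (x * y * (y * leg_sum x y N - leg_sum x 1 N))"
    unfolding NA_def nonisthmic_sum_del[OF fX a] c n_def by simp
  have NB: "(x - 1) * NB = n * (kc wK * x * y * (x * leg_sum x y N - leg_sum 1 y N))"
    unfolding NB_def nonloops_sum_con[OF fX a] c n_def by simp
  have A: "(\<Sum>m\<in>legged {} ?X. ?A m * x ^ ?v m * y ^ ?f m) =
     x * y ^ 2 * kc (wK * qK) * (n * ?C) + (NA + (x ^ 2 * y * (n * ?D) - x * y * (n * ?D)))"
    unfolding U(1) sum.union_disjoint[OF fin(2,3) U(2)] dA sum_subtractf IS LS NA_def n_def ..
  have B: "(\<Sum>m\<in>legged {} ?X. ?B m * x ^ ?v m * y ^ ?f m) =
     x ^ 2 * y * (n * ?D) + (NB + (x * y ^ 2 * kc wK * (n * ?C) - x * y * kc wK * (n * ?C)))"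
    unfolding U(3) sum.union_disjoint[OF fin(4,5) U(4)] dB sum_subtractf IS LS NB_def n_def ..
  have "(x - 1) * (y - 1) * root_sum x y (N + 2) =
     (x - 1) * (y - 1) * (x * y ^ 2 * kc (wK * qK) * (n * ?C) + (x ^ 2 * y * (n * ?D) - x * y * (n * ?D)))
     + (x - 1) * ((y - 1) * NA)
     + kc (nuK - 1) * ((x - 1) * (y - 1) * (x ^ 2 * y * (n * ?D)
       + (x * y ^ 2 * kc wK * (n * ?C) - x * y * kc wK * (n * ?C)))
       + (y - 1) * ((x - 1) * NB))"
    unfolding split A B by (simp only: distrib_left distrib_right right_diff_distrib left_diff_distrib
      mult_ac add_ac) (simp add: algebra_simps)
  also have "\<dots> = n * ((x - 1) * (y - 1) * (x * y ^ 2 * kc (wK * qK) * ?C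
        + (x ^ 2 * y - x * y) * ?D
        + kc (nuK - 1) * (x ^ 2 * y * ?D + (x * y ^ 2 - x * y) * kc wK * ?C))
     + (x - 1) * (x * y * (y * leg_sum x y N - leg_sum x 1 N))
     + kc (nuK - 1) * (y - 1) * (kc wK * x * y * (x * leg_sum x y N - leg_sum 1 y N)))"
    unfolding NA NB by algebra
  finally show ?thesis unfolding n_def .
qed

section \<open>Limits in the t-adic topology\<close>

definition subdeg_ge :: "int \<Rightarrow> 'a::zero fls \<Rightarrow> bool" where
  "subdeg_ge k f \<longleftrightarrow> (\<forall>j<k. fls_nth f j = 0)"

lemma subdeg_ge_iff: "subdeg_ge k f \<longleftrightarrow> f = 0 \<or> k \<le> fls_subdegree f"
proof
  assume v: "subdeg_ge k f"
  show "f = 0 \<or> k \<le> fls_subdegree f"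
  proof (rule ccontr)
    assume "\<not> (f = 0 \<or> k \<le> fls_subdegree f)"
    then have "f \<noteq> 0" "fls_subdegree f < k" by auto
    then show False using v nth_fls_subdegree_nonzero unfolding subdeg_ge_def by blast
  qed
next
  assume "f = 0 \<or> k \<le> fls_subdegree f"
  then show "subdeg_ge k f" unfolding subdeg_ge_def by (auto intro: fls_eq0_below_subdegree)
qed

lemma subdeg_ge_0 [simp]: "subdeg_ge k 0" by (simp add: subdeg_ge_def)

lemma subdeg_ge_add: "subdeg_ge k f \<Longrightarrow> subdeg_ge k g \<Longrightarrow> subdeg_ge k (f + g)" for f :: "'a :: ab_group_add fls"
  by (simp add: subdeg_ge_def)

lemma subdeg_ge_diff: "subdeg_ge k f \<Longrightarrow> subdeg_ge k g \<Longrightarrow> subdeg_ge k (f - g)" for f :: "'a :: ab_group_add fls"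
  by (simp add: subdeg_ge_def)

lemma subdeg_ge_uminus: "subdeg_ge k f \<Longrightarrow> subdeg_ge k (- f)" for f :: "'a :: ab_group_add fls"
  by (simp add: subdeg_ge_def)

lemma subdeg_ge_sum: "(\<And>i. i \<in> A \<Longrightarrow> subdeg_ge k (f i)) \<Longrightarrow> subdeg_ge k (sum f A)"
  for f :: "_ \<Rightarrow> 'a :: ab_group_add fls"
  by (induction A rule: infinite_finite_induct) (auto intro: subdeg_ge_add)

lemma subdeg_ge_mono: "subdeg_ge k f \<Longrightarrow> j \<le> k \<Longrightarrow> subdeg_ge j f"
  by (simp add: subdeg_ge_def)

lemma subdeg_ge_mult: "subdeg_ge k f \<Longrightarrow> subdeg_ge j g \<Longrightarrow> subdeg_ge (k + j) (f * g)" for f :: "'a :: field fls"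
  by (cases "f = 0"; cases "g = 0") (simp_all add: subdeg_ge_iff)

lemma subdeg_ge_mult_0: "subdeg_ge 0 f \<Longrightarrow> subdeg_ge 0 g \<Longrightarrow> subdeg_ge 0 (f * g)" for f :: "'a :: field fls"
  using subdeg_ge_mult[of 0 f 0 g] by simp

lemma subdeg_ge_1: "subdeg_ge 0 (1 :: 'a :: field fls)" by (simp add: subdeg_ge_iff)

lemma subdeg_ge_power: "subdeg_ge 0 f \<Longrightarrow> subdeg_ge 0 (f ^ n)" for f :: "'a :: field fls"
  by (induction n) (auto intro: subdeg_ge_mult_0 subdeg_ge_1)

lemma subdeg_ge_const: "subdeg_ge 0 (fls_const (c :: 'a :: field))" by (simp add: subdeg_ge_def)

lemma subdeg_ge_X_power: "subdeg_ge (int n) (fls_X ^ n :: 'a :: field fls)"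
  by (simp add: subdeg_ge_iff)

lemma subdeg_ge_all: "(\<And>k. subdeg_ge k f) \<Longrightarrow> f = 0"
  by (rule fls_eqI) (metis subdeg_ge_def less_add_one fls_zero_nth)

lemma subdeg_ge_fps: "subdeg_ge 0 (fps_to_fls f)"
  by (simp add: subdeg_ge_def)

text \<open>\<open>l\<close> is the sum of \<open>t\<^sup>n F\<^sub>n\<close>, where every \<open>F\<^sub>n\<close> has a pole of order at most \<open>d\<close> at \<open>t = 0\<close>.\<close>

definition t_sums :: "nat \<Rightarrow> 'a :: field fls fps \<Rightarrow> 'a fls \<Rightarrow> bool" where
  "t_sums d F l \<longleftrightarrow> (\<forall>n. subdeg_ge (- int d) (fps_nth F n)) \<and>
     (\<forall>N. subdeg_ge (int N - int d) (l - (\<Sum>n<N. fls_X ^ n * fps_nth F n)))"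

lemma t_sums_unique:
  assumes "t_sums d F l" "t_sums e F m" shows "l = m"
proof -
  have "subdeg_ge k (l - m)" for k
  proof -
    define N where "N = nat (\<bar>k\<bar>) + d + e"
    let ?s = "\<Sum>n<N. fls_X ^ n * fps_nth F n"
    have "subdeg_ge (int N - int d) (l - ?s)" "subdeg_ge (int N - int e) (m - ?s)"
      using assms unfolding t_sums_def by blast+
    moreover have "k \<le> int N - int d" "k \<le> int N - int e" unfolding N_def by linarith+
    ultimately have "subdeg_ge k (l - ?s)" "subdeg_ge k (m - ?s)" using subdeg_ge_mono by blast+
    then have "subdeg_ge k ((l - ?s) - (m - ?s))" by (rule subdeg_ge_diff)
    then show ?thesis by simp
  qed
  then show ?thesis using subdeg_ge_all[of "l - m"] by simp
qed

lemma t_sums_weaken: "t_sums d F l \<Longrightarrow> d \<le> e \<Longrightarrow> t_sums e F l"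
  unfolding t_sums_def by (meson subdeg_ge_mono diff_left_mono of_nat_mono neg_le_iff_le)

lemma t_sums_bound: "t_sums d F l \<Longrightarrow> subdeg_ge (- int d) l"
  unfolding t_sums_def by (drule conjunct2) (drule spec[of _ 0], simp)

lemma t_sums_add: "t_sums d F l \<Longrightarrow> t_sums d G m \<Longrightarrow> t_sums d (F + G) (l + m)"
proof -
  assume a: "t_sums d F l" "t_sums d G m"
  have e: "(l + m) - (\<Sum>n<N. fls_X ^ n * fps_nth (F + G) n) =
    (l - (\<Sum>n<N. fls_X ^ n * fps_nth F n)) + (m - (\<Sum>n<N. fls_X ^ n * fps_nth G n))" for N
    by (simp add: distrib_left sum.distrib)
  show ?thesis unfolding t_sums_def e
    using a unfolding t_sums_def by (auto intro!: subdeg_ge_add)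
qed

lemma t_sums_mult:
  assumes F: "t_sums d F l" and G: "t_sums e G m"
  shows "t_sums (d + e) (F * G) (l * m)"
  unfolding t_sums_def
proof (intro conjI allI)
  have f: "subdeg_ge (- int d) (fps_nth F n)" and g: "subdeg_ge (- int e) (fps_nth G n)" for n
    using F G by (auto simp: t_sums_def)
  show "subdeg_ge (- int (d + e)) (fps_nth (F * G) n)" for n
    unfolding fps_mult_nth using subdeg_ge_mult[OF f g] by (intro subdeg_ge_sum) simp
  fix N :: nat
  let ?lN = "\<Sum>n<N. fls_X ^ n * fps_nth F n" and ?mN = "\<Sum>n<N. fls_X ^ n * fps_nth G n"
  have lN: "subdeg_ge (- int d) ?lN"
  proof (rule subdeg_ge_sum)
    fix n
    have "subdeg_ge (int n + - int d) (fls_X ^ n * fps_nth F n)"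
      by (rule subdeg_ge_mult[OF subdeg_ge_X_power f])
    then show "subdeg_ge (- int d) (fls_X ^ n * fps_nth F n)" by (rule subdeg_ge_mono) simp
  qed
  have 1: "subdeg_ge (int N - int (d + e)) ((l - ?lN) * m)"
    using subdeg_ge_mult[of "int N - int d" "l - ?lN" "- int e" m] F t_sums_bound[OF G]
      unfolding t_sums_def by (simp add: algebra_simps)
  have 2: "subdeg_ge (int N - int (d + e)) (?lN * (m - ?mN))"
    using subdeg_ge_mult[OF lN, of "int N - int e" "m - ?mN"] G unfolding t_sums_def
      by (simp add: algebra_simps)
  let ?h = "\<lambda>i j. fls_X ^ (i + j) * (fps_nth F i * fps_nth G j)"
  have "(\<Sum>n<N. fls_X ^ n * fps_nth (F * G) n) = (\<Sum>n<N. \<Sum>i\<le>n. ?h i (n - i))"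
    by (intro sum.cong refl) (auto simp: fps_mult_nth sum_distrib_left atLeast0AtMost intro!: sum.cong)
  also have "\<dots> = (\<Sum>(i, j)\<in>{(i, j). i + j < N}. ?h i j)" by (rule sum.triangle_reindex[symmetric])
  finally have e1: "(\<Sum>n<N. fls_X ^ n * fps_nth (F * G) n) = (\<Sum>(i, j)\<in>{(i, j). i + j < N}. ?h i j)" .
  have e2: "?lN * ?mN = (\<Sum>(i, j)\<in>{..<N} \<times> {..<N}. ?h i j)"
    unfolding sum_product sum.cartesian_product by (intro sum.cong refl) (auto simp: power_add mult_ac)
  have sub: "{(i, j). i + j < N} \<subseteq> {..<N} \<times> {..<N}" by auto
  \<comment> \<open>What the Cauchy product omits are the pairs with i + j at least N, each of
    valuation at least N - d - e.\<close>
  have e3: "?lN * ?mN - (\<Sum>n<N. fls_X ^ n * fps_nth (F * G) n) =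
    (\<Sum>(i, j)\<in>{..<N} \<times> {..<N} - {(i, j). i + j < N}. ?h i j)"
    unfolding e1 e2 by (subst sum_diff[OF _ sub]) auto
  have 3: "subdeg_ge (int N - int (d + e)) (?lN * ?mN - (\<Sum>n<N. fls_X ^ n * fps_nth (F * G) n))"
    unfolding e3
  proof (rule subdeg_ge_sum)
    fix p assume p: "p \<in> {..<N} \<times> {..<N} - {(i, j). i + j < N}"
    obtain i j where pe: "p = (i, j)" by (cases p)
    have "N \<le> i + j" using p pe by simp
    moreover have "subdeg_ge (int (i + j) + (- int d + - int e)) (?h i j)"
      by (intro subdeg_ge_mult subdeg_ge_X_power f g)
    ultimately show "subdeg_ge (int N - int (d + e)) (case p of (i, j) \<Rightarrow> ?h i j)"
      unfolding pe by (auto elim!: subdeg_ge_mono)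
  qed
  have e0: "l * m - (\<Sum>n<N. fls_X ^ n * fps_nth (F * G) n) =
    (l - ?lN) * m + ?lN * (m - ?mN) + (?lN * ?mN - (\<Sum>n<N. fls_X ^ n * fps_nth (F * G) n))"
    by (simp add: algebra_simps)
  show "subdeg_ge (int N - int (d + e)) (l * m - (\<Sum>n<N. fls_X ^ n * fps_nth (F * G) n))"
    unfolding e0 by (rule subdeg_ge_add[OF subdeg_ge_add[OF 1 2] 3])
qed

lemma t_sums_const: "subdeg_ge (- int d) c \<Longrightarrow> t_sums d (fps_const c) c"
proof -
  assume c: "subdeg_ge (- int d) c"
  have "subdeg_ge (int N - int d) (c - (\<Sum>n<N. fls_X ^ n * fps_nth (fps_const c) n))" for N
  proof (cases N)
    case 0 then show ?thesis using c by simp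
  next
    case (Suc M)
    have "(\<Sum>n<N. fls_X ^ n * fps_nth (fps_const c) n) = (\<Sum>n<N. if n = 0 then c else 0)"
      by (intro sum.cong refl) simp
    also have "\<dots> = c" using Suc by simp
    finally show ?thesis by simp
  qed
  then show ?thesis using c unfolding t_sums_def by simp
qed

lemma t_sums_X: "t_sums 0 fps_X fls_X"
  unfolding t_sums_def
proof (intro conjI allI)
  show "subdeg_ge (- int 0) (fps_nth fps_X n :: 'a fls)" for n by (simp add: fps_X_def subdeg_ge_1)
  fix N
  have v: "subdeg_ge 1 (fls_X :: 'a fls)" by (simp add: subdeg_ge_iff)
  show "subdeg_ge (int N - int 0) (fls_X - (\<Sum>n<N. fls_X ^ n * fps_nth fps_X n) :: 'a fls)"
  proof (cases "N \<le> 1")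
    case True
    then consider "N = 0" | "N = 1" by linarith
    then show ?thesis using v by cases (auto simp: fps_X_def intro: subdeg_ge_mono)
  next
    case False
    have "(\<Sum>n<N. fls_X ^ n * fps_nth fps_X n :: 'a fls) = (\<Sum>n<N. if n = 1 then fls_X else 0)"
      by (intro sum.cong refl) (simp add: fps_X_def)
    also have "\<dots> = fls_X" using False by simp
    finally show ?thesis by simp
  qed
qed

text \<open>The uniform bound on the poles makes every coefficient of the limit a finite sum: only
  \<open>n \<le> k + d\<close> can contribute to the coefficient of t^k.\<close>

lemma t_sums_ex:
  assumes "\<And>n. subdeg_ge (- int d) (fps_nth F n)"
  shows "\<exists>l. t_sums d F l"
proof -
  define c where "c k = (\<Sum>n\<le>nat (k + int d). fls_nth (fps_nth F n) (k - int n))" for k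
  have ext: "(\<Sum>n<N. fls_nth (fps_nth F n) (k - int n)) = c k" if "k + int d < int N" for k N
  proof (cases "k + int d < 0")
    case True
    then have "fls_nth (fps_nth F n) (k - int n) = 0" for n using assms[of n] unfolding subdeg_ge_def by auto
    then show ?thesis by (simp add: c_def)
  next
    case False
    have "fls_nth (fps_nth F n) (k - int n) = 0" if "\<not> n \<le> nat (k + int d)" for n
    proof -
      have "k - int n < - int d" using that False by linarith
      then show ?thesis using assms[of n] by (simp add: subdeg_ge_def)
    qed
    then show ?thesis unfolding c_def
      using that False by (intro sum.mono_neutral_right) auto
  qed
  have c0: "c k = 0" if "k < - int d" for k
    unfolding c_def using assms that by (intro sum.neutral) (auto simp: subdeg_ge_def)
  define l where "l = Abs_fls c"
  have ln: "fls_nth l k = c k" for k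
    unfolding l_def by (rule nth_Abs_fls_lower_bound[of "- int d"]) (use c0 in auto)
  have xn: "fls_nth (fls_X ^ n * f) k = fls_nth f (k - int n)" for n k and f :: "'a fls"
    by (simp add: fls_X_power_times_conv_shift)
  have "subdeg_ge (int N - int d) (l - (\<Sum>n<N. fls_X ^ n * fps_nth F n))" for N
    unfolding subdeg_ge_def by (auto simp: ln fls_nth_sum xn ext)
  then show ?thesis using assms unfolding t_sums_def by blast
qed

section \<open>Comparison with summation in the metric of Laurent series\<close>

lemma dist_fls_subdeg_ge:
  fixes a b :: "'a :: field fls"
  assumes "subdeg_ge (int N) (a - b)" shows "dist a b \<le> inverse (2 ^ N)"
proof (cases "a = b")
  case False
  then have N: "int N \<le> fls_subdegree (a - b)" using assms by (simp add: subdeg_ge_iff)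
  then have "dist a b = inverse (2 ^ nat (fls_subdegree (a - b)))" using False by (simp add: dist_fls_def)
  also have "\<dots> \<le> inverse (2 ^ N)" using N by (intro le_imp_inverse_le power_increasing) auto
  finally show ?thesis .
qed simp

lemma t_sums_has_sum:
  fixes G :: "int \<Rightarrow> 'a :: field fls"
  assumes F: "t_sums d F l" and G: "\<And>n. n < n0 \<Longrightarrow> G n = 0" "\<And>j. G (n0 + int j) = fps_nth F j"
  shows "((\<lambda>n. fls_X_intpow n * G n) has_sum (fls_X_intpow n0 * l)) UNIV"
  unfolding has_sum_def tendsto_iff
proof (intro allI impI)
  fix e :: real assume "e > 0"
  then obtain M where M: "inverse (2 ^ M) < e"
    using real_arch_pow_inv[of e "1/2"] by (auto simp: power_one_over inverse_eq_divide)
  \<comment> \<open>Large enough that the terms from index \<open>n0 + N\<close> on have valuation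
    at least \<open>M\<close>, even after losing \<open>d\<close> to the poles and for negative
    \<open>n0\<close>.\<close>
  define N where "N = nat (int M + int d + \<bar>n0\<bar>)"
  have N: "int M \<le> n0 + (int N - int d)" unfolding N_def by linarith
  have ip: "fls_X_intpow (n0 + int j) = fls_X_intpow n0 * (fls_X ^ j :: 'a fls)" for j
  proof -
    have "fls_X_intpow (n0 + int j) = (fls_X_intpow n0 * fls_X_intpow (int j) :: 'a fls)"
      by (rule fls_X_intpow_times_fls_X_intpow[symmetric])
    then show ?thesis by (simp add: fls_X_power_conv_shift_1)
  qed
  have vip: "subdeg_ge k (fls_X_intpow k :: 'a fls)" for k by (simp add: subdeg_ge_iff)
  let ?I = "(\<lambda>j. n0 + int j) ` {..<N}"
  have sI: "(\<Sum>n\<in>?I. fls_X_intpow n * G n) = fls_X_intpow n0 * (\<Sum>j<N. fls_X ^ j * fps_nth F j)"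
  proof -
    have "(\<Sum>n\<in>?I. fls_X_intpow n * G n) = (\<Sum>j<N. fls_X_intpow (n0 + int j) * G (n0 + int j))"
      by (subst sum.reindex) (auto simp: inj_on_def)
    then show ?thesis unfolding ip G(2) by (simp only: sum_distrib_left mult.assoc)
  qed
  have main: "dist (\<Sum>n\<in>S. fls_X_intpow n * G n) (fls_X_intpow n0 * l) < e" if S: "finite S" "?I \<subseteq> S" for S
  proof -
    have "(\<Sum>n\<in>S. fls_X_intpow n * G n) = (\<Sum>n\<in>S - ?I. fls_X_intpow n * G n) + (\<Sum>n\<in>?I. fls_X_intpow n * G n)"
      using sum.subset_diff[OF S(2,1)] .
    then have e: "(\<Sum>n\<in>S. fls_X_intpow n * G n) - fls_X_intpow n0 * l =
        (\<Sum>n\<in>S - ?I. fls_X_intpow n * G n) - fls_X_intpow n0 * (l - (\<Sum>j<N. fls_X ^ j * fps_nth F j))"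
      unfolding sI by (simp add: algebra_simps)
    have 1: "subdeg_ge (int M) (\<Sum>n\<in>S - ?I. fls_X_intpow n * G n)"
    proof (rule subdeg_ge_sum)
      fix n assume n: "n \<in> S - ?I"
      show "subdeg_ge (int M) (fls_X_intpow n * G n)"
      proof (cases "n < n0")
        case False
        define j where "j = nat (n - n0)"
        have nj: "n = n0 + int j" using False by (simp add: j_def)
        then have jN: "N \<le> j" using n by force
        have "subdeg_ge (n + - int d) (fls_X_intpow n * G n)"
          using F unfolding nj G(2) t_sums_def by (intro subdeg_ge_mult vip) auto
        then show ?thesis by (rule subdeg_ge_mono) (use N nj jN in linarith)
      qed (simp add: G(1))
    qed
    have "subdeg_ge (n0 + (int N - int d)) (fls_X_intpow n0 * (l - (\<Sum>j<N. fls_X ^ j * fps_nth F j)))"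
      using F unfolding t_sums_def by (intro subdeg_ge_mult vip) auto
    then have 2: "subdeg_ge (int M) (fls_X_intpow n0 * (l - (\<Sum>j<N. fls_X ^ j * fps_nth F j)))"
      by (rule subdeg_ge_mono) (rule N)
    show ?thesis using dist_fls_subdeg_ge[of M] subdeg_ge_diff[OF 1 2] M unfolding e[symmetric]
      by (meson order_le_less_trans)
  qed
  show "\<forall>\<^sub>F S in finite_subsets_at_top UNIV. dist (sum (\<lambda>n. fls_X_intpow n * G n) S)
    (fls_X_intpow n0 * l) < e"
    unfolding eventually_finite_subsets_at_top
    by (intro exI[of _ ?I]) (use main in auto)
qed

section \<open>The functional equation\<close>

lemma kc_of_nat: "kc (of_nat n) = of_nat n"
  by (induction n) simp_all

lemma of_nat_K_eq_0_iff: "(of_nat n :: K) = 0 \<longleftrightarrow> n = 0"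
  unfolding of_nat_fract Zero_fract_def by (simp add: eq_fract)

lemma of_nat_L_eq_0_iff: "(of_nat n :: Kr fls) = 0 \<longleftrightarrow> n = 0"
  unfolding kc_of_nat[symmetric] kc_eq_0_iff of_nat_K_eq_0_iff ..

lemma kc_inverse: "kc (inverse c) = inverse (kc c)"
proof (cases "c = 0")
  case False
  then have "kc c * kc (inverse c) = 1" unfolding kc_hom(4)[symmetric] by simp
  then show ?thesis by (rule inverse_unique[symmetric])
qed simp

lemma subdeg_ge_kc: "subdeg_ge 0 (kc c)" by (simp add: kc_def subdeg_ge_const)

text \<open>Rigidity of rooted maps makes this the coefficient of \<open>t\<^sup>e\<close> in \<open>M(x, y)\<close>: the leg has label \<open>0\<close>, and
  the other \<open>2 e\<close> darts can be labelled in \<open>(2 e)!\<close> distinct ways.\<close>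

definition leg_egf :: "Kr fls \<Rightarrow> Kr fls \<Rightarrow> nat \<Rightarrow> Kr fls" where
  "leg_egf x y e = leg_sum x y (2 * e) / of_nat (fact (2 * e))"

definition Mser :: "Kr fls \<Rightarrow> Kr fls \<Rightarrow> Kr fls fps" where
  "Mser x y = Abs_fps (leg_egf x y)"

lemma subdeg_ge_leg_sum: "subdeg_ge 0 x \<Longrightarrow> subdeg_ge 0 y \<Longrightarrow> subdeg_ge 0 (leg_sum x y n)"
  unfolding leg_sum_def leg_weight_def by (intro subdeg_ge_sum subdeg_ge_mult_0 subdeg_ge_power subdeg_ge_kc)

lemma subdeg_ge_leg_egf: "subdeg_ge 0 x \<Longrightarrow> subdeg_ge 0 y \<Longrightarrow> subdeg_ge 0 (leg_egf x y n)"
  unfolding leg_egf_def divide_inverse kc_of_nat[symmetric] kc_inverse[symmetric]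
  by (intro subdeg_ge_mult_0 subdeg_ge_leg_sum subdeg_ge_kc)

text \<open>Euler's relation in the form of \<open>planar\<close> makes the number of darts that are
  not legs even.\<close>

lemma leg_sum_odd: assumes "odd n" shows "leg_sum x y n = 0"
proof -
  have "legged {0} {0..n} = {}"
  proof (rule ccontr)
    assume "legged {0} {0..n} \<noteq> {}"
    then obtain \<sigma> \<alpha> where m: "(\<sigma>, \<alpha>) \<in> legged {0} {0..n}" by auto
    note l = leggedD[OF m]
    have "{x \<in> {0..n}. \<alpha> x \<noteq> x} = {1..n}" using l(5) by auto
    then have "nonfix \<alpha> {0..n} = n" by (simp add: nonfix_def)
    then have "n + 4 = 2 * (cyc \<sigma> {0..n} + cyc (\<sigma> \<circ> \<alpha>) {0..n})" using l(7) by (simp add: planar_def)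
    then have "even (n + 4)" by (metis dvd_triv_left)
    then have "even n" by simp
    then show False using assms by simp
  qed
  then show ?thesis by (simp add: leg_sum_def)
qed

text \<open>Odd indices drop out, and the binomial coefficients turn the factorials of the parts
  into that of the whole; the labelled product becomes a Cauchy product.\<close>

lemma binom_conv_leg_egf:
  "binom_conv (2 * e) (leg_sum x y) (leg_sum x' y') = of_nat (fact (2 * e)) * fps_nth
    (Mser x y * Mser x' y') e"
proof -
  let ?f = "\<lambda>k. of_nat (2 * e choose k) * (leg_sum x y k * leg_sum x' y' (2 * e - k))"
  have "binom_conv (2 * e) (leg_sum x y) (leg_sum x' y') = (\<Sum>k\<in>(\<lambda>j. 2 * j) ` {..e}. ?f k)"
    unfolding binom_conv_def
  proof (rule sum.mono_neutral_right)
    show "\<forall>k\<in>{..2 * e} - (\<lambda>j. 2 * j) ` {..e}. ?f k = 0"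
    proof
      fix k assume k: "k \<in> {..2 * e} - (\<lambda>j. 2 * j) ` {..e}"
      have "odd k" using k by (auto elim!: evenE)
      then show "?f k = 0" by (simp add: leg_sum_odd)
    qed
  qed auto
  also have "\<dots> = (\<Sum>j\<le>e. ?f (2 * j))" by (subst sum.reindex) (auto simp: inj_on_def)
  also have "\<dots> = (\<Sum>j\<le>e. of_nat (fact (2 * e)) * (leg_egf x y j * leg_egf x' y' (e - j)))"
  proof (rule sum.cong[OF refl])
    fix j assume "j \<in> {..e}"
    then have j: "2 * j \<le> 2 * e" by simp
    have "fact (2 * j) * fact (2 * e - 2 * j) * (2 * e choose 2 * j) = (fact (2 * e) :: nat)"
      by (rule binomial_fact_lemma[OF j])
    then have "(of_nat (fact (2 * j)) * of_nat (fact (2 * e - 2 * j)) * of_nat (2 * e choose 2 * j) ::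
      Kr fls) = of_nat (fact (2 * e))"
      unfolding of_nat_mult[symmetric] by simp
    moreover have "(of_nat (fact (2 * j)) :: Kr fls) \<noteq> 0" "(of_nat (fact (2 * e - 2 * j)) :: Kr fls) \<noteq> 0"
      unfolding of_nat_L_eq_0_iff by auto
    moreover have "2 * (e - j) = 2 * e - 2 * j" by simp
    ultimately show "?f (2 * j) = of_nat (fact (2 * e)) * (leg_egf x y j * leg_egf x' y' (e - j))"
      unfolding leg_egf_def by (simp add: field_simps del: of_nat_fact)
  qed
  finally show ?thesis by (simp add: Mser_def fps_mult_nth sum_distrib_left atLeast0AtMost)
qed

lemma leg_egf_0: "leg_egf x y 0 = 1" by (simp add: leg_egf_def leg_sum_0)

lemma leg_egf_Suc: "of_nat (2 * e + 1) * of_nat (fact (2 * e)) * leg_egf x y (Suc e) =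
  root_sum x y (2 * e + 2)"
proof -
  have "fact (2 * e + 2) = (2 * e + 2) * ((2 * e + 1) * fact (2 * e) :: nat)"
    by (simp add: algebra_simps)
  then have "(of_nat (fact (2 * e + 2)) :: Kr fls) = of_nat (2 * e + 2) *
    (of_nat (2 * e + 1) * of_nat (fact (2 * e)))"
    by (metis of_nat_mult)
  moreover have "leg_sum x y (2 * e + 2) = of_nat (2 * e + 2) * root_sum x y (2 * e + 2)"
    by (rule leg_sum_root_sum) simp
  moreover have "2 * Suc e = 2 * e + 2" by simp
  moreover have "(of_nat (2 * e + 2) :: Kr fls) \<noteq> 0" "(of_nat (2 * e + 1) :: Kr fls) \<noteq> 0"
    "(of_nat (fact (2 * e)) :: Kr fls) \<noteq> 0"
    unfolding of_nat_L_eq_0_iff by auto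
  ultimately show ?thesis unfolding leg_egf_def by (simp add: field_simps del: of_nat_fact of_nat_add
    of_nat_mult of_nat_Suc)
qed

text \<open>Here \<open>fps_X\<close> marks edges and is independent of the t that may occur inside
  x and y. Each coefficient is an instance of \<open>root_sum_recursion\<close>, which has no
  denominators and thus holds for all x and y.\<close>

lemma functional_equation_fps:
  "fps_const ((x - 1) * (y - 1)) * (Mser x y - 1) = fps_X *
     (fps_const ((x - 1) * (y - 1) * (x * y ^ 2 * kc (wK * qK)
       + kc (nuK - 1) * ((x * y ^ 2 - x * y) * kc wK))) * (Mser x y * Mser 1 y)
      + fps_const ((x - 1) * (y - 1) * ((x ^ 2 * y - x * y) + kc (nuK - 1) * (x ^ 2 * y))) *
        (Mser x y * Mser x 1)
      + fps_const ((x - 1) * (x * y)) * (fps_const y * Mser x y - Mser x 1)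
      + fps_const (kc (nuK - 1) * (y - 1) * (kc wK * x * y)) * (fps_const x * Mser x y - Mser 1 y))"
  (is "?L = fps_X * ?R")
proof (rule fps_ext)
  fix n
  show "fps_nth ?L n = fps_nth (fps_X * ?R) n"
  proof (cases n)
    case 0
    then show ?thesis by (simp add: Mser_def leg_egf_0)
  next
    case (Suc e)
    \<comment> \<open>The factor 2e + 1 comes from the partners of the root in the recursion with N
      = 2e, the factor (2e)! from the binomial convolutions.\<close>
    define c where "c = (of_nat (2 * e + 1) * of_nat (fact (2 * e)) :: Kr fls)"
    define g where "g = (of_nat (fact (2 * e)) :: Kr fls)"
    have c0: "c \<noteq> 0" unfolding c_def of_nat_mult[symmetric] of_nat_L_eq_0_iff by simp
    have g0: "g \<noteq> 0" unfolding g_def of_nat_L_eq_0_iff by simp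
    have leg_sum: "leg_sum x' y' (2 * e) = g * leg_egf x' y' e" for x' y'
      using g0 unfolding leg_egf_def g_def by (simp del: of_nat_fact)
    let ?C = "fps_nth (Mser x y * Mser 1 y) e" and ?D = "fps_nth (Mser x y * Mser x 1) e"
    have r: "fps_nth ?R e = (x - 1) * (y - 1) * (x * y ^ 2 * kc (wK * qK)
      + kc (nuK - 1) * ((x * y ^ 2 - x * y) * kc wK)) * ?C
      + (x - 1) * (y - 1) * ((x ^ 2 * y - x * y) + kc (nuK - 1) * (x ^ 2 * y)) * ?D
      + (x - 1) * (x * y) * (y * leg_egf x y e - leg_egf x 1 e)
      + kc (nuK - 1) * (y - 1) * (kc wK * x * y) * (x * leg_egf x y e - leg_egf 1 y e)"
      by (simp only: fps_add_nth fps_mult_left_const_nth fps_sub_nth Mser_def fps_nth_Abs_fps)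
    have "c * fps_nth ?L (Suc e) = (x - 1) * (y - 1) * (c * leg_egf x y (Suc e))"
      by (simp add: Mser_def)
    also have "\<dots> = (x - 1) * (y - 1) * root_sum x y (2 * e + 2)" unfolding c_def leg_egf_Suc ..
    also have "\<dots> = c * fps_nth ?R e"
      unfolding root_sum_recursion binom_conv_leg_egf leg_sum r c_def g_def[symmetric] by algebra
    finally have "fps_nth ?L (Suc e) = fps_nth ?R e" using c0 by simp
    then show ?thesis using Suc by simp
  qed
qed

lemma Mser_t_sums_ex:
  assumes "subdeg_ge 0 x" "subdeg_ge 0 y" shows "\<exists>M. t_sums 0 (Mser x y) M"
  using subdeg_ge_leg_egf[OF assms] by (intro t_sums_ex) (simp add: Mser_def)

lemma tconv0:
  "t_sums 0 F l \<Longrightarrow> t_sums 0 G m \<Longrightarrow> t_sums 0 (F * G) (l * m)"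
  "t_sums 0 F l \<Longrightarrow> t_sums 0 G m \<Longrightarrow> t_sums 0 (F + G) (l + m)"
  "subdeg_ge 0 c \<Longrightarrow> t_sums 0 (fps_const c) c"
  using t_sums_mult[of 0 F l 0 G m] t_sums_add[of 0 F l G m] t_sums_const[of 0 c] by simp_all

lemma tconv0_diff: "t_sums 0 F l \<Longrightarrow> t_sums 0 G m \<Longrightarrow> t_sums 0 (F - G) (l - m)"
proof -
  assume a: "t_sums 0 F l" "t_sums 0 G m"
  have m: "t_sums 0 (fps_const (- 1)) (- 1 :: 'a fls)" by (rule tconv0(3))
    (rule subdeg_ge_uminus[OF subdeg_ge_1])
  have "t_sums 0 (F + fps_const (- 1) * G) (l + - 1 * m)" by (rule tconv0(2)[OF a(1) tconv0(1)[OF m a(2)]])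
  moreover have "fps_const (- 1) * G = - G" by (rule fps_ext) simp
  ultimately show ?thesis by simp
qed

text \<open>Both sides are limits of one and the same power series when its variable is set to t,
  and such limits are unique.\<close>

lemma functional_equation:
  assumes v: "subdeg_ge 0 x" "subdeg_ge 0 y"
    and M: "t_sums 0 (Mser x y) M" and A: "t_sums 0 (Mser 1 y) A" and B: "t_sums 0 (Mser x 1) B"
  shows "(x - 1) * (y - 1) * (M - 1) = fls_X *
     ((x - 1) * (y - 1) * (x * y ^ 2 * kc (wK * qK) + kc (nuK - 1) * ((x * y ^ 2 - x * y) * kc wK)) * (M * A)
      + (x - 1) * (y - 1) * ((x ^ 2 * y - x * y) + kc (nuK - 1) * (x ^ 2 * y)) * (M * B)
      + (x - 1) * (x * y) * (y * M - B)
      + kc (nuK - 1) * (y - 1) * (kc wK * x * y) * (x * M - A))"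
proof -
  have 1: "t_sums 0 (1 :: Kr fls fps) 1" using tconv0(3)[of 1] subdeg_ge_1 by simp
  note vs = subdeg_ge_mult_0 subdeg_ge_add subdeg_ge_diff subdeg_ge_power subdeg_ge_kc subdeg_ge_1 v
  show ?thesis
    by (rule t_sums_unique[OF _ _, of 0 "fps_const ((x - 1) * (y - 1)) * (Mser x y - 1)" _ 0])
      (intro tconv0_diff tconv0 1 M vs, unfold functional_equation_fps,
        intro tconv0_diff tconv0 1 M A B t_sums_X vs)
qed

section \<open>Evaluating coefficients and series\<close>

lemma map_poly_kc_hom:
  "map_poly kc (p + q) = map_poly kc p + map_poly kc q"
  "map_poly kc (p * q) = map_poly kc p * map_poly kc q"
proof -
  have s: "kc (sum f S) = (\<Sum>i\<in>S. kc (f i))" for f :: "nat \<Rightarrow> K" and S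
    by (induction S rule: infinite_finite_induct) simp_all
  show "map_poly kc (p + q) = map_poly kc p + map_poly kc q"
    "map_poly kc (p * q) = map_poly kc p * map_poly kc q"
    by (rule poly_eqI, simp add: coeff_map_poly coeff_mult s)+
qed

lemma peval_hom: "peval (p + q) Y = peval p Y + peval q Y" "peval (p * q) Y = peval p Y * peval q Y"
  by (simp_all add: peval_def map_poly_kc_hom)

lemma peval_simps [simp]: "peval 0 Y = 0" "peval 1 Y = 1" "peval [:c:] Y = kc c" "peval [:0, 1:] Y = Y"
  by (simp_all add: peval_def map_poly_pCons one_pCons)

lemma peval_monom: "peval (monom c n) Y = kc c * Y ^ n"
  by (simp add: peval_def map_poly_monom poly_monom)

lemma peval_sum: "peval (sum f S) Y = (\<Sum>i\<in>S. peval (f i) Y)"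
  by (induction S rule: infinite_finite_induct) (simp_all add: peval_hom)

lemma peval_power: "peval (p ^ n) Y = peval p Y ^ n"
  by (induction n) (simp_all add: peval_hom)

lemma subdeg_ge_peval: "subdeg_ge 0 Y \<Longrightarrow> subdeg_ge 0 (peval p Y)"
proof (induction p)
  case (pCons c p)
  have "pCons c p = [:c:] + [:0, 1:] * p" by simp
  then have "peval (pCons c p) Y = kc c + Y * peval p Y" by (metis peval_hom peval_simps(3,4))
  then show ?case using pCons by (auto intro: subdeg_ge_add subdeg_ge_mult_0 subdeg_ge_kc)
qed simp

lemma rat_eval_Fract:
  assumes "b \<noteq> 0" "peval b Y \<noteq> 0"
  shows "rat_eval (Fract a b) Y = peval a Y / peval b Y"
  unfolding rat_eval_def
proof (rule some_equality)
  show "\<exists>a' b'. b' \<noteq> 0 \<and> Fract a b = Fract a' b' \<and> peval b' Y \<noteq> 0 \<and>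
      peval a Y / peval b Y = peval a' Y / peval b' Y" using assms by blast
next
  fix z assume "\<exists>a' b'. b' \<noteq> 0 \<and> Fract a b = Fract a' b' \<and> peval b' Y \<noteq> 0 \<and>
      z = peval a' Y / peval b' Y"
  then obtain a' b' where *: "b' \<noteq> 0" "Fract a b = Fract a' b'" "peval b' Y \<noteq> 0"
    "z = peval a' Y / peval b' Y" by blast
  have "a * b' = a' * b" using * assms by (simp add: eq_fract)
  then have "peval a Y * peval b' Y = peval a' Y * peval b Y" by (metis peval_hom(2))
  then show "z = peval a Y / peval b Y"
    unfolding *(4) frac_eq_eq[OF *(3) assms(2)] by simp
qed

lemma rat_eval_poly: "rat_eval (Fract p 1) Y = peval p Y"
  using rat_eval_Fract[of 1 Y p] by simp

section \<open>The coefficients of M in the statement as labelled sums\<close>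

lemma potts_pottsK: "Fract [:potts e m:] 1 = pottsK (darts e) m"
proof -
  have c: "colourings e m n = colset (darts e) (vertex_rel (darts e) (fst m)) n" for n
    by (auto simp: colourings_def colset_def vertex_rel_def)
  have "mono_edges e m c = monochr (darts e) (snd m) c" for c
    by (simp add: mono_edges_def monochr_def)
  then have "potts e m = (THE P. represents P (colour_sum (darts e) (vertex_rel (darts e) (fst m)) (snd m)))"
    unfolding potts_def represents_def eval_q_def colour_sum_def c by simp
  then show ?thesis by (simp add: pottsK_def interpK_def toK_def)
qed

lemma map_weight_vweight: "map_weight e m = vweight (darts e) m (pottsK (darts e) m)"
  by (simp add: map_weight_def vweight_def potts_pottsK nverts_def cyc_def)

text \<open>The (2e - 1)! labellings of a rooted map and the 2e corners at which the leg can be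
  attached cancel against (2e)!.\<close>

lemma rooted_sum_leg_egf:
  assumes "e \<ge> 1"
  shows "(\<Sum>C\<in>rooted_maps e. let m = (SOME m. m \<in> C) in kc (map_weight e m) * x ^ root_vdeg m * y ^
    root_fdeg m) = leg_egf x y e"
proof -
  have D: "darts e = {0..<2 * e}" "finite (darts e)" by (simp_all add: darts_def)
  let ?g = "\<lambda>m. root_weight x y (darts e) 0 m"
  have g: "?g m = kc (map_weight e m) * x ^ root_vdeg m * y ^ root_fdeg m" for m
    by (simp add: root_weight_def map_weight_vweight vdeg_def fdeg_def root_vdeg_def root_fdeg_def)
  have "?g (relab_map \<pi> m) = ?g m" if "bij \<pi>" "\<pi> ` darts e = darts e" "\<pi> 0 = 0"
    "m \<in> legged {} (darts e)" for \<pi> m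
    using relab_map_invariants[OF that(1,4) D(2), unfolded that(2)]
      relab_map_invariants(3,4)[OF that(1,4) D(2), of 0, unfolded that(3)]
    by (simp add: root_weight_def)
  from rooted_maps_sum[OF assms this]
  have s: "root_sum x y (2 * e) = of_nat (fact (2 * e - 1)) * (\<Sum>C\<in>rooted_maps e. ?g (SOME m. m \<in> C))"
    unfolding root_sum_def D(1)[symmetric] .
  have "fact (2 * e) = 2 * e * (fact (2 * e - 1) :: nat)"
    using fact_reduce[of "2 * e", where 'a = nat] assms by simp
  then have f: "(of_nat (fact (2 * e)) :: Kr fls) = of_nat (2 * e) * of_nat (fact (2 * e - 1))"
    by (metis of_nat_mult)
  have "(of_nat (2 * e) :: Kr fls) \<noteq> 0" "(of_nat (fact (2 * e - 1)) :: Kr fls) \<noteq> 0"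
    unfolding of_nat_L_eq_0_iff using assms by auto
  moreover have "leg_sum x y (2 * e) = of_nat (2 * e) * root_sum x y (2 * e)"
    by (rule leg_sum_root_sum) (use assms in simp)
  ultimately have "leg_egf x y e = (\<Sum>C\<in>rooted_maps e. ?g (SOME m. m \<in> C))"
    unfolding leg_egf_def s f by (simp del: of_nat_fact of_nat_mult)
  then show ?thesis unfolding g Let_def by simp
qed

lemma peval_M_coeff: "peval (M1y_coeff e) y = leg_egf 1 y e" "peval (Mx1_coeff e) x = leg_egf x 1 e"
proof -
  show "peval (M1y_coeff e) y = leg_egf 1 y e"
    using rooted_sum_leg_egf[of e 1 y] unfolding M1y_coeff_def
      by (auto simp: peval_sum peval_monom leg_egf_0 Let_def)
  show "peval (Mx1_coeff e) x = leg_egf x 1 e"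
    using rooted_sum_leg_egf[of e x 1] unfolding Mx1_coeff_def
      by (auto simp: peval_sum peval_monom leg_egf_0 Let_def)
qed

lemma rat_eval_0: "rat_eval 0 Y = 0"
  using rat_eval_poly[of 0 Y] by (simp add: Zero_fract_def)

lemma subst_t_sums:
  assumes F: "t_sums d F l" and H: "\<And>n. n < n0 \<Longrightarrow> fls_nth H n = 0"
    and HF: "\<And>j. rat_eval (fls_nth H (n0 + int j)) Y = fps_nth F j"
  shows "subst_terms H Y summable_on UNIV" "subst H Y = fls_X_intpow n0 * l"
proof -
  have "((\<lambda>n. fls_X_intpow n * rat_eval (fls_nth H n) Y) has_sum (fls_X_intpow n0 * l)) UNIV"
    by (rule t_sums_has_sum[OF F]) (simp_all add: H HF rat_eval_0)
  then have h: "(subst_terms H Y has_sum (fls_X_intpow n0 * l)) UNIV"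
    by (simp only: subst_terms_def)
  show "subst_terms H Y summable_on UNIV" using h summable_on_def by blast
  show "subst H Y = fls_X_intpow n0 * l" unfolding subst_def using h by (rule infsumI)
qed

lemma subst_M:
  "t_sums 0 (Mser 1 y) A \<Longrightarrow> subst M1y y = A"
  "t_sums 0 (Mser x 1) B \<Longrightarrow> subst Mx1 x = B"
proof -
  show "subst M1y y = A" if "t_sums 0 (Mser 1 y) A"
    using subst_t_sums(2)[OF that, of 0 M1y y] by (simp add: M1y_def rat_eval_poly peval_M_coeff Mser_def)
  show "subst Mx1 x = B" if "t_sums 0 (Mser x 1) B"
    using subst_t_sums(2)[OF that, of 0 Mx1 x] by (simp add: Mx1_def rat_eval_poly peval_M_coeff Mser_def)
qed

lemma Kr_0_1: "(0 :: Kr) = Fract 0 1" "(1 :: Kr) = Fract 1 1"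
  by (rule Zero_fract_def, rule One_fract_def)

lemma cK_hom: "cK (a + b) = cK a + cK b" "cK (a * b) = cK a * cK b" "cK 0 = 0" "cK 1 = 1"
proof -
  show "cK (a + b) = cK a + cK b" by (simp add: cK_def)
  show "cK (a * b) = cK a * cK b" by (simp add: cK_def mult.commute)
  show "cK 0 = 0" by (simp add: cK_def Kr_0_1)
  have "[:1 :: K:] = 1" by (simp only: one_pCons)
  then show "cK 1 = 1" unfolding cK_def Kr_0_1 by (simp only:)
qed

lemma cK_eq_iff: "cK a = cK b \<longleftrightarrow> a = b"
  by (simp add: cK_def eq_fract)

lemma cK_0_iff: "cK a = 0 \<longleftrightarrow> a = 0"
  using cK_eq_iff[of a 0] by (simp add: cK_hom)

lemma zK_neq_cK: "zK \<noteq> cK c"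
  by (simp add: zK_def cK_def eq_fract)

lemma zK_neq [simp]: "zK \<noteq> 0" "zK \<noteq> 1"
  using zK_neq_cK[of 0] zK_neq_cK[of 1] by (simp_all add: cK_hom)

lemma wnu_nonzero: "wK * (nuK - 1) \<noteq> 0"
proof -
  have "nuK \<noteq> 1" by (simp add: nuK_def One_fract_def eq_fract one_pCons)
  moreover have "wK \<noteq> 0" by (simp add: wK_def Zero_fract_def eq_fract)
  ultimately show ?thesis by simp
qed

section \<open>Invariance of I under the kernel\<close>

abbreviation (input) "Xs \<equiv> 1 + fls_X * fls_const zK"

text \<open>The value of I at \<open>Y\<close>, where \<open>A\<close> stands for M(1, Y).\<close>

definition Ival :: "Kr fls \<Rightarrow> Kr fls \<Rightarrow> Kr fls" where
  "Ival A Y = kc (wK * qK) * Y * fls_X * A + (Y - 1) / Y + fls_X * (Y / (Y - 1))"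

lemma subdeg_ge_Xs: "subdeg_ge 0 Xs"
  by (intro subdeg_ge_add subdeg_ge_1 subdeg_ge_mult_0 subdeg_ge_const) (simp add: subdeg_ge_iff)

lemma Xs_minus_1: "Xs - 1 = fls_X * fls_const zK" "Xs - 1 \<noteq> 0" "Xs \<noteq> 0"
proof -
  show "Xs - 1 = fls_X * fls_const zK" by simp
  have "fls_const zK \<noteq> 0" using zK_neq by (metis fls_const_nth fls_zero_nth)
  then show "Xs - 1 \<noteq> 0" by simp
  have "fls_nth Xs 0 = 1" by (simp add: fls_X_times_conv_shift)
  then show "Xs \<noteq> 0" by (metis fls_zero_nth zero_neq_one)
qed

text \<open>The right-hand side does not depend on the root \<open>Y\<close> of the kernel.\<close>

lemma kernel_root_invariant:
  assumes v: "subdeg_ge 0 Y" and Y: "Y \<noteq> 0" "Y \<noteq> 1" and k: "kernel Xs Y = 0"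
    and A: "t_sums 0 (Mser 1 Y) A" and B: "t_sums 0 (Mser Xs 1) B"
  shows "Xs * Ival A Y = 1 - Xs ^ 2 * kc wK * kc (nuK - 1) * (fls_X / (Xs - 1))
     - Xs * fls_X * (Xs * kc nuK - 1) * B + (Xs - 1) * Xs * fls_X * B"
proof -
  obtain M where M: "t_sums 0 (Mser Xs Y) M" using Mser_t_sums_ex[OF subdeg_ge_Xs v] by blast
  define x where "x = Xs"
  define n w q t where "n = kc nuK" and "w = kc wK" and "q = kc qK" and "t = (fls_X :: Kr fls)"
  have x: "x - 1 \<noteq> 0" "x \<noteq> 0" using Xs_minus_1 by (auto simp: x_def)
  have y: "Y - 1 \<noteq> 0" using Y by simp
  have fe: "(x - 1) * (Y - 1) * (M - 1) = t *
     ((x - 1) * (Y - 1) * (x * Y ^ 2 * (w * q) + (n - 1) * ((x * Y ^ 2 - x * Y) * w)) * (M * A)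
      + (x - 1) * (Y - 1) * ((x ^ 2 * Y - x * Y) + (n - 1) * (x ^ 2 * Y)) * (M * B)
      + (x - 1) * (x * Y) * (Y * M - B)
      + (n - 1) * (Y - 1) * (w * x * Y) * (x * M - A))"
    using functional_equation[OF subdeg_ge_Xs v M A B] unfolding x_def n_def w_def q_def t_def by simp
  have ke: "1 - x^2 * Y * w * t * (n - 1) / (x - 1) - x * Y^2 * t / (Y - 1)
     - x * Y * t * (x * n - 1) * B - x * Y * w * t * ((n - 1) * (Y - 1) + q * Y) * A = 0"
    using k unfolding kernel_def subst_M(1)[OF A] subst_M(2)[OF B]
      unfolding x_def[symmetric] n_def w_def q_def t_def .
  define h1 h2 where "h1 = x^2 * Y * w * t * (n - 1) / (x - 1)" and "h2 = x * Y^2 * t / (Y - 1)"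
  have h: "(x - 1) * h1 = x^2 * Y * w * t * (n - 1)" "(Y - 1) * h2 = x * Y^2 * t"
    unfolding h1_def h2_def using x y by simp_all
  \<comment> \<open>The kernel equation multiplied by (x - 1)(Y - 1). The left-hand side is exactly
    the coefficient of \<open>M\<close> in the functional equation \<open>fe\<close>.\<close>
  have E2: "(x - 1) * (Y - 1) - x^2 * Y * w * t * (n - 1) * (Y - 1) - x * Y^2 * t * (x - 1)
     - (x - 1) * (Y - 1) * (x * Y * t * (x * n - 1) * B)
       - (x - 1) * (Y - 1) * (x * Y * w * t * ((n - 1) * (Y - 1) + q * Y) * A) = 0"
    using ke[folded h1_def h2_def] h by algebra
  \<comment> \<open>What is left of \<open>fe\<close> once the multiple of \<open>M\<close> has
    vanished.\<close>
  have E1: "(x - 1) * (Y - 1) = t * (x - 1) * (x * Y) * B + t * (n - 1) * (Y - 1) * (w * x * Y) * A"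
    using fe E2 by algebra
  define D where "D = Y * (Y - 1) * (x - 1)"
  have D: "D \<noteq> 0" using x y Y by (simp add: D_def)
  define g1 g2 g3 where "g1 = (Y - 1) / Y" and "g2 = Y / (Y - 1)" and "g3 = t / (x - 1)"
  have g: "Y * g1 = Y - 1" "(Y - 1) * g2 = Y" "(x - 1) * g3 = t"
    unfolding g1_def g2_def g3_def using x y Y by simp_all
  \<comment> \<open>With denominators cleared by \<open>D\<close>, the equations \<open>E1\<close>
    and \<open>E2\<close> suffice to eliminate \<open>A\<close> from x I(Y); afterwards
    \<open>Y\<close> occurs only in the common factor \<open>D\<close>.\<close>
  have "D * (x * (w * q * Y * t * A + g1 + t * g2)) =
      x * (x - 1) * (w * q * t * Y ^ 2 * A * (Y - 1) + (Y - 1) ^ 2 + t * Y ^ 2)"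
    unfolding D_def using g(1,2) by algebra
  also have "\<dots> = Y * (Y - 1) * (x - 1) * (1 - x * t * (x * n - 1) * B + (x - 1) * x * t * B)
    - Y * (Y - 1) * x ^ 2 * w * (n - 1) * t"
    using E1 E2 by algebra
  also have "\<dots> = D * (1 - x ^ 2 * w * (n - 1) * g3 - x * t * (x * n - 1) * B + (x - 1) * x * t * B)"
  proof -
    have "Y * (Y - 1) * x ^ 2 * w * (n - 1) * t = D * (x ^ 2 * w * (n - 1) * g3)"
      unfolding D_def g(3)[symmetric] by (simp only: mult_ac)
    moreover have "D * (1 - p + r) - D * q = D * (1 - q - p + r)" for p q r :: "Kr fls"
      by (simp add: algebra_simps)
    ultimately show ?thesis unfolding D_def[symmetric] by (simp only:)
  qed
  finally have "x * (w * q * Y * t * A + g1 + t * g2) =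
     1 - x ^ 2 * w * (n - 1) * g3 - x * t * (x * n - 1) * B + (x - 1) * x * t * B"
    using D by simp
  then show ?thesis
    unfolding g1_def g2_def g3_def Ival_def x_def[symmetric]
      unfolding n_def w_def q_def t_def kc_hom kc_diff .
qed

section \<open>Rational functions with a bounded pole at 1\<close>

definition pole_bd :: "nat \<Rightarrow> Kr \<Rightarrow> bool" where
  "pole_bd d r \<longleftrightarrow> (\<exists>a b. poly b 1 \<noteq> 0 \<and> r = Fract a (b * [:-1, 1:] ^ d))"

definition pole1 :: Kr where "pole1 = Fract 1 [:-1, 1:]"

lemma pole_bd_poly: "pole_bd 0 (Fract p 1)"
  unfolding pole_bd_def by (rule exI[of _ p], rule exI[of _ 1]) simp

lemma pole_bd_Suc: "pole_bd d r \<Longrightarrow> pole_bd (Suc d) r"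
proof -
  assume "pole_bd d r"
  then obtain a b where *: "poly b 1 \<noteq> 0" "r = Fract a (b * [:-1, 1:] ^ d)"
    unfolding pole_bd_def by blast
  have b: "b \<noteq> 0" using * by auto
  have c: "Fract a (b * D ^ d) = Fract (a * D) (b * D ^ Suc d)" if "D \<noteq> 0" for D :: "K poly"
    using that b by (simp add: eq_fract mult_ac)
  have "r = Fract (a * [:-1, 1:]) (b * [:-1, 1:] ^ Suc d)"
    unfolding *(2) by (rule c) simp
  then show ?thesis unfolding pole_bd_def using * by blast
qed

lemma pole_bd_mono: "pole_bd d r \<Longrightarrow> d \<le> e \<Longrightarrow> pole_bd e r"
  by (induction e) (auto simp: le_Suc_eq intro: pole_bd_Suc)

lemma pole_bd_mult: "pole_bd d r \<Longrightarrow> pole_bd e s \<Longrightarrow> pole_bd (d + e) (r * s)"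
proof -
  assume "pole_bd d r" "pole_bd e s"
  then obtain a b a' b' where *: "poly b 1 \<noteq> 0" "r = Fract a (b * [:-1, 1:] ^ d)"
    "poly b' 1 \<noteq> 0" "s = Fract a' (b' * [:-1, 1:] ^ e)"
    unfolding pole_bd_def by blast
  have "r * s = Fract (a * a') ((b * b') * [:-1, 1:] ^ (d + e))"
    unfolding * mult_fract power_add by (simp only: mult_ac)
  moreover have "poly (b * b') 1 \<noteq> 0" using * by simp
  ultimately show ?thesis unfolding pole_bd_def by blast
qed

lemma pole_bd_add: "pole_bd d r \<Longrightarrow> pole_bd d s \<Longrightarrow> pole_bd d (r + s)"
proof -
  assume "pole_bd d r" "pole_bd d s"
  then obtain a b a' b' where *: "poly b 1 \<noteq> 0" "r = Fract a (b * [:-1, 1:] ^ d)"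
    "poly b' 1 \<noteq> 0" "s = Fract a' (b' * [:-1, 1:] ^ d)"
    unfolding pole_bd_def by blast
  have nz: "b \<noteq> 0" "b' \<noteq> 0" using * by auto
  have "r + s = Fract (a * b' + a' * b) ((b * b') * [:-1, 1:] ^ d)"
    unfolding * using nz by (simp add: eq_fract algebra_simps)
  moreover have "poly (b * b') 1 \<noteq> 0" using * by simp
  ultimately show ?thesis unfolding pole_bd_def by blast
qed

lemma pole_bd_cK: "pole_bd 0 (cK c)" unfolding cK_def by (rule pole_bd_poly)

lemma pole_bd_0: "pole_bd d 0"
  using pole_bd_mono[OF pole_bd_cK[of 0], of d] by (simp add: cK_hom)

lemma pole_bd_sum: "(\<And>i. i \<in> S \<Longrightarrow> pole_bd d (f i)) \<Longrightarrow> pole_bd d (sum f S)"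
  by (induction S rule: infinite_finite_induct) (auto intro: pole_bd_add pole_bd_0)

lemma pole_bd_pole1: "pole_bd 1 pole1"
  unfolding pole_bd_def pole1_def by (rule exI[of _ 1], rule exI[of _ 1]) simp

lemma pole1_power: "pole1 ^ d = Fract 1 ([:-1, 1:] ^ d)"
  unfolding pole1_def by (induction d) (simp_all add: One_fract_def)

text \<open>The constant is the quotient a(1) / b(1) of numerator and cofactor at 1: subtracting it
  makes the numerator vanish at 1, so one factor y - 1 cancels. It lies in K because both
  polynomials have coefficients there.\<close>

lemma pole_bd_leading:
  assumes "pole_bd (Suc d) r"
  shows "\<exists>c. pole_bd d (r - cK c * pole1 ^ Suc d)"
proof -
  obtain a b where *: "poly b 1 \<noteq> 0" "r = Fract a (b * [:-1, 1:] ^ Suc d)"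
    using assms unfolding pole_bd_def by blast
  define c where "c = poly a 1 / poly b 1"
  have "poly (a - [:c:] * b) 1 = 0" using * by (simp add: c_def)
  then obtain k where k: "a - [:c:] * b = [:-1, 1:] * k" by (metis dvdE poly_eq_0_iff_dvd)
  have nz: "b \<noteq> 0" using * by auto
  have e1: "Fract a (b * D) - Fract c' 1 * Fract 1 D =
      Fract (a - c' * b) (b * D)" if "D \<noteq> 0" for c' D :: "K poly"
    using that nz by (simp add: eq_fract algebra_simps)
  have e2: "Fract (D * k) (b * D ^ Suc d) = Fract k (b * D ^ d)" if "D \<noteq> 0" for D :: "K poly"
    using that nz by (simp add: eq_fract mult_ac)
  have "r - cK c * pole1 ^ Suc d = Fract (a - [:c:] * b) (b * [:-1, 1:] ^ Suc d)"
    unfolding *(2) pole1_power cK_def by (rule e1[OF power_not_zero]) simp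
  also have "\<dots> = Fract k (b * [:-1, 1:] ^ d)"
    unfolding k by (rule e2) simp
  finally show ?thesis unfolding pole_bd_def using * by blast
qed

definition polefps :: "nat \<Rightarrow> Kr fps \<Rightarrow> bool" where
  "polefps d h \<longleftrightarrow> (\<forall>n. pole_bd d (fps_nth h n))"

lemma polefps_mono: "polefps d h \<Longrightarrow> d \<le> e \<Longrightarrow> polefps e h"
  unfolding polefps_def using pole_bd_mono by blast

lemma polefps_add: "polefps d h \<Longrightarrow> polefps d g \<Longrightarrow> polefps d (h + g)"
  unfolding polefps_def by (simp add: pole_bd_add)

lemma polefps_mult: "polefps d h \<Longrightarrow> polefps e g \<Longrightarrow> polefps (d + e) (h * g)"
  unfolding polefps_def fps_mult_nth by (auto intro!: pole_bd_sum pole_bd_mult)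

lemma polefps_mult': "polefps 0 h \<Longrightarrow> polefps e g \<Longrightarrow> polefps e (h * g)"
  using polefps_mult[of 0 h e g] by simp

lemma polefps_const: "pole_bd d c \<Longrightarrow> polefps d (fps_const c)"
  unfolding polefps_def by (simp add: pole_bd_0)

lemma polefps_X: "polefps 0 fps_X"
  unfolding polefps_def fps_X_def using pole_bd_cK[of 1] by (simp add: cK_hom pole_bd_0)

lemma polefps_X_power: "polefps 0 (fps_X ^ n)"
proof (induction n)
  case 0
  have "fps_const (1 :: Kr) = 1" by simp
  then show ?case using polefps_const[OF pole_bd_cK[of 1]] by (simp add: cK_hom)
qed (auto intro: polefps_mult' polefps_X)

definition Mfps :: "Kr fps" where "Mfps = Abs_fps (\<lambda>e. Fract (M1y_coeff e) 1)"

definition Ifps :: "Kr fps" where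
  "Ifps = fps_const (cK wK * cK qK * zK) * fps_X * Mfps + fps_const ((zK - 1) / zK)
    + fps_X * fps_const (zK / (zK - 1))"

lemma Iinv_Ifps: "Iinv = fps_to_fls Ifps"
  unfolding Iinv_def Ifps_def M1y_def Mfps_def
  by (simp add: fls_times_fps_to_fls fps_to_fls_plus)

text \<open>The coefficients of M(1, y) are polynomials and (y - 1)/y is regular at 1, so the only
  pole comes from t y/(y - 1) = t + t/(y - 1).\<close>

lemma Ifps_split: "\<exists>J. polefps 0 J \<and> Ifps = fps_const pole1 * fps_X + J"
proof -
  define J where "J = fps_const (cK wK * cK qK * zK) * fps_X * Mfps + fps_const ((zK - 1) / zK) + fps_X"
  have zm: "zK - 1 = Fract [:-1, 1:] 1"
    unfolding zK_def Kr_0_1 by (simp add: one_pCons)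
  have "pole1 * (zK - 1) = 1" unfolding zm pole1_def by (simp add: Kr_0_1 eq_fract)
  then have z: "zK / (zK - 1) = 1 + pole1"
    using zK_neq(2) by (simp add: divide_eq_eq algebra_simps)
  have "Ifps = fps_const pole1 * fps_X + J"
  proof -
    have "fps_const (1 + pole1) = 1 + fps_const pole1" by (simp flip: fps_const_add)
    moreover have "T + c + X * (1 + P) = P * X + (T + c + X)" for T c X P :: "Kr fps"
      by (simp add: algebra_simps)
    ultimately show ?thesis unfolding Ifps_def J_def z by (simp only:)
  qed
  moreover have "polefps 0 J"
  proof -
    have 1: "pole_bd 0 (cK wK * cK qK * zK)"
      using pole_bd_mult[OF pole_bd_mult[OF pole_bd_cK pole_bd_cK] pole_bd_poly[of "[:0, 1:]"]]
        by (simp add: zK_def)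
    have "(zK - 1) / zK = Fract [:-1, 1:] ([:0, 1:] * [:-1, 1:] ^ 0)"
      unfolding zm unfolding zK_def by simp
    moreover have "poly [:0, 1 :: K:] 1 \<noteq> 0" by simp
    ultimately have 2: "pole_bd 0 ((zK - 1) / zK)" unfolding pole_bd_def by blast
    have 3: "polefps 0 Mfps" unfolding polefps_def Mfps_def by (simp add: pole_bd_poly)
    show ?thesis unfolding J_def
      by (intro polefps_add polefps_mult' polefps_const 1 2 3 polefps_X)
  qed
  ultimately show ?thesis by blast
qed

text \<open>The top pole of a power of I is the power of t/(y - 1); every mixed term with the
  regular part has a smaller pole order.\<close>

lemma Ifps_power: "\<exists>R. polefps d R \<and> Ifps ^ Suc d = fps_const (pole1 ^ Suc d) * fps_X ^ Suc d + R"
proof -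
  obtain J where J: "polefps 0 J" "Ifps = fps_const pole1 * fps_X + J" using Ifps_split by blast
  have p1: "polefps 1 (fps_const pole1 * fps_X)"
    using polefps_mult[OF polefps_const[OF pole_bd_pole1] polefps_X] by simp
  have I: "polefps 1 Ifps" unfolding J(2) by (rule polefps_add[OF p1 polefps_mono[OF J(1)]]) simp
  show ?thesis
  proof (induction d)
    case 0
    then show ?case using J by auto
  next
    case (Suc d)
    then obtain R where R: "polefps d R" "Ifps ^ Suc d = fps_const (pole1 ^ Suc d) * fps_X ^ Suc d + R"
      by blast
    let ?p = "fps_const (pole1 ^ Suc d) * fps_X ^ Suc d"
    have "Ifps ^ Suc (Suc d) = Ifps * (?p + R)" unfolding R(2)[symmetric] by simp
    also have "\<dots> = (fps_const pole1 * fps_X) * ?p + (J * ?p + Ifps * R)"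
      unfolding distrib_left by (subst (1) J(2)) (simp add: distrib_right)
    also have "(fps_const pole1 * fps_X) * ?p = fps_const (pole1 ^ Suc (Suc d)) * fps_X ^ Suc (Suc d)"
      by (simp add: mult_ac flip: fps_const_mult)
    finally have e: "Ifps ^ Suc (Suc d) = fps_const (pole1 ^ Suc (Suc d)) * fps_X ^ Suc (Suc d)
      + (J * ?p + Ifps * R)" .
    have "pole_bd k (pole1 ^ k)" for k
    proof (induction k)
      case 0 show ?case using pole_bd_cK[of 1] by (simp add: cK_hom)
    next
      case (Suc k) show ?case using pole_bd_mult[OF pole_bd_pole1 Suc] by simp
    qed
    then have "polefps (Suc d) (fps_const (pole1 ^ Suc d))" by (intro polefps_const)
    from polefps_mult[OF this polefps_X_power[of "Suc d"]] have "polefps (Suc d) ?p" by simp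
    then have "polefps (Suc d) (J * ?p)" by (rule polefps_mult'[OF J(1)])
    moreover have "polefps (Suc d) (Ifps * R)" using polefps_mult[OF I R(1)] by simp
    ultimately show ?case using e polefps_add by blast
  qed
qed

text \<open>What both kernel roots have in common: no nonzero polynomial over K vanishes at
  \<open>Y\<close>, denominators that are nonzero at 1 do not lower the valuation, and a factor 1/(y
  - 1) lowers it by at most one.\<close>

locale evalpt =
  fixes Y :: "Kr fls"
  assumes v: "subdeg_ge 0 Y"
    and nz: "\<And>b. b \<noteq> 0 \<Longrightarrow> peval b Y \<noteq> 0"
    and unit: "\<And>b. poly b 1 \<noteq> 0 \<Longrightarrow> subdeg_ge 0 (inverse (peval b Y))"
    and pole: "subdeg_ge (- 1) (inverse (Y - 1))"
begin

text \<open>Only the coefficients are evaluated. The series variable stays formal until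
  \<open>t_sums\<close> replaces it by t, since the values themselves involve t.\<close>

definition fmap :: "Kr fps \<Rightarrow> Kr fls fps" where
  "fmap h = Abs_fps (\<lambda>n. rat_eval (fps_nth h n) Y)"

lemma ev_Fract: "b \<noteq> 0 \<Longrightarrow> rat_eval (Fract a b) Y = peval a Y / peval b Y"
  using nz rat_eval_Fract by blast

lemma ev_add: "rat_eval (r + s) Y = rat_eval r Y + rat_eval s Y"
proof (cases r rule: Fract_cases_nonzero; cases s rule: Fract_cases_nonzero)
  fix a b a' b' assume "r = Fract a b" "b \<noteq> 0" "s = Fract a' b'" "b' \<noteq> 0"
  then show ?thesis using nz by (simp add: ev_Fract peval_hom add_frac_eq)
qed (simp_all add: rat_eval_0)

lemma ev_mult: "rat_eval (r * s) Y = rat_eval r Y * rat_eval s Y"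
proof (cases r rule: Fract_cases_nonzero; cases s rule: Fract_cases_nonzero)
  fix a b a' b' assume "r = Fract a b" "b \<noteq> 0" "s = Fract a' b'" "b' \<noteq> 0"
  then show ?thesis by (simp add: ev_Fract peval_hom)
qed (simp_all add: rat_eval_0)

lemma ev_cK: "rat_eval (cK c) Y = kc c"
  by (simp add: cK_def rat_eval_poly)

lemma ev_1: "rat_eval 1 Y = 1"
  using ev_cK[of 1] by (simp add: cK_hom)

lemma ev_zK: "rat_eval zK Y = Y"
  by (simp add: zK_def rat_eval_poly)

lemma ev_sum: "rat_eval (sum f S) Y = (\<Sum>i\<in>S. rat_eval (f i) Y)"
  by (induction S rule: infinite_finite_induct) (simp_all add: ev_add rat_eval_0)

lemma fmap_hom:
  "fmap (h + g) = fmap h + fmap g" "fmap (h * g) = fmap h * fmap g"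
  "fmap (fps_const c) = fps_const (rat_eval c Y)" "fmap fps_X = fps_X" "fmap 1 = 1"
  by (rule fps_ext, simp add: fmap_def fps_mult_nth ev_add ev_mult ev_sum ev_1 fps_X_def rat_eval_0)+

lemma fmap_power: "fmap (h ^ n) = fmap h ^ n"
  by (induction n) (simp_all add: fmap_hom)

lemma fmap_minus: "fmap (h - g) = fmap h - fmap g"
  using fmap_hom(1)[of "h - g" g] by simp

lemma ev_pole_bd: assumes "pole_bd d r" shows "subdeg_ge (- int d) (rat_eval r Y)"
proof -
  obtain a b where *: "poly b 1 \<noteq> 0" "r = Fract a (b * [:-1, 1:] ^ d)"
    using assms unfolding pole_bd_def by blast
  have "b \<noteq> 0" using * by auto
  then have "b * [:-1, 1:] ^ d \<noteq> 0" by simp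
  have e: "[:-1, 1:] = [:-1:] + [:0, 1 :: K:]" by simp
  have "kc (- 1) = - 1" using kc_diff[of 0 1] by simp
  then have p: "peval [:-1, 1:] Y = Y - 1" unfolding e by (simp only: peval_hom peval_simps) simp
  have r: "rat_eval r Y = peval a Y * inverse (peval b Y) * inverse (Y - 1) ^ d"
    unfolding *(2) ev_Fract[OF \<open>b * [:-1, 1:] ^ d \<noteq> 0\<close>] peval_hom peval_power
    by (simp only: p divide_inverse inverse_mult_distrib power_inverse mult.assoc)
  have "subdeg_ge (- int k) (inverse (Y - 1) ^ k)" for k
  proof (induction k)
    case (Suc k)
    have "- 1 + - int k = - int (Suc k)" by simp
    then show ?case using subdeg_ge_mult[OF pole Suc] by (simp only: power_Suc)
  qed (simp add: subdeg_ge_1)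
  from subdeg_ge_mult[OF subdeg_ge_mult_0[OF subdeg_ge_peval[OF v, of a] unit[OF *(1)]] this[of d]]
  show ?thesis unfolding r by simp
qed

lemma fmap_t_sums_ex: "polefps d h \<Longrightarrow> \<exists>l. t_sums d (fmap h) l"
  unfolding polefps_def by (intro t_sums_ex) (simp add: fmap_def ev_pole_bd)

lemma subst_pole_bd:
  assumes "\<And>n. pole_bd d (fls_nth H n)"
  shows "subst_wd H Y"
    and "t_sums d (fmap (Abs_fps (\<lambda>j. fls_nth H (fls_subdegree H + int j)))) l \<Longrightarrow>
      subst H Y = fls_X_intpow (fls_subdegree H) * l"
proof -
  let ?h = "Abs_fps (\<lambda>j. fls_nth H (fls_subdegree H + int j))"
  have h: "polefps d ?h" using assms by (simp add: polefps_def)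
  have s: "subst_terms H Y summable_on UNIV" "subst H Y = fls_X_intpow (fls_subdegree H) * l"
    if "t_sums d (fmap ?h) l" for l
    using subst_t_sums[OF that, of "fls_subdegree H" H Y] by (simp_all add: fmap_def)
  have "\<exists>a b. b \<noteq> 0 \<and> fls_nth H n = Fract a b \<and> peval b Y \<noteq> 0" for n
  proof -
    obtain a b where *: "poly b 1 \<noteq> 0" "fls_nth H n = Fract a (b * [:-1, 1:] ^ d)"
      using assms[of n] unfolding pole_bd_def by blast
    have "b \<noteq> 0" using * by auto
    then have "b * [:-1, 1:] ^ d \<noteq> 0" by simp
    then show ?thesis using *(2) nz by blast
  qed
  then show "subst_wd H Y" unfolding subst_wd_def using s(1) fmap_t_sums_ex[OF h] by blast
  show "t_sums d (fmap ?h) l \<Longrightarrow> subst H Y = fls_X_intpow (fls_subdegree H) * l" using s(2) .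
qed

lemma Ifps_value:
  assumes A: "t_sums 0 (Mser 1 Y) A" shows "t_sums 1 (fmap Ifps) (Ival A Y)"
proof -
  have z: "zK \<noteq> 0" "zK - 1 \<noteq> 0" using zK_neq by auto
  have d1: "rat_eval ((zK - 1) / zK) Y * Y = Y - 1"
  proof -
    have "rat_eval ((zK - 1) / zK) Y * Y + 1 = rat_eval ((zK - 1) / zK * zK + 1) Y"
      unfolding ev_add ev_mult ev_zK ev_1 ..
    also have "(zK - 1) / zK * zK + 1 = zK" using z by simp
    finally show ?thesis unfolding ev_zK by (simp add: algebra_simps)
  qed
  have d2: "rat_eval (zK / (zK - 1)) Y * (Y - 1) = Y"
  proof -
    have "rat_eval (zK / (zK - 1)) Y * (Y - 1) = rat_eval (zK / (zK - 1)) Y * Y - rat_eval (zK / (zK - 1)) Y"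
      by (simp add: algebra_simps)
    moreover have "rat_eval (zK / (zK - 1)) Y * Y = rat_eval (zK / (zK - 1) * zK) Y"
      unfolding ev_mult ev_zK ..
    moreover have "zK / (zK - 1) * zK = zK + zK / (zK - 1)" using z by (simp add: field_simps)
    ultimately show ?thesis by (simp add: ev_add ev_zK)
  qed
  have Y: "Y \<noteq> 0" "Y - 1 \<noteq> 0"
  proof -
    show "Y \<noteq> 0" using nz[of "[:0, 1:]"] by simp
    then show "Y - 1 \<noteq> 0" using d2 by auto
  qed
  have e: "rat_eval ((zK - 1) / zK) Y = (Y - 1) / Y" "rat_eval (zK / (zK - 1)) Y = Y / (Y - 1)"
    using d1 d2 Y by (simp_all add: eq_divide_eq)
  have m: "fmap Mfps = Mser 1 Y"
    by (rule fps_ext) (simp add: fmap_def Mfps_def Mser_def rat_eval_poly peval_M_coeff)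
  have "subdeg_ge 0 (inverse Y)" using unit[of "[:0, 1:]"] by simp
  then have v1: "subdeg_ge 0 ((Y - 1) / Y)" unfolding divide_inverse
    by (intro subdeg_ge_mult_0 subdeg_ge_diff v subdeg_ge_1)
  have v2: "subdeg_ge (- 1) (Y / (Y - 1))" unfolding divide_inverse using subdeg_ge_mult[OF v pole] by simp
  have 1: "t_sums 0 (fps_const (kc (wK * qK) * Y) * fps_X * Mser 1 Y) (kc (wK * qK) * Y * fls_X * A)"
    by (intro tconv0(1) t_sums_X A tconv0(3) subdeg_ge_mult_0 subdeg_ge_kc v)
  have 2: "t_sums 0 (fps_const ((Y - 1) / Y)) ((Y - 1) / Y)" by (rule tconv0(3)[OF v1])
  have 3: "t_sums 1 (fps_X * fps_const (Y / (Y - 1))) (fls_X * (Y / (Y - 1)))"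
    using t_sums_mult[OF t_sums_X t_sums_const[of 1 "Y / (Y - 1)"]] v2 by simp
  have "fmap Ifps = fps_const (kc (wK * qK) * Y) * fps_X * Mser 1 Y + fps_const ((Y - 1) / Y)
    + fps_X * fps_const (Y / (Y - 1))"
    unfolding Ifps_def fmap_hom m ev_mult ev_cK ev_zK e kc_hom ..
  then show ?thesis unfolding Ival_def
    using t_sums_add[OF t_sums_weaken[OF tconv0(2)[OF 1 2], of 1] 3] by simp
qed

end

section \<open>The kernel roots as evaluation points\<close>

lemma subdeg_ge_0_fps: assumes "subdeg_ge 0 f" obtains F where "f = fps_to_fls F"
proof
  show "f = fps_to_fls (Abs_fps (\<lambda>n. fls_nth f (int n)))"
    by (rule fls_eqI) (use assms in \<open>auto simp: subdeg_ge_def\<close>)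
qed

lemma coeff0_mult:
  fixes f g :: "'a :: field fls"
  assumes "subdeg_ge 0 f" "subdeg_ge 0 g" shows "fls_nth (f * g) 0 = fls_nth f 0 * fls_nth g 0"
proof -
  obtain F G where "f = fps_to_fls F" "g = fps_to_fls G" using assms subdeg_ge_0_fps by metis
  then show ?thesis by (simp flip: fls_times_fps_to_fls)
qed

lemma coeff0_kc: "fls_nth (kc c) 0 = cK c" by (simp add: kc_def)

lemma coeff0_peval: "subdeg_ge 0 Y \<Longrightarrow> fls_nth (peval p Y) 0 = poly (map_poly cK p) (fls_nth Y 0)"
proof (induction p)
  case (pCons c p)
  have "pCons c p = [:c:] + [:0, 1:] * p" by simp
  then have e: "peval (pCons c p) Y = kc c + Y * peval p Y" by (simp only: peval_hom peval_simps)
  have m: "map_poly cK (pCons c p) = pCons (cK c) (map_poly cK p)"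
    by (rule poly_eqI) (simp add: coeff_map_poly cK_hom coeff_pCons split: nat.split)
  show ?case unfolding e m using pCons coeff0_mult[OF pCons(3) subdeg_ge_peval[OF pCons(3)]]
    by (simp add: coeff0_kc)
qed simp

lemma fls_subdegree_0I: "subdeg_ge 0 f \<Longrightarrow> fls_nth f 0 \<noteq> 0 \<Longrightarrow> fls_subdegree f = 0"
  by (rule fls_subdegree_eqI) (auto simp: subdeg_ge_def)

lemma subdeg_ge_inverse:
  fixes f :: "'a :: field fls"
  assumes "fls_subdegree f = k" shows "subdeg_ge (- k) (inverse f)"
  using assms by (cases "f = 0") (simp_all add: subdeg_ge_iff)

lemma poly_cK_1: "poly (map_poly cK p) 1 = cK (poly p 1)"
proof (induction p)
  case (pCons c p)
  have "map_poly cK (pCons c p) = pCons (cK c) (map_poly cK p)"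
    by (rule poly_eqI) (simp add: coeff_map_poly cK_hom coeff_pCons split: nat.split)
  then show ?case using pCons by (simp add: cK_hom)
qed (simp add: cK_hom)

text \<open>Evaluating at s/c amounts to composing with a polynomial of degree 1, which sends no
  nonzero polynomial to 0. In this form the transcendence of s/c over K is used.\<close>

lemma poly_cK_scaled: "poly (map_poly cK p) (zK / cK c) = Fract (pcompose p [:0, 1 / c:]) 1" if "c \<noteq> 0"
proof -
  have z: "zK / cK c = Fract [:0, 1 / c:] 1"
    unfolding zK_def cK_def using that by (simp add: eq_fract)
  show ?thesis
  proof (induction p)
    case 0 then show ?case by (simp add: Kr_0_1)
  next
    case (pCons k p)
    have "map_poly cK (pCons k p) = pCons (cK k) (map_poly cK p)"
      by (rule poly_eqI) (simp add: coeff_map_poly cK_hom coeff_pCons split: nat.split)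
    then have "poly (map_poly cK (pCons k p)) (zK / cK c) =
      cK k + zK / cK c * Fract (pcompose p [:0, 1 / c:]) 1"
      using pCons.IH by simp
    also have "\<dots> = Fract (pcompose (pCons k p) [:0, 1 / c:]) 1"
      unfolding z unfolding cK_def by (simp add: pcompose_pCons)
    finally show ?case .
  qed
qed

text \<open>Modulo t, a polynomial takes its value at 1, so it is a unit unless it vanishes there.
  In general the power of y - 1 dividing it is split off, and Y - 1 is nonzero.\<close>

lemma evalpt_near_1:
  assumes v: "subdeg_ge 0 Y" and Y0: "fls_nth Y 0 = 1" and d: "fls_subdegree (Y - 1) = 1"
  shows "evalpt Y"
proof
  show "subdeg_ge 0 Y" by (rule v)
  have y: "Y - 1 \<noteq> 0" using d by auto
  have u: "peval b Y \<noteq> 0" "fls_subdegree (peval b Y) = 0" if "poly b 1 \<noteq> 0" for b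
  proof -
    have "fls_nth (peval b Y) 0 \<noteq> 0"
      using that coeff0_peval[OF v, of b] Y0 poly_cK_1 cK_0_iff by simp
    then show "peval b Y \<noteq> 0" "fls_subdegree (peval b Y) = 0"
      using fls_subdegree_0I[OF subdeg_ge_peval[OF v]] by auto
  qed
  show "subdeg_ge 0 (inverse (peval b Y))" if "poly b 1 \<noteq> 0" for b
    using subdeg_ge_inverse[OF u(2)[OF that]] by simp
  show "subdeg_ge (- 1) (inverse (Y - 1))" by (rule subdeg_ge_inverse[OF d])
  show "peval b Y \<noteq> 0" if b: "b \<noteq> 0" for b
  proof -
    obtain q where q: "b = [:- 1, 1:] ^ order 1 b * q" "\<not> [:- 1, 1:] dvd q"
      using order_decomp[OF b, of 1] by auto
    have "poly q 1 \<noteq> 0" using q(2) by (simp add: poly_eq_0_iff_dvd)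
    have e: "[:-1, 1:] = [:-1:] + [:0, 1 :: K:]" by simp
    have "kc (- 1) = - 1" using kc_diff[of 0 1] by simp
    then have p: "peval [:-1, 1:] Y = Y - 1" unfolding e by (simp only: peval_hom peval_simps) simp
    have "peval b Y = (Y - 1) ^ order 1 b * peval q Y"
      by (subst q(1)) (simp only: peval_hom peval_power p)
    then show ?thesis using u(1)[OF \<open>poly q 1 \<noteq> 0\<close>] y by simp
  qed
qed

text \<open>The constant term s/c is transcendental over K, so every nonzero polynomial, y - 1
  included, takes a value with nonzero constant term.\<close>

lemma evalpt_transcendental:
  assumes v: "subdeg_ge 0 Y" and c: "c \<noteq> 0" and Y0: "fls_nth Y 0 = zK / cK c"
  shows "evalpt Y"
proof
  show "subdeg_ge 0 Y" by (rule v)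
  have u: "peval b Y \<noteq> 0" "fls_subdegree (peval b Y) = 0" if "b \<noteq> 0" for b
  proof -
    have "pcompose b [:0, 1 / c:] \<noteq> 0" using that c by (simp add: pcompose_eq_0_iff)
    then have "fls_nth (peval b Y) 0 \<noteq> 0"
      using coeff0_peval[OF v, of b] Y0 poly_cK_scaled[OF c, of b] by (simp add: Kr_0_1 eq_fract)
    then show "peval b Y \<noteq> 0" "fls_subdegree (peval b Y) = 0"
      using fls_subdegree_0I[OF subdeg_ge_peval[OF v]] by auto
  qed
  show "peval b Y \<noteq> 0" if "b \<noteq> 0" for b using u(1)[OF that] .
  show "subdeg_ge 0 (inverse (peval b Y))" if "poly b 1 \<noteq> 0" for b
    using subdeg_ge_inverse[OF u(2), of b] that by force
  have "zK / cK c \<noteq> 1" using zK_neq_cK[of c] c cK_0_iff by auto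
  then have "fls_nth (Y - 1) 0 \<noteq> 0" using Y0 by simp
  then have "fls_subdegree (Y - 1) = 0" by (intro fls_subdegree_0I subdeg_ge_diff v subdeg_ge_1)
  from subdeg_ge_inverse[OF this] have "subdeg_ge 0 (inverse (Y - 1))" by simp
  then show "subdeg_ge (- 1) (inverse (Y - 1))" by (rule subdeg_ge_mono) simp
qed

text \<open>Apart from its term with denominator Y - 1, the kernel has constant coefficient 1 -
  w(\<nu> - 1)/s, which is not 0. The kernel equation forces x Y^2 t/(Y - 1) to have the same
  constant coefficient, so Y - 1 has the valuation of t.\<close>

lemma kernel_root_near_1:
  assumes v: "subdeg_ge 0 Y" and Y0: "fls_nth Y 0 = 1" and k: "kernel Xs Y = 0"
  shows "fls_subdegree (Y - 1) = 1"
proof -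
  obtain A where A: "t_sums 0 (Mser 1 Y) A" using Mser_t_sums_ex[OF subdeg_ge_1 v] by blast
  obtain B where B: "t_sums 0 (Mser Xs 1) B" using Mser_t_sums_ex[OF subdeg_ge_Xs subdeg_ge_1] by blast
  have vAB: "subdeg_ge 0 A" "subdeg_ge 0 B" using t_sums_bound[OF A] t_sums_bound[OF B] by simp_all
  define x where "x = Xs"
  have vx: "subdeg_ge 0 x" "fls_nth x 0 = 1" unfolding x_def using subdeg_ge_Xs
    by (simp_all add: fls_X_times_conv_shift)
  define c where "c = wK * (nuK - 1)"
  \<comment> \<open>At x = 1 + ts the quotient t/(x - 1) equals 1/s, so the first fraction of the
    kernel has no pole at t = 0.\<close>
  define p where "p = fls_const (inverse zK)"
  have vp: "subdeg_ge 0 p" unfolding p_def by (rule subdeg_ge_const)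
  have xm: "x - 1 = fls_X * fls_const zK" unfolding x_def by simp
  have p: "fls_X = p * (x - 1)"
    unfolding xm p_def using zK_neq by (simp add: mult.left_commute[of "fls_const (inverse zK)"]
      fls_const_mult_const)
  have x0: "x - 1 \<noteq> 0" using Xs_minus_1 x_def by simp
  define Q where "Q = x * Y * (x * kc nuK - 1) * B + x * Y * kc wK * ((kc nuK - 1) * (Y - 1) + kc qK * Y) * A"
  define R where "R = 1 - x^2 * Y * kc c * p - fls_X * Q"
  note vs = subdeg_ge_mult_0 subdeg_ge_add subdeg_ge_diff subdeg_ge_power subdeg_ge_kc subdeg_ge_1 v
    vx(1) vAB vp
  have vQ: "subdeg_ge 0 Q" unfolding Q_def by (intro vs)
  have vX: "subdeg_ge 0 (fls_X :: Kr fls)" by (simp add: subdeg_ge_iff)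
  have vR: "subdeg_ge 0 R" unfolding R_def by (intro vs vQ vX)
  have "fls_nth (x * x * Y * kc c * p) 0 = fls_nth x 0 * fls_nth x 0 * fls_nth Y 0 * fls_nth (kc c) 0 *
    fls_nth p 0"
    by (simp only: coeff0_mult subdeg_ge_mult_0 subdeg_ge_kc v vx(1) vp)
  then have "fls_nth (x^2 * Y * kc c * p) 0 = cK c * inverse zK"
    unfolding power2_eq_square vx(2) Y0 coeff0_kc by (simp add: p_def)
  moreover have "fls_nth (fls_X * Q) 0 = 0" unfolding coeff0_mult[OF vX vQ] by simp
  ultimately have "fls_nth R 0 = 1 - cK c * inverse zK"
    unfolding R_def by (simp only: fls_minus_nth fls_one_nth) simp
  moreover have "cK c * inverse zK \<noteq> 1"
  proof
    assume "cK c * inverse zK = 1"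
    then have "cK c = zK" using zK_neq(1) by (metis divide_inverse eq_divide_imp mult_1 nonzero_divide_eq_eq)
    then show False using zK_neq_cK[of c] by simp
  qed
  ultimately have R0: "fls_nth R 0 \<noteq> 0" by simp
  have sR: "fls_subdegree R = 0" by (rule fls_subdegree_0I[OF vR R0])
  have "x^2 * Y * kc wK * fls_X * (kc nuK - 1) / (x - 1) = x^2 * Y * kc c * p"
    unfolding c_def kc_hom kc_diff by (subst p) (use x0 in simp)
  then have k': "1 - x^2 * Y * kc c * p - x * Y^2 * fls_X / (Y - 1) - x * Y * fls_X * (x * kc nuK - 1) * B
      - x * Y * kc wK * fls_X * ((kc nuK - 1) * (Y - 1) + kc qK * Y) * A = 0"
    using k unfolding kernel_def subst_M(1)[OF A] subst_M(2)[OF B] unfolding x_def[symmetric] by simp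
  define h where "h = x * Y^2 * fls_X / (Y - 1)"
  have "R - h = 0"
    using k'[folded h_def] unfolding R_def Q_def by algebra
  then have "R - x * Y^2 * fls_X / (Y - 1) = 0" unfolding h_def .
  then have e: "x * Y^2 * fls_X / (Y - 1) = R" by simp
  have Y1: "Y - 1 \<noteq> 0" using e R0 by auto
  have eq: "x * Y^2 * fls_X = R * (Y - 1)" using e Y1 by (metis nonzero_divide_eq_eq)
  have nz: "x \<noteq> 0" "Y \<noteq> 0" "R \<noteq> 0" using vx Y0 R0 by auto
  have "fls_subdegree x = 0" "fls_subdegree Y = 0" using fls_subdegree_0I[OF vx(1)]
    fls_subdegree_0I[OF v] vx(2) Y0 by simp_all
  then have "fls_subdegree (x * Y^2 * fls_X) = 1" using nz by (simp add: power2_eq_square)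
  moreover have "fls_subdegree (R * (Y - 1)) = fls_subdegree (Y - 1)" using nz Y1 sR by simp
  ultimately show ?thesis using eq by simp
qed

section \<open>Removing poles\<close>

lemma embK_nth: "fls_nth (embK_fls A) n = cK (fls_nth A n)"
  unfolding embK_fls_def
proof (rule nth_Abs_fls_lower_bound[of "fls_subdegree A"])
  show "\<forall>n<fls_subdegree A. cK (fls_nth A n) = 0" by (simp add: cK_hom)
qed

lemma embK_shift: "fls_X_intpow k * embK_fls A = embK_fls (fls_X_intpow k * A)"
  by (rule fls_eqI) (simp only: fls_X_intpow_times_conv_shift fls_shift_nth embK_nth)

text \<open>Modulo t the value at \<open>Y1\<close> is r(1), an element of K, and the value at
  \<open>Y2\<close> is r(s/c). Equality makes the numerator of r - r(1) vanish at a transcendental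
  element, hence identically.\<close>

lemma invariant_regular_constant:
  assumes E1: "evalpt Y1" and E2: "evalpt Y2"
    and Y1: "fls_nth Y1 0 = 1" and c: "c \<noteq> 0" and Y2: "fls_nth Y2 0 = zK / cK c"
    and r: "pole_bd 0 r" and e: "fls_nth (rat_eval r Y1) 0 = fls_nth (rat_eval r Y2) 0"
  shows "\<exists>k. r = cK k"
proof -
  interpret A: evalpt Y1 by (rule E1)
  interpret B: evalpt Y2 by (rule E2)
  obtain a b where *: "poly b 1 \<noteq> 0" "r = Fract a b"
    using r unfolding pole_bd_def by auto
  have b: "b \<noteq> 0" using * by auto
  have q: "fls_nth (rat_eval r Y) 0 * poly (map_poly cK b) (fls_nth Y 0) = poly (map_poly cK a) (fls_nth Y 0)"
    if "evalpt Y" for Y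
  proof -
    interpret evalpt Y by (rule that)
    have "rat_eval r Y * peval b Y = peval a Y" unfolding *(2) ev_Fract[OF b] using nz[OF b] by simp
    moreover have "subdeg_ge 0 (rat_eval r Y)" using ev_pole_bd[OF r] by simp
    ultimately show ?thesis using coeff0_mult[OF _ subdeg_ge_peval[OF v]] coeff0_peval[OF v] by metis
  qed
  define k where "k = poly a 1 / poly b 1"
  have "fls_nth (rat_eval r Y1) 0 * cK (poly b 1) = cK (poly a 1)"
    using q[OF E1] unfolding Y1 poly_cK_1 .
  moreover have "cK k * cK (poly b 1) = cK (poly a 1)" using * by (simp add: k_def flip: cK_hom)
  moreover have "cK (poly b 1) \<noteq> 0" using * cK_0_iff by simp
  ultimately have "fls_nth (rat_eval r Y1) 0 = cK k" by (metis mult_right_cancel)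
  then have "cK k * Fract (pcompose b [:0, 1 / c:]) 1 = Fract (pcompose a [:0, 1 / c:]) 1"
    using q[OF E2] e unfolding Y2 poly_cK_scaled[OF c] by simp
  then have "smult k (pcompose b [:0, 1 / c:]) = pcompose a [:0, 1 / c:]"
    unfolding cK_def by (simp add: eq_fract)
  then have "pcompose (smult k b - a) [:0, 1 / c:] = 0" by (simp add: pcompose_diff pcompose_smult)
  then have "smult k b - a = 0" using c by (simp add: pcompose_eq_0_iff)
  then have "a = [:k:] * b" by simp
  then have "r = cK k" unfolding *(2) cK_def using b by (simp add: eq_fract)
  then show ?thesis by blast
qed

text \<open>The coefficients below \<open>n\<close> are constants by induction and evaluate alike at
  both points. Modulo t^(n+1) the two expansions of \<open>l\<close> then differ only by t^n times
  the difference of the values of coefficient \<open>n\<close>, whose constant term must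
  vanish.\<close>

lemma invariant_no_pole:
  assumes E1: "evalpt Y1" and E2: "evalpt Y2"
    and Y1: "fls_nth Y1 0 = 1" and c: "c \<noteq> 0" and Y2: "fls_nth Y2 0 = zK / cK c"
    and h: "polefps 0 h" and l: "t_sums 0 (evalpt.fmap Y1 h) l" "t_sums 0 (evalpt.fmap Y2 h) l"
  shows "\<exists>k. fps_nth h n = cK k"
proof (induction n rule: less_induct)
  case (less n)
  interpret A: evalpt Y1 by (rule E1)
  interpret B: evalpt Y2 by (rule E2)
  let ?F = "\<lambda>i. fps_nth (A.fmap h) i" and ?G = "\<lambda>i. fps_nth (B.fmap h) i"
  have FG: "?F i = ?G i" if i: "i < n" for i
  proof -
    obtain k where "fps_nth h i = cK k" using less[OF i] by blast
    then show ?thesis by (simp add: A.fmap_def B.fmap_def A.ev_cK B.ev_cK)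
  qed
  have "subdeg_ge (int (Suc n) - int 0) (l - (\<Sum>i<Suc n. fls_X ^ i * ?G i))"
    "subdeg_ge (int (Suc n) - int 0) (l - (\<Sum>i<Suc n. fls_X ^ i * ?F i))"
    using l unfolding t_sums_def by blast+
  then have "subdeg_ge (int (Suc n)) ((l - (\<Sum>i<Suc n. fls_X ^ i * ?G i))
    - (l - (\<Sum>i<Suc n. fls_X ^ i * ?F i)))"
    unfolding of_nat_0 diff_zero by (rule subdeg_ge_diff)
  also have "(l - (\<Sum>i<Suc n. fls_X ^ i * ?G i)) - (l - (\<Sum>i<Suc n. fls_X ^ i * ?F i)) =
    fls_X ^ n * (?F n - ?G n)"
    using FG by (simp add: algebra_simps)
  finally have "fls_nth (fls_X ^ n * (?F n - ?G n)) (int n) = 0" by (simp add: subdeg_ge_def)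
  then have "fls_nth (?F n - ?G n) 0 = 0" unfolding fls_X_power_times_conv_shift fls_shift_nth by simp
  then have "fls_nth (rat_eval (fps_nth h n) Y1) 0 = fls_nth (rat_eval (fps_nth h n) Y2) 0"
    by (simp add: A.fmap_def B.fmap_def)
  then show ?case using invariant_regular_constant[OF E1 E2 Y1 c Y2] h unfolding polefps_def by blast
qed

lemma invariant_expansion:
  assumes E1: "evalpt Y1" and E2: "evalpt Y2"
    and Y1: "fls_nth Y1 0 = 1" and c: "c \<noteq> 0" and Y2: "fls_nth Y2 0 = zK / cK c"
    and I1: "t_sums 1 (evalpt.fmap Y1 Ifps) w" and I2: "t_sums 1 (evalpt.fmap Y2 Ifps) w"
  shows "polefps d h \<Longrightarrow> t_sums e (evalpt.fmap Y1 h) l \<Longrightarrow> t_sums e (evalpt.fmap Y2 h) l \<Longrightarrow>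
    \<exists>A :: nat \<Rightarrow> K fls. fps_to_fls h = (\<Sum>i\<le>d. embK_fls (A i) * Iinv ^ i)"
proof (induction d arbitrary: h e l)
  interpret A: evalpt Y1 by (rule E1)
  interpret B: evalpt Y2 by (rule E2)
  case 0
  obtain l1 l2 where l12: "t_sums 0 (A.fmap h) l1" "t_sums 0 (B.fmap h) l2"
    using A.fmap_t_sums_ex[OF 0(1)] B.fmap_t_sums_ex[OF 0(1)] by blast
  \<comment> \<open>The limit is given with pole bound \<open>e\<close>; without a pole at 1 the
    bound 0 is available, and uniqueness across bounds identifies the limits.\<close>
  have "l1 = l" "l2 = l" using t_sums_unique l12 0 by blast+
  then have "\<exists>k. fps_nth h n = cK k" for n
    using invariant_no_pole[OF E1 E2 Y1 c Y2 0(1)] l12 by blast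
  then obtain k where k: "\<And>n. fps_nth h n = cK (k n)" by metis
  have "fps_to_fls h = embK_fls (fps_to_fls (Abs_fps k))"
    by (rule fls_eqI) (simp add: embK_nth k cK_hom)
  then show ?case by (intro exI[of _ "\<lambda>_. fps_to_fls (Abs_fps k)"]) simp
next
  interpret A: evalpt Y1 by (rule E1)
  interpret B: evalpt Y2 by (rule E2)
  case (Suc d)
  obtain R where R: "polefps d R" "Ifps ^ Suc d = fps_const (pole1 ^ Suc d) * fps_X ^ Suc d + R"
    using Ifps_power by blast
  have "\<exists>k. pole_bd d (fps_nth h n - cK k * pole1 ^ Suc d)" for n
    using pole_bd_leading Suc.prems(1) unfolding polefps_def by blast
  then obtain k where k: "\<And>n. pole_bd d (fps_nth h n - cK (k n) * pole1 ^ Suc d)" by metis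
  \<comment> \<open>Collects the leading pole coefficients of \<open>h\<close>. They lie in K, so
    \<open>C\<close> evaluates identically at both roots and subtracting a multiple by
    \<open>C\<close> keeps the invariance.\<close>
  define C where "C = Abs_fps (\<lambda>n. cK (k n))"
  have C: "polefps 0 C" by (simp add: C_def polefps_def pole_bd_cK)
  \<comment> \<open>The pole of \<open>I\<close> at \<open>1\<close> carries a factor \<open>t\<close>, hence the power of \<open>fps_X\<close> in front of \<open>h\<close>.\<close>
  define g where "g = fps_X ^ Suc d * h - C * Ifps ^ Suc d"
  have "polefps d (h - C * fps_const (pole1 ^ Suc d))"
    unfolding polefps_def C_def using k by (simp only: fps_sub_nth fps_mult_right_const_nth
      fps_nth_Abs_fps) blast
  then have g1: "polefps d (fps_X ^ Suc d * (h - C * fps_const (pole1 ^ Suc d)))"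
    by (rule polefps_mult'[OF polefps_X_power])
  have "polefps 0 (fps_const (cK (- 1)))" by (rule polefps_const[OF pole_bd_cK])
  then have g2: "polefps d (fps_const (cK (- 1)) * (C * R))" using C R by (intro polefps_mult')
  have m1: "cK (- 1) = - 1" using cK_hom(1)[of 1 "- 1"] by (simp add: cK_hom eq_neg_iff_add_eq_0 add.commute)
  have "g = fps_X ^ Suc d * (h - C * fps_const (pole1 ^ Suc d)) + fps_const (cK (- 1)) * (C * R)"
  proof -
    have "fps_const (cK (- 1)) = - 1" unfolding m1 by (rule fps_ext) simp
    moreover have "X * h - C * (P * X + R) = X * (h - C * P) + - 1 * (C * R)" for X P :: "Kr fps"
      by (simp add: algebra_simps)
    ultimately show ?thesis unfolding g_def R(2) by (simp only:)
  qed
  then have g: "polefps d g" using polefps_add[OF g1 g2] by simp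
  obtain l1 l2 where l12: "t_sums d (A.fmap g) l1" "t_sums d (B.fmap g) l2"
    using A.fmap_t_sums_ex[OF g] B.fmap_t_sums_ex[OF g] by blast
  obtain m where m: "t_sums 0 (A.fmap C) m" using A.fmap_t_sums_ex[OF C] by blast
  have CC: "B.fmap C = A.fmap C" by (rule fps_ext) (simp add: A.fmap_def B.fmap_def C_def A.ev_cK B.ev_cK)
  have pow: "t_sums n (F ^ n) (f ^ n)" if "t_sums 1 F f" for F :: "Kr fls fps" and f n
  proof (induction n)
    case 0
    have "t_sums 0 (fps_const 1) (1 :: Kr fls)" by (rule tconv0(3)[OF subdeg_ge_1])
    then show ?case by simp
  next
    case (Suc n) show ?case using t_sums_mult[OF that Suc] by simp
  qed
  have powX: "t_sums 0 (fps_X ^ n) (fls_X ^ n :: Kr fls)" for n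
  proof (induction n)
    case 0
    have "t_sums 0 (fps_const 1) (1 :: Kr fls)" by (rule tconv0(3)[OF subdeg_ge_1])
    then show ?case by simp
  next
    case (Suc n) show ?case using tconv0(1)[OF t_sums_X Suc] by simp
  qed
  have diff: "t_sums n (F - G) (f - f')" if F: "t_sums n F f" and G: "t_sums n G f'"
    for F G :: "Kr fls fps" and f f' n
  proof -
    have "t_sums 0 (fps_const (- 1)) (- 1 :: Kr fls)" by (rule tconv0(3)[OF subdeg_ge_uminus[OF subdeg_ge_1]])
    from t_sums_mult[OF this G] have "t_sums n (fps_const (- 1) * G) (- 1 * f')" by (simp only: add_0)
    from t_sums_add[OF F this] have "t_sums n (F + fps_const (- 1) * G) (f + - 1 * f')" .
    moreover have "fps_const (- 1) * G = - G" by (rule fps_ext) simp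
    ultimately show ?thesis by simp
  qed
  have lim: "t_sums (e + Suc d) (X ^ Suc d * F - P * Q ^ Suc d) (fls_X ^ Suc d * l - m * w ^ Suc d)"
    if "t_sums e F l" "t_sums 0 P m" "t_sums 1 Q w" and X: "X = fps_X" for F P Q X :: "Kr fls fps"
    using t_sums_weaken[OF t_sums_mult[OF powX[of "Suc d"] that(1)], of "e + Suc d"]
      t_sums_weaken[OF t_sums_mult[OF that(2) pow[OF that(3), of "Suc d"]], of "e + Suc d"]
    unfolding X by (intro diff) simp_all
  \<comment> \<open>The value of \<open>g\<close> is computed from those of \<open>h\<close>,
    \<open>C\<close> and I, all of which agree at the two points; \<open>g\<close> is therefore an
    invariant of pole order at most \<open>d\<close>.\<close>
  have "t_sums (e + Suc d) (A.fmap g) (fls_X ^ Suc d * l - m * w ^ Suc d)"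
    unfolding g_def A.fmap_minus A.fmap_hom(2) A.fmap_power by (rule lim[OF Suc.prems(2) m I1 A.fmap_hom(4)])
  then have 1: "l1 = fls_X ^ Suc d * l - m * w ^ Suc d" using t_sums_unique l12(1) by blast
  have "t_sums (e + Suc d) (B.fmap g) (fls_X ^ Suc d * l - m * w ^ Suc d)"
    unfolding g_def B.fmap_minus B.fmap_hom(2) B.fmap_power
      by (rule lim[OF Suc.prems(3) m[folded CC] I2 B.fmap_hom(4)])
  then have 2: "l2 = fls_X ^ Suc d * l - m * w ^ Suc d" using t_sums_unique l12(2) by blast
  obtain A where A: "fps_to_fls g = (\<Sum>i\<le>d. embK_fls (A i) * Iinv ^ i)"
    using Suc.IH[OF g] l12 1 2 by blast
  have CE: "fps_to_fls C = embK_fls (fps_to_fls (Abs_fps k))"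
    by (rule fls_eqI) (simp add: embK_nth C_def cK_hom)
  have "fps_to_fls g = fls_X ^ Suc d * fps_to_fls h - fps_to_fls C * Iinv ^ Suc d"
    unfolding g_def Iinv_Ifps by (simp only: fps_to_fls_minus fls_times_fps_to_fls fps_to_fls_power
      fps_X_to_fls)
  then have e1: "fls_X ^ Suc d * fps_to_fls h = (\<Sum>i\<le>d. embK_fls (A i) * Iinv ^ i)
    + embK_fls (fps_to_fls (Abs_fps k)) * Iinv ^ Suc d"
    unfolding A CE by (simp add: algebra_simps)
  let ?s = "fls_X_intpow (- int (Suc d)) :: Kr fls"
  \<comment> \<open>Divides the expansion of \<open>g\<close> plus \<open>C\<close> times the top
    power of I by t^(d+1). Negative powers of t are admissible since the coefficients are Laurent
    series.\<close>
  define A' where "A' i = fls_X_intpow (- int (Suc d)) *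
    (if i \<le> d then A i else fps_to_fls (Abs_fps k))" for i
  have "fps_to_fls h = ?s * (fls_X ^ Suc d * fps_to_fls h)"
    unfolding fls_X_power_times_conv_shift fls_X_intpow_times_conv_shift by simp
  also have "\<dots> = (\<Sum>i\<le>Suc d. embK_fls (A' i) * Iinv ^ i)"
    unfolding e1 A'_def embK_shift[symmetric] by (simp add: distrib_left sum_distrib_left mult.assoc)
  finally show ?case by blast
qed

theorem theorem8p1:
  fixes Y1 Y2 :: "Kr fps" and H :: "Kr fls" and d :: nat
  assumes Y1_0: "fps_nth Y1 0 = 1"
    and Y2_0: "fps_nth Y2 0 = zK / cK (wK * (nuK - 1))"
    and Y1_ker: "kernel (1 + fls_X * fls_const zK) (fps_to_fls Y1) = 0"
    and Y2_ker: "kernel (1 + fls_X * fls_const zK) (fps_to_fls Y2) = 0"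
    and H_val: "\<forall>n. \<exists>a b. poly b 1 \<noteq> 0 \<and> fls_nth H n = Fract a (b * [:-1, 1:] ^ d)"
  shows "subst_wd H (fps_to_fls Y1) \<and> subst_wd H (fps_to_fls Y2) \<and>
         (subst H (fps_to_fls Y1) = subst H (fps_to_fls Y2) \<longrightarrow>
           (\<exists>A :: nat \<Rightarrow> K fls. H = (\<Sum>i\<le>d. embK_fls (A i) * Iinv ^ i)))"
proof -
  let ?Y1 = "fps_to_fls Y1" and ?Y2 = "fps_to_fls Y2"
  define c where "c = wK * (nuK - 1)"
  have c: "c \<noteq> 0" unfolding c_def by (rule wnu_nonzero)
  have v: "subdeg_ge 0 ?Y1" "subdeg_ge 0 ?Y2" by (rule subdeg_ge_fps)+
  have n: "fls_nth ?Y1 0 = 1" "fls_nth ?Y2 0 = zK / cK c" using Y1_0 Y2_0 by (simp_all add: c_def)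
  have E1: "evalpt ?Y1" by (rule evalpt_near_1[OF v(1) n(1) kernel_root_near_1[OF v(1) n(1) Y1_ker]])
  have E2: "evalpt ?Y2" by (rule evalpt_transcendental[OF v(2) c n(2)])
  interpret A: evalpt ?Y1 by (rule E1)
  interpret B: evalpt ?Y2 by (rule E2)
  have H: "\<And>n. pole_bd d (fls_nth H n)" using H_val unfolding pole_bd_def by blast
  \<comment> \<open>The power of t extracted from \<open>H\<close> is not affected by substituting
    for y, so \<open>H\<close> takes equal values at both roots exactly when \<open>h\<close>
    does.\<close>
  define h where "h = Abs_fps (\<lambda>j. fls_nth H (fls_subdegree H + int j))"
  have h: "polefps d h" using H by (simp add: polefps_def h_def)
  obtain l1 l2 where l: "t_sums d (A.fmap h) l1" "t_sums d (B.fmap h) l2"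
    using A.fmap_t_sums_ex[OF h] B.fmap_t_sums_ex[OF h] by blast
  have S: "subst H ?Y1 = fls_X_intpow (fls_subdegree H) * l1"
    "subst H ?Y2 = fls_X_intpow (fls_subdegree H) * l2"
    using A.subst_pole_bd(2)[OF H] B.subst_pole_bd(2)[OF H] l unfolding h_def by blast+
  have "\<exists>A :: nat \<Rightarrow> K fls. H = (\<Sum>i\<le>d. embK_fls (A i) * Iinv ^ i)" if eq: "subst H ?Y1 = subst H ?Y2"
  proof -
    have "l1 = l2" using eq unfolding S by (simp del: fls_X_intpow_times_conv_shift)
    obtain A1 A2 B where lim: "t_sums 0 (Mser 1 ?Y1) A1" "t_sums 0 (Mser 1 ?Y2) A2" "t_sums 0 (Mser Xs 1) B"
      using Mser_t_sums_ex[OF subdeg_ge_1 v(1)] Mser_t_sums_ex[OF subdeg_ge_1 v(2)]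
        Mser_t_sums_ex[OF subdeg_ge_Xs subdeg_ge_1] by blast
    have ne: "?Y1 \<noteq> 0" "?Y1 \<noteq> 1" "?Y2 \<noteq> 0" "?Y2 \<noteq> 1"
    proof -
      show "?Y1 \<noteq> 0" "?Y2 \<noteq> 0" using A.nz[of "[:0, 1:]"] B.nz[of "[:0, 1:]"] by simp_all
      show "?Y1 \<noteq> 1" using kernel_root_near_1[OF v(1) n(1) Y1_ker] by auto
      have "zK / cK c \<noteq> 1" using zK_neq_cK[of c] c cK_0_iff by auto
      then show "?Y2 \<noteq> 1" using n(2) by auto
    qed
    have "Xs * Ival A1 ?Y1 = Xs * Ival A2 ?Y2"
      unfolding kernel_root_invariant[OF v(1) ne(1,2) Y1_ker lim(1,3)]
        kernel_root_invariant[OF v(2) ne(3,4) Y2_ker lim(2,3)] ..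
    then have w: "Ival A2 ?Y2 = Ival A1 ?Y1" using Xs_minus_1(3) by simp
    obtain A :: "nat \<Rightarrow> K fls" where A: "fps_to_fls h = (\<Sum>i\<le>d. embK_fls (A i) * Iinv ^ i)"
      using invariant_expansion[OF E1 E2 n(1) c n(2) A.Ifps_value[OF lim(1)] B.Ifps_value[OF lim(2),
        unfolded w] h l(1)]
        l(2) \<open>l1 = l2\<close> by blast
    have "H = fls_X_intpow (fls_subdegree H) * fps_to_fls h"
      unfolding fls_X_intpow_times_conv_shift
      by (rule fls_eqI) (auto simp: h_def fls_eq0_below_subdegree)
    also have "\<dots> = (\<Sum>i\<le>d. embK_fls (fls_X_intpow (fls_subdegree H) * A i) * Iinv ^ i)"
      unfolding A embK_shift[symmetric] by (simp only: sum_distrib_left mult.assoc)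
    finally have "H = (\<Sum>i\<le>d. embK_fls (fls_X_intpow (fls_subdegree H) * A i) * Iinv ^ i)" .
    then show ?thesis by (intro exI[of _ "\<lambda>i. fls_X_intpow (fls_subdegree H) * A i"])
  qed
  then show ?thesis using A.subst_pole_bd(1)[OF H] B.subst_pole_bd(1)[OF H] by blast
qed

end
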